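(* Assume that $A$ contains only primitive columns and let $C^1\subseteq M$ be a circuit. Let $B^*\subseteq A$ be linearly independent with $\frac12\sum_{\mathbf{a}\in B^*}\mathbf{a}\in\mathbb{Z}^m$, having minimum cardinality $|B^*|$ among all subsets of $A$ with these two properties, and assume that $$B^*=\left[\mathbf{e}^1\,|\,\cdots\,|\,\mathbf{e}^{|B^*|-1}\,|\,\mathbf{e}^1+\cdots+\mathbf{e}^{|B^*|-1}+2\mathbf{e}^{|B^*|}\right].$$ (i) If $|B^*|=2$, then $C^1=[C^*\,|\,\mathbf{b}\,|\,\mathbf{b}+2\mathbf{e}^1_{m-1}]$ for some $\mathbf{b}\in A/\mathbf{e}^1$. Furthermore, $C^1$ is the unique circuit in $M$, so $|M|\le m$. (ii) If $|B^*|=3$, then $C^1=[C^*\,|\,\mathbf{b}\,|\,\mathbf{b}+\mathbf{d}]$ for some $\mathbf{b}\in A/\mathbf{e}^1$ and $\mathbf{d}\in D^*$. Furthermore, $C^1$ is the unique circuit in $M$, so $|M|\le m$. (iii) If $|B^*|=4$, then either $C^1=C^*$, or $|C^1\cap C^*|=2$ and $|C^1|=4$. Moreover, if $M$ contains multiple circuits, say $C^1\neq C^*$, then $M$ contains precisely three circuits: $C^1$, $C^*$, and the symmetric difference $C^1\triangle C^*$. Regardless of the number of circuits, $|M|\le m+1$.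
   Context: Conventions. A matrix is treated as the multiset of its columns (so $\in,\subseteq,\setminus,\cup,\cap,\triangle,\operatorname{span}$ refer to columns), and $[\cdot|\cdot]$ denotes concatenation of columns or matrices. $\mathbf{e}^i$ is the $i$th standard unit vector of $\mathbb{R}^m$ and $\mathbf{e}^i_t$ that of $\mathbb{R}^t$. For a scalar $\beta$ and $\mathbf{b}\in\mathbb{Z}^{m-1}$, $(\beta,\mathbf{b})\in\mathbb{Z}^m$ is the stacked column. Two vectors differ if $\mathbf{a}\neq\pm\overline{\mathbf{a}}$; a multiset has differing columns if its members pairwise differ and it does not contain $\mathbf{0}$. For matrices with differing columns, $|X|$ is the number of columns. An integer matrix with $m$ rows and rank $m$ is bimodular if all its $m\times m$ minors are at most $2$ in absolute value. A bimodular matrix $B$ with differing columns is maximal if there is no bimodular matrix $B'\supsetneq B$ with differing columns. An integer vector is primitive if the gcd of its entries is $1$. A circuit is an inclusion-wise minimal linearly dependent set of columns. Standing assumptions. $A$ is a maximal bimodular integer matrix with $m$ rows, rank $m$ and differing columns, with $\mathbf{e}^1\in A$, written as $$A=\begin{bmatrix}1&\boldsymbol\beta^\intercal\\ \mathbf{0}&\hat A\end{bmatrix}.$$ Columns of $A$ have been multiplied by $-1$ where necessary so that whenever two columns $\mathbf{b},\mathbf{c}$ of $\hat A$ do not differ, $\mathbf{b}=\mathbf{c}$. $A/\mathbf{e}^1$ denotes the unique maximal set of differing columns of $\hat A$ (its set of distinct nonzero columns). For $\mathbf{b}\in\mathbb{Z}^{m-1}$ let $O(\mathbf{b}):=\{(\beta,\mathbf{b})\in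 A\}$, and let $$M:=\{\mathbf{b}\in A/\mathbf{e}^1 : |O(\mathbf{b})|\ge 2\}.$$ Given $B^*$ as in the claim, the signs of the columns of $A$ are moreover chosen (which is possible) so that $$A\cap\operatorname{span}B^*\subseteq B^*\cup\left\{\mathbf{e}^{|B^*|}+\sum_{i=1}^{|B^*|-1}\alpha_i\mathbf{e}^i : \alpha_1,\dots,\alpha_{|B^*|-1}\in\{0,1\}\right\}.$$ Define $$C^*:=\left\{\mathbf{e}^{|B^*|-1}_{m-1}+\sum_{i=1}^{|B^*|-2}\alpha_i\mathbf{e}^i_{m-1} : \alpha_1,\dots,\alpha_{|B^*|-2}\in\{0,1\}\right\},$$ $$D^*:=\left[\mathbf{e}^1_{m-1}\,|\,\cdots\,|\,\mathbf{e}^{|B^*|-2}_{m-1}\,|\,\mathbf{e}^1_{m-1}+\cdots+\mathbf{e}^{|B^*|-2}_{m-1}+2\mathbf{e}^{|B^*|-1}_{m-1}\right].$$ In particular $M\cap\operatorname{span}D^*\subseteq C^*$.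
   Formalization: In (i) and (ii) the two columns b and b+2e^1 (resp. b+d) of C^1 are taken up to multiplication by -1, since the sign conventions leave these signs free and the literal equality can fail; B* and the sets it competes with for minimum cardinality are required to be nonempty. *)

theory Defs
  imports
    "HOL-Library.Multiset"
    "Jordan_Normal_Form.DL_Rank"
    "Jordan_Normal_Form.DL_Submatrix"
begin

definition differ :: "int vec \<Rightarrow> int vec \<Rightarrow> bool" where
  "differ a b \<longleftrightarrow> a \<noteq> b \<and> a \<noteq> - b"

definition differing_columns :: "int mat \<Rightarrow> bool" where
  "differing_columns A \<longleftrightarrow>
     (\<forall>i < dim_col A. \<forall>j < dim_col A. i \<noteq> j \<longrightarrow> differ (col A i) (col A j)) \<and>
     0\<^sub>v (dim_row A) \<notin> set (cols A)"

definition bimodular :: "int mat \<Rightarrow> bool" where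
  "bimodular A \<longleftrightarrow>
     vec_space.rank (dim_row A) (map_mat real_of_int A) = dim_row A \<and>
     (\<forall>J \<subseteq> {..<dim_col A}. card J = dim_row A \<longrightarrow> \<bar>det (submatrix A UNIV J)\<bar> \<le> 2)"

definition maximal_bimodular :: "int mat \<Rightarrow> bool" where
  "maximal_bimodular A \<longleftrightarrow>
     bimodular A \<and> differing_columns A \<and>
     \<not> (\<exists>A'. dim_row A' = dim_row A \<and> bimodular A' \<and> differing_columns A' \<and>
             mset (cols A) \<subset># mset (cols A'))"

definition primitive :: "int vec \<Rightarrow> bool" where
  "primitive v \<longleftrightarrow> Gcd (vec_set v) = 1"

text \<open>Linear dependence and span of integer vectors are taken over the reals.\<close>

definition real_vecs :: "int vec set \<Rightarrow> real vec set" where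
  "real_vecs X = map_vec real_of_int ` X"

definition lin_dependent :: "nat \<Rightarrow> int vec set \<Rightarrow> bool" where
  "lin_dependent n X \<longleftrightarrow>
     LinearCombinations.module.lin_dep class_ring (module_vec TYPE(real) n) (real_vecs X)"

definition in_span :: "nat \<Rightarrow> int vec \<Rightarrow> int vec set \<Rightarrow> bool" where
  "in_span n v X \<longleftrightarrow>
     map_vec real_of_int v \<in>
       LinearCombinations.module.span class_ring (module_vec TYPE(real) n) (real_vecs X)"

definition circuit :: "nat \<Rightarrow> int vec set \<Rightarrow> bool" where
  "circuit n C \<longleftrightarrow> lin_dependent n C \<and> (\<forall>C' \<subset> C. \<not> lin_dependent n C')"

text \<open>
  The columns of \<open>A\<close> without the first entry, up to repetition and without the zero column.
  This is the maximal set of differing columns only under the assumption \<open>aligned_signs A\<close>.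
\<close>

definition contraction :: "int mat \<Rightarrow> int vec set" where
  "contraction A = {b. b \<noteq> 0\<^sub>v (dim_vec b) \<and> (\<exists>\<beta>. vCons \<beta> b \<in> set (cols A))}"

definition aligned_signs :: "int mat \<Rightarrow> bool" where
  "aligned_signs A \<longleftrightarrow>
     (\<forall>\<beta> \<gamma> b c. vCons \<beta> b \<in> set (cols A) \<and> vCons \<gamma> c \<in> set (cols A) \<and> \<not> differ b c
        \<longrightarrow> b = c)"

definition fiber :: "int mat \<Rightarrow> int vec \<Rightarrow> int vec set" where
  "fiber A b = {a \<in> set (cols A). \<exists>\<beta>. a = vCons \<beta> b}"

definition multiple_fibers :: "int mat \<Rightarrow> int vec set" where
  "multiple_fibers A = {b \<in> contraction A. card (fiber A b) \<ge> 2}"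

text \<open>
  The empty set is linearly independent and its half-sum is integral, so it has to be excluded
  for the minimum-cardinality condition to be meaningful.
\<close>

definition half_integral_indep :: "int mat \<Rightarrow> int vec set \<Rightarrow> bool" where
  "half_integral_indep A B \<longleftrightarrow>
     B \<noteq> {} \<and> B \<subseteq> set (cols A) \<and> \<not> lin_dependent (dim_row A) B \<and>
     (1 / 2 :: real) \<cdot>\<^sub>v finsum_vec TYPE(real) (dim_row A) (map_vec real_of_int) B
       \<in> map_vec real_of_int ` carrier_vec (dim_row A)"

definition min_half_integral_indep :: "int mat \<Rightarrow> int vec set \<Rightarrow> bool" where
  "min_half_integral_indep A B \<longleftrightarrow>
     half_integral_indep A B \<and> (\<forall>B'. half_integral_indep A B' \<longrightarrow> card B \<le> card B')"

text \<open>
  Unit vectors are indexed from 0. For \<open>k \<ge> 1\<close>, \<open>half_basis n k\<close> consists of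
  \<open>e\<^sup>1, \<dots>, e\<^sup>k\<^sup>-\<^sup>1\<close> and \<open>e\<^sup>1 + \<dots> + e\<^sup>k\<^sup>-\<^sup>1 + 2 e\<^sup>k\<close> in dimension \<open>n\<close>, and \<open>cube n k\<close> of all
  \<open>e\<^sup>k + \<alpha>\<^sub>1 e\<^sup>1 + \<dots> + \<alpha>\<^sub>k\<^sub>-\<^sub>1 e\<^sup>k\<^sup>-\<^sup>1\<close> with coefficients in \<open>{0, 1}\<close>.
  With \<open>k = |B\<^sup>*|\<close> one has \<open>B\<^sup>* = half_basis m k\<close>, \<open>D\<^sup>* = half_basis (m - 1) (k - 1)\<close> and
  \<open>C\<^sup>* = cube (m - 1) (k - 1)\<close>.
\<close>

definition half_basis :: "nat \<Rightarrow> nat \<Rightarrow> int vec set" where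
  "half_basis n k =
     unit_vec n ` {..<k - 1} \<union>
     {finsum_vec TYPE(int) n (unit_vec n) {..<k - 1} + 2 \<cdot>\<^sub>v unit_vec n (k - 1)}"

definition cube :: "nat \<Rightarrow> nat \<Rightarrow> int vec set" where
  "cube n k =
     {unit_vec n (k - 1) + finsum_vec TYPE(int) n (\<lambda>i. \<alpha> i \<cdot>\<^sub>v unit_vec n i) {..<k - 1} | \<alpha>.
       \<forall>i. \<alpha> i \<in> {0, 1}}"

text \<open>
  The multiset equation says \<open>C = [X | b | b + d]\<close> where the last two columns are read up to
  multiplication by -1: apart from the columns in the span of \<open>B\<^sup>*\<close>, the standing conventions
  leave the sign of each class of columns free.
\<close>

definition extends_by_pair ::
    "int vec set \<Rightarrow> int vec set \<Rightarrow> int vec set \<Rightarrow> int vec \<Rightarrow> bool" where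
  "extends_by_pair V C X d \<longleftrightarrow>
     (\<exists>b. \<exists>\<sigma> \<in> {1, -1}. \<exists>\<tau> \<in> {1, -1}. \<sigma> \<cdot>\<^sub>v b \<in> V \<and>
        mset_set C = mset_set X + {# \<sigma> \<cdot>\<^sub>v b, \<tau> \<cdot>\<^sub>v (b + d) #})"

end

theory Submission
  imports Defs "HOL-Library.Function_Algebras"
begin

text \<open>
Write \<open>e\<close> for the first unit vector and \<open>k\<close> for the cardinality of \<open>B\<^sup>*\<close>. An element of \<open>M\<close> is a vector
\<open>b\<close> with two lifts \<open>a\<close> and \<open>a + \<delta> e\<close> in \<open>A\<close>, where \<open>\<delta> \<ge> 1\<close>. A circuit in \<open>M\<close> is therefore a minimal
set of lifts that is linearly dependent modulo \<open>e\<close>.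

Everything rests on one estimate. Let \<open>S\<close> be a basis of columns of \<open>A\<close> that contains \<open>e\<close>. It generates
a lattice of index 1 or 2 in \<open>\<int>\<^sup>m\<close>, and by Cramer's rule the coordinates of every column of \<open>A\<close> are at
most 2 in absolute value, at most 1 if the index is 2. Exchanging the lifts of the members of \<open>M\<close>
changes no coordinate except the one at \<open>e\<close>, and the choices add up: if \<open>r \<in> M\<close> has coordinates
\<open>x\<^sub>b\<close> at lifts \<open>b\<close> in \<open>S\<close>, then the \<open>e\<close>-coordinate varies over a range of width at least
\<open>1 + \<Sum> \<bar>x\<^sub>b\<bar>\<close>, so this number is at most 4, and at most 2 for index 2 (\<open>sum_coords_bound\<close>).

A basis containing \<open>B\<^sup>*\<close> has index 2, because half the sum of \<open>B\<^sup>*\<close> is integral. Choose it to contain as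
many lifts outside \<open>span B\<^sup>*\<close> as possible. The bound 2 forces every member of \<open>M\<close> outside \<open>span B\<^sup>*\<close> to be,
up to sign and modulo \<open>span B\<^sup>*\<close>, exactly one of the chosen lifts; this sorts these members into classes.
The estimate is then an equality, and that makes them integral over the basis (\<open>outside_span_B\<close>).

For a circuit, the bound 4 yields an integral relation with nonzero coefficients of total absolute value
at most 4. A circuit outside \<open>span B\<^sup>*\<close> would live in a lattice of index 2, where the bound 2 leaves no
room for it, so every circuit meets \<open>span B\<^sup>*\<close>, that is, \<open>C\<^sup>*\<close> (\<open>circuit_coeffs\<close>). In each class the
coefficients, taken with the signs, cancel. Hence a circuit that is not contained in \<open>C\<^sup>*\<close> consists of
two members of one class with coefficients \<open>\<plusminus>1\<close> and of members of \<open>C\<^sup>*\<close> of total weight at most 2: one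
vector, necessarily with coefficient \<open>\<plusminus>2\<close>, or two vectors with coefficients \<open>\<plusminus>1\<close>
(\<open>circuit_cases\<close>). In the first case suitable lifts of the two class members have an integral half-sum,
so \<open>k = 2\<close> by minimality. Minimality also shows for \<open>k \<ge> 3\<close> that the difference of two members of a class
has exactly one odd coordinate along \<open>B\<^sup>* - {e}\<close>. For three members, one of the differences is, up to
signs, the sum of the other two, and then it would have none or two odd coordinates; so a class has at
most two members (\<open>class_size\<close>).

The rest is circuit elimination. For \<open>k = 2\<close> and \<open>k = 3\<close> all circuits share a vector of \<open>C\<^sup>*\<close>, and two
circuits with a common vector would produce one avoiding it; so the circuit is unique. For \<open>k = 4\<close> a circuit
is \<open>C\<^sup>*\<close> or a pair of \<open>C\<^sup>*\<close> together with a class of two elements, and elimination leaves at most one class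
and complementary pairs (\<open>three_circuits\<close>). One or two vectors hit all circuits, and \<open>M\<close> without them is
independent in \<open>\<real>\<^bsup>m-1\<^esup>\<close>, which bounds its cardinality.
\<close>

section \<open>Lattices of index at most two\<close>

text \<open>
A basis given as an indexed family, so that replacing columns by shifted lifts keeps the index set.
\<close>

definition (in vector_space) frame :: "'b set \<Rightarrow> 'c set \<Rightarrow> ('c \<Rightarrow> 'b) \<Rightarrow> bool" where
  "frame A I p \<longleftrightarrow> finite I \<and> card I = dim A \<and> p ` I \<subseteq> A \<and>
     (\<forall>x. (\<Sum>i\<in>I. scale (x i) (p i)) = 0 \<longrightarrow> (\<forall>i\<in>I. x i = 0))"

text \<open>
The determinant bound enters the argument only through the coordinates of vectors with respect to
bases consisting of columns. \<open>Z\<close> stands for the integral vectors. The last two assumptions say that a basis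
generates a sublattice of \<open>Z\<close> of index at most 2: all denominators divide 2, and any two vectors of \<open>Z\<close>
outside the sublattice are congruent modulo it.
\<close>

locale bimodular_system = vector_space scale
  for scale :: "real \<Rightarrow> 'v::ab_group_add \<Rightarrow> 'v" (infixr "*s" 75) +
  fixes A Z :: "'v set"
  assumes finite_A: "finite A"
    and A_subset_Z: "A \<subseteq> Z"
    and Z_diff: "u \<in> Z \<Longrightarrow> v \<in> Z \<Longrightarrow> u - v \<in> Z"
    and Z_subset_span: "Z \<subseteq> span A"
    and coord_le_2:
      "frame A I p \<Longrightarrow> a \<in> A \<Longrightarrow> a = (\<Sum>i\<in>I. x i *s p i) \<Longrightarrow> i \<in> I \<Longrightarrow> \<bar>x (i::'v)\<bar> \<le> 2"
    and coord_le_1: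
      "frame A I p \<Longrightarrow> z \<in> Z \<Longrightarrow> z = (\<Sum>i\<in>I. y i *s p i) \<Longrightarrow> j \<in> I \<Longrightarrow> y (j::'v) \<notin> \<int> \<Longrightarrow>
       a \<in> A \<Longrightarrow> a = (\<Sum>i\<in>I. x i *s p i) \<Longrightarrow> i \<in> I \<Longrightarrow> \<bar>x i\<bar> \<le> 1"
    and coord_half_integral:
      "frame A I p \<Longrightarrow> z \<in> Z \<Longrightarrow> z = (\<Sum>i\<in>I. y i *s p i) \<Longrightarrow> i \<in> I \<Longrightarrow> 2 * y (i::'v) \<in> \<int>"
    and coord_index_2:
      "frame A I p \<Longrightarrow> z \<in> Z \<Longrightarrow> z = (\<Sum>i\<in>I. y i *s p i) \<Longrightarrow> j \<in> I \<Longrightarrow> y (j::'v) \<notin> \<int> \<Longrightarrow>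
       z' \<in> Z \<Longrightarrow> z' = (\<Sum>i\<in>I. y' i *s p i) \<Longrightarrow> j' \<in> I \<Longrightarrow> y' j' \<notin> \<int> \<Longrightarrow>
       i \<in> I \<Longrightarrow> y i - y' i \<in> \<int>"
begin

definition basis :: "'v set \<Rightarrow> bool" where
  "basis S \<longleftrightarrow> S \<subseteq> A \<and> independent S \<and> A \<subseteq> span S"

definition integral_over :: "'v set \<Rightarrow> 'v \<Rightarrow> bool" where
  "integral_over S v \<longleftrightarrow> (\<forall>s. representation S v s \<in> \<int>)"

lemma Z_closed:
  assumes "x \<in> Z" "y \<in> Z"
  shows "0 \<in> Z" "- x \<in> Z" "x + y \<in> Z"
proof -
  show 0: "0 \<in> Z" using Z_diff[OF assms(1,1)] by simp
  show "- x \<in> Z" using Z_diff[OF 0 assms(1)] by simp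
  have "- y \<in> Z" using Z_diff[OF 0 assms(2)] by simp
  then show "x + y \<in> Z" using Z_diff[OF assms(1)] by fastforce
qed

lemma Z_of_int:
  assumes "x \<in> Z"
  shows "of_int n *s x \<in> Z"
proof -
  have nat: "of_nat k *s x \<in> Z" for k
    by (induction k) (auto simp: scale_left_distrib Z_closed[OF assms assms] Z_closed(3)[OF assms])
  show ?thesis
  proof (cases "n \<ge> 0")
    case True
    then show ?thesis using nat[of "nat n"] by simp
  next
    case False
    then show ?thesis using nat[of "nat (- n)"] Z_closed(2)[OF nat nat, of "nat (- n)"] by simp
  qed
qed

lemma Z_sum: "finite I \<Longrightarrow> I \<noteq> {} \<Longrightarrow> (\<And>i. i \<in> I \<Longrightarrow> f i \<in> Z) \<Longrightarrow> sum f I \<in> Z"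
  by (induction I rule: finite_ne_induct) (auto intro: Z_closed)

lemma basis_finite: "basis S \<Longrightarrow> finite S"
  using finite_A finite_subset by (auto simp: basis_def)

lemma basis_span:
  assumes "basis S" "v \<in> Z"
  shows "v \<in> span S"
proof -
  have "span A \<subseteq> span S" using assms(1) by (simp add: basis_def span_minimal)
  then show ?thesis using assms(2) Z_subset_span by blast
qed

lemma basis_expansion: "basis S \<Longrightarrow> v \<in> Z \<Longrightarrow> v = (\<Sum>s\<in>S. representation S v s *s s)"
  using sum_representation_eq[of S v S] basis_span[of S v] basis_finite[of S]
  by (auto simp: basis_def)

lemma basis_extend:
  assumes "independent T" "T \<subseteq> A" "basis V"
  obtains S where "basis S" "T \<subseteq> S" "S \<subseteq> V \<union> T"
proof -
  obtain S where S: "T \<subseteq> S" "S \<subseteq> V \<union> T" "independent S" "V \<union> T \<subseteq> span S"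
    using maximal_independent_subset_extend[of T "V \<union> T"] assms(1) by auto
  have "span V \<subseteq> span S" using S(4) by (simp add: span_minimal)
  then have "basis S" using S assms(2,3) by (auto simp: basis_def)
  then show thesis using that S by blast
qed

lemma basis_card: "basis S \<Longrightarrow> card S = dim A"
  using basis_card_eq_dim[of S A] by (auto simp: basis_def)

text \<open>
Adding multiples of \<open>e\<close> to the other basis vectors is a unipotent change of basis; it transforms
the coordinates as in \<open>coords_shift\<close>, where only the one at \<open>e\<close> changes.
\<close>

lemma frame_shift:
  assumes S: "basis S" and e: "e \<in> S" "\<tau> e = 0"
    and A: "\<And>s. s \<in> S \<Longrightarrow> s + \<tau> s *s e \<in> A"
  shows "frame A S (\<lambda>s. s + \<tau> s *s e)"
proof -
  have fin: "finite S" by (rule basis_finite[OF S])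
  have expand: "(\<Sum>s\<in>S. x s *s (s + \<tau> s *s e)) =
      (\<Sum>s\<in>S. (x s + (if s = e then \<Sum>s\<in>S. x s * \<tau> s else 0)) *s s)" for x
  proof -
    have "(\<Sum>s\<in>S. x s *s (s + \<tau> s *s e)) = (\<Sum>s\<in>S. x s *s s) + (\<Sum>s\<in>S. x s * \<tau> s) *s e"
      by (simp add: scale_right_distrib sum.distrib scale_sum_left)
    also have "(\<Sum>s\<in>S. x s * \<tau> s) *s e =
        (\<Sum>s\<in>S. if s = e then (\<Sum>s\<in>S. x s * \<tau> s) *s s else 0)"
      using fin e by simp
    also have "(\<Sum>s\<in>S. x s *s s) + \<dots> =
        (\<Sum>s\<in>S. (x s + (if s = e then \<Sum>s\<in>S. x s * \<tau> s else 0)) *s s)"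
      by (subst sum.distrib[symmetric], rule sum.cong) (auto simp: scale_left_distrib)
    finally show ?thesis .
  qed
  have "\<forall>s\<in>S. x s = 0" if zero: "(\<Sum>s\<in>S. x s *s (s + \<tau> s *s e)) = 0" for x
  proof -
    have ind: "\<not> dependent S" using S by (simp add: basis_def)
    have *: "x s + (if s = e then \<Sum>s\<in>S. x s * \<tau> s else 0) = 0" if "s \<in> S" for s
      using independentD[OF ind fin subset_refl zero[unfolded expand]] that by blast
    have ne: "x s = 0" if "s \<in> S" "s \<noteq> e" for s
      using *[OF that(1)] that(2) by simp
    then have "x s * \<tau> s = 0" if "s \<in> S" for s
      using e(2) that by (cases "s = e") auto
    then have sum0: "(\<Sum>s\<in>S. x s * \<tau> s) = 0" by (rule sum.neutral[OF ballI])
    have "x e = 0" using *[OF e(1)] unfolding sum0 by simp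
    then show ?thesis using ne by metis
  qed
  then show ?thesis
    using fin A basis_card[OF S] by (auto simp: frame_def)
qed

lemma coords_shift:
  assumes S: "basis S" and e: "e \<in> S" "\<tau> e = 0" and v: "v \<in> Z"
  shows "v + t *s e = (\<Sum>s\<in>S. (representation S v s +
      (if s = e then t - (\<Sum>u\<in>S. representation S v u * \<tau> u) else 0)) *s (s + \<tau> s *s e))"
    (is "_ = ?R")
proof -
  have fin: "finite S" by (rule basis_finite[OF S])
  let ?x = "representation S v"
  let ?q = "\<Sum>u\<in>S. ?x u * \<tau> u"
  have "?R = (\<Sum>s\<in>S. ?x s *s s) + (\<Sum>s\<in>S. (?x s * \<tau> s) *s e) +
      (\<Sum>s\<in>S. if s = e then (t - ?q) *s e else 0)"
    unfolding sum.distrib[symmetric]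
    by (rule sum.cong) (auto simp: algebra_simps e(2))
  also have "\<dots> = v + ?q *s e + (t - ?q) *s e"
    using basis_expansion[OF S v] fin e(1) by (simp add: scale_sum_left)
  also have "\<dots> = v + t *s e" by (simp add: algebra_simps)
  finally show ?thesis by simp
qed

lemma integral_over_sum:
  assumes "basis S" "\<And>i. i \<in> I \<Longrightarrow> v i \<in> Z" "\<And>i. i \<in> I \<Longrightarrow> integral_over S (v i)"
    "\<And>i. i \<in> I \<Longrightarrow> c i \<in> \<int>"
  shows "integral_over S (\<Sum>i\<in>I. c i *s v i)"
proof -
  have ind: "independent S" using assms(1) by (simp add: basis_def)
  have "representation S (\<Sum>i\<in>I. c i *s v i) = (\<lambda>s. \<Sum>i\<in>I. c i * representation S (v i) s)"
    using representation_sum[OF ind, of I "\<lambda>i. c i *s v i"] representation_scale[OF ind]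
      basis_span[OF assms(1) assms(2)] by (simp add: span_scale)
  then show ?thesis
    using assms(3,4) unfolding integral_over_def by (auto intro!: Ints_sum)
qed

lemma basis_frame:
  assumes "basis S"
  shows "frame A S (\<lambda>s. s)"
  using assms basis_card[OF assms] basis_finite[OF assms] independentD
  unfolding frame_def basis_def by blast

lemma representation_outside:
  fixes s :: 'v
  shows "s \<notin> S \<Longrightarrow> representation S v s = 0"
  using representation_ne_zero by blast

lemma basis_index_2:
  assumes S: "basis S" and z: "z \<in> Z" "z' \<in> Z" "\<not> integral_over S z" "\<not> integral_over S z'"
  shows "integral_over S (z - z')"
proof -
  have ind: "independent S" using S by (simp add: basis_def)
  obtain j j' where j: "representation S z j \<notin> \<int>" "representation S z' j' \<notin> \<int>"
    using z(3,4) by (auto simp: integral_over_def)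
  then have jS: "j \<in> S" "j' \<in> S"
    using representation_outside[of _ S] by (metis Ints_0)+
  have "representation S z s - representation S z' s \<in> \<int>" if "s \<in> S" for s
    using coord_index_2[OF basis_frame[OF S] z(1) basis_expansion[OF S z(1)] jS(1) j(1)
        z(2) basis_expansion[OF S z(2)] jS(2) j(2) that] .
  then have "representation S z s - representation S z' s \<in> \<int>" for s
    using representation_outside[of s S] by (cases "s \<in> S") auto
  then show ?thesis
    unfolding integral_over_def
    by (simp add: representation_diff[OF ind basis_span[OF S z(2)] basis_span[OF S z(1)]])
qed

lemma basis_half_integral: "basis S \<Longrightarrow> z \<in> Z \<Longrightarrow> 2 * representation S z s \<in> \<int>"
  using coord_half_integral[OF basis_frame _ basis_expansion] representation_outside[of s S z]
  by (cases "s \<in> S") auto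

end

section \<open>Moving lifts\<close>

text \<open>
\<open>B\<close> plays the role of \<open>B\<^sup>*\<close>, with integral half-sum \<open>h\<close>. A member \<open>b\<close> of \<open>M\<close> is represented by its
lower lift \<open>l b\<close> and the gap \<open>\<delta> b\<close> to another lift of it. Under the last assumption the members of \<open>M\<close> in the
span of \<open>B\<close> are congruent to \<open>h\<close> modulo the lattice generated by \<open>B\<close>; this is how \<open>C\<^sup>*\<close> enters.
\<close>

locale half_basis_system = bimodular_system scale A Z
  for scale :: "real \<Rightarrow> 'v::ab_group_add \<Rightarrow> 'v" (infixr "*s" 75) and A Z +
  fixes e h :: 'v and B :: "'v set" and M :: "'i set" and l :: "'i \<Rightarrow> 'v" and \<delta> :: "'i \<Rightarrow> int"
  assumes e_in_B: "e \<in> B"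
    and B_subset_A: "B \<subseteq> A"
    and independent_B: "independent B"
    and card_B: "card B \<ge> 2"
    and h_in_Z: "h \<in> Z"
    and twice_h: "h + h = \<Sum>B"
    and minimal: "B' \<subseteq> A \<Longrightarrow> B' \<noteq> {} \<Longrightarrow> independent B' \<Longrightarrow> z \<in> Z \<Longrightarrow> z + z = \<Sum>B' \<Longrightarrow> card B \<le> card B'"
    and finite_M: "finite M"
    and lift_in_A: "b \<in> M \<Longrightarrow> l b \<in> A"
    and gap_pos: "b \<in> M \<Longrightarrow> \<delta> b \<ge> 1"
    and shifted_lift_in_A: "b \<in> M \<Longrightarrow> l b + of_int (\<delta> b) *s e \<in> A"
    and lift_not_in_span: "b \<in> M \<Longrightarrow> l b \<notin> span {e}"
    and lifts_differ: "b \<in> M \<Longrightarrow> b' \<in> M \<Longrightarrow> b \<noteq> b' \<Longrightarrow> l b - l b' \<notin> span {e} \<and> l b + l b' \<notin> span {e}"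
    and coords_in_span_B:
      "b \<in> M \<Longrightarrow> l b \<in> span B \<Longrightarrow> s \<in> B \<Longrightarrow> representation B (l b) s \<notin> \<int>"
begin

lemma e_nonzero: "e \<noteq> 0"
  using independent_B e_in_B dependent_zero by blast

lemma e_in_A: "e \<in> A"
  using e_in_B B_subset_A by blast

lemma finite_B: "finite B"
  using B_subset_A finite_A finite_subset by blast

lemma inj_l: "inj_on l M"
proof (rule inj_onI, rule ccontr)
  fix b b' assume b: "b \<in> M" "b' \<in> M" "l b = l b'" "b \<noteq> b'"
  then have "l b - l b' \<in> span {e}" by (simp add: span_zero)
  then show False using lifts_differ[OF b(1,2,4)] by blast
qed

lemma l_in_Z: "b \<in> M \<Longrightarrow> l b \<in> Z"
  using lift_in_A A_subset_Z by blast

lemma e_in_Z: "e \<in> Z"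
  using e_in_A A_subset_Z by blast

lemma e_notin_lifts: "C \<subseteq> M \<Longrightarrow> e \<notin> l ` C"
  using lift_not_in_span span_base[of e "{e}"] by auto

text \<open>
Each choice of lifts, for \<open>r\<close> and for the basis vectors in \<open>l ` C\<close>, again gives a basis and a column
of \<open>A\<close>. The integrality of the basis does not depend on the choice, since the gaps are integers.
\<close>

lemma shifted_coord_bound:
  fixes \<tau> :: "'i \<Rightarrow> int"
  assumes S: "basis S" "e \<in> S" and C: "C \<subseteq> M" "l ` C \<subseteq> S" and r: "r \<in> M"
    and t: "t \<in> {0, \<delta> r}" and \<tau>: "\<And>b. b \<in> C \<Longrightarrow> \<tau> b \<in> {0, \<delta> b}"
  defines "x \<equiv> representation S (l r)"
  shows "\<bar>x e + of_int t - (\<Sum>b\<in>C. x (l b) * of_int (\<tau> b))\<bar> \<le> 2" (is "\<bar>?X\<bar> \<le> 2")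
    and "\<exists>z\<in>Z. \<not> integral_over S z \<Longrightarrow>
      \<bar>x e + of_int t - (\<Sum>b\<in>C. x (l b) * of_int (\<tau> b))\<bar> \<le> 1"
proof -
  define \<sigma> where "\<sigma> s = (if s \<in> l ` C then \<tau> (inv_into C l s) else 0)" for s
  have inj: "inj_on l C" using inj_l C(1) inj_on_subset by blast
  have \<sigma>l: "\<sigma> (l b) = \<tau> b" if "b \<in> C" for b
    using that inj by (simp add: \<sigma>_def)
  have \<sigma>e: "real_of_int (\<sigma> e) = 0" using e_notin_lifts[OF C(1)] by (simp add: \<sigma>_def)
  have fin: "finite S" by (rule basis_finite[OF S(1)])
  have inA: "s + real_of_int (\<sigma> s) *s e \<in> A" if "s \<in> S" for s
  proof (cases "s \<in> l ` C")
    case True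
    then obtain b where b: "b \<in> C" "s = l b" by blast
    then show ?thesis using \<tau>[OF b(1)] \<sigma>l[OF b(1)] lift_in_A[of b] shifted_lift_in_A[of b] C(1) by auto
  next
    case False
    then show ?thesis using that S(1) by (auto simp: \<sigma>_def basis_def)
  qed
  have sum_\<sigma>: "(\<Sum>s\<in>S. y s * real_of_int (\<sigma> s)) = (\<Sum>b\<in>C. y (l b) * of_int (\<tau> b))" for y
  proof -
    have "(\<Sum>s\<in>S. y s * real_of_int (\<sigma> s)) = (\<Sum>s\<in>l ` C. y s * real_of_int (\<sigma> s))"
      by (rule sum.mono_neutral_right) (use fin C(2) in \<open>auto simp: \<sigma>_def\<close>)
    also have "\<dots> = (\<Sum>b\<in>C. y (l b) * of_int (\<tau> b))"
      by (subst sum.reindex[OF inj]) (simp add: \<sigma>l)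
    finally show ?thesis .
  qed
  have fr: "frame A S (\<lambda>s. s + real_of_int (\<sigma> s) *s e)"
    by (rule frame_shift[where e = e and \<tau> = "\<lambda>s. real_of_int (\<sigma> s)", OF S \<sigma>e inA])
  let ?x = "\<lambda>v t s. representation S v s +
      (if s = e then t - (\<Sum>b\<in>C. representation S v (l b) * of_int (\<tau> b)) else 0)"
  have exp: "v + t *s e = (\<Sum>s\<in>S. ?x v t s *s (s + real_of_int (\<sigma> s) *s e))" if "v \<in> Z" for v t
    using coords_shift[where e = e and \<tau> = "\<lambda>s. real_of_int (\<sigma> s)", OF S \<sigma>e that, of t] unfolding sum_\<sigma> .
  have rA: "l r + of_int t *s e \<in> A"
    using t lift_in_A[OF r] shifted_lift_in_A[OF r] by auto
  have X: "?X = ?x (l r) (of_int t) e" by (simp add: x_def)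
  show "\<bar>?X\<bar> \<le> 2"
    unfolding X by (rule coord_le_2[OF fr rA exp[OF l_in_Z[OF r]] S(2)])
  assume "\<exists>z\<in>Z. \<not> integral_over S z"
  then obtain z j where z: "z \<in> Z" "representation S z j \<notin> \<int>"
    by (auto simp: integral_over_def)
  have jS: "j \<in> S" using z(2) representation_outside[of j S z] by (metis Ints_0)
  have "\<exists>j\<in>S. ?x z 0 j \<notin> \<int>"
  proof (cases "\<exists>j\<in>S. j \<noteq> e \<and> representation S z j \<notin> \<int>")
    case True
    then show ?thesis by force
  next
    case False
    then have je: "j = e" using z(2) jS by blast
    have "representation S z (l b) \<in> \<int>" if "b \<in> C" for b
      using False C(2) e_notin_lifts[OF C(1)] that by (metis image_eqI subset_iff)
    then have "(\<Sum>b\<in>C. representation S z (l b) * of_int (\<tau> b)) \<in> \<int>"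
      by (intro Ints_sum Ints_mult) auto
    then have "?x z 0 e \<notin> \<int>" using z(2) je by auto
    then show ?thesis using S(2) by blast
  qed
  then obtain j where j: "j \<in> S" "?x z 0 j \<notin> \<int>" by blast
  have z0: "z = (\<Sum>s\<in>S. ?x z 0 s *s (s + real_of_int (\<sigma> s) *s e))"
    using exp[OF z(1), of 0] by simp
  show "\<bar>?X\<bar> \<le> 1"
    unfolding X by (rule coord_le_1[OF fr z(1) z0 j rA exp[OF l_in_Z[OF r]] S(2)])
qed

text \<open>
The two extreme choices of lifts push the coordinate at \<open>e\<close> as far as possible in opposite directions.
\<close>

lemma width_bound:
  assumes S: "basis S" "e \<in> S" and C: "C \<subseteq> M" "l ` C \<subseteq> S" and r: "r \<in> M"
  defines "x \<equiv> representation S (l r)"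
  shows "of_int (\<delta> r) + (\<Sum>b\<in>C. \<bar>x (l b)\<bar> * of_int (\<delta> b)) \<le> 4"
    and "\<exists>z\<in>Z. \<not> integral_over S z \<Longrightarrow> of_int (\<delta> r) + (\<Sum>b\<in>C. \<bar>x (l b)\<bar> * of_int (\<delta> b)) \<le> 2"
proof -
  \<comment> \<open>\<open>?up\<close> moves exactly the lifts that increase the coordinate at \<open>e\<close>, \<open>?dn\<close> the others.\<close>
  let ?up = "\<lambda>b. if x (l b) < 0 then \<delta> b else 0"
  let ?dn = "\<lambda>b. if x (l b) < 0 then 0 else \<delta> b"
  let ?U = "x e + of_int (\<delta> r) - (\<Sum>b\<in>C. x (l b) * of_int (?up b))"
  let ?L = "x e + of_int 0 - (\<Sum>b\<in>C. x (l b) * of_int (?dn b))"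
  have "?U - ?L = of_int (\<delta> r) + (\<Sum>b\<in>C. x (l b) * of_int (?dn b) - x (l b) * of_int (?up b))"
    unfolding sum_subtractf by simp
  also have "(\<Sum>b\<in>C. x (l b) * of_int (?dn b) - x (l b) * of_int (?up b)) =
      (\<Sum>b\<in>C. \<bar>x (l b)\<bar> * of_int (\<delta> b))"
    by (rule sum.cong) auto
  finally have eq: "of_int (\<delta> r) + (\<Sum>b\<in>C. \<bar>x (l b)\<bar> * of_int (\<delta> b)) = ?U - ?L" ..
  note bound = shifted_coord_bound[OF S C r, folded x_def]
  have "\<bar>?U\<bar> \<le> 2" "\<bar>?L\<bar> \<le> 2" by (rule bound(1); simp)+
  then show "of_int (\<delta> r) + (\<Sum>b\<in>C. \<bar>x (l b)\<bar> * of_int (\<delta> b)) \<le> 4" unfolding eq by linarith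
  assume non: "\<exists>z\<in>Z. \<not> integral_over S z"
  have "\<bar>?U\<bar> \<le> 1" "\<bar>?L\<bar> \<le> 1" by (rule bound(2)[OF _ _ non]; simp)+
  then show "of_int (\<delta> r) + (\<Sum>b\<in>C. \<bar>x (l b)\<bar> * of_int (\<delta> b)) \<le> 2" unfolding eq by linarith
qed

corollary sum_coords_bound:
  assumes S: "basis S" "e \<in> S" and C: "C \<subseteq> M" "l ` C \<subseteq> S" and r: "r \<in> M"
  defines "x \<equiv> representation S (l r)"
  shows "1 + (\<Sum>b\<in>C. \<bar>x (l b)\<bar>) \<le> 4"
    and "\<exists>z\<in>Z. \<not> integral_over S z \<Longrightarrow> 1 + (\<Sum>b\<in>C. \<bar>x (l b)\<bar>) \<le> 2"
proof -
  have "(\<Sum>b\<in>C. \<bar>x (l b)\<bar>) \<le> (\<Sum>b\<in>C. \<bar>x (l b)\<bar> * of_int (\<delta> b))"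
    using gap_pos C(1) by (intro sum_mono) (simp add: mult_le_cancel_left1 subset_iff)
  moreover have "1 \<le> real_of_int (\<delta> r)" using gap_pos[OF r] by simp
  ultimately have le: "1 + (\<Sum>b\<in>C. \<bar>x (l b)\<bar>) \<le>
      of_int (\<delta> r) + (\<Sum>b\<in>C. \<bar>x (l b)\<bar> * of_int (\<delta> b))" by linarith
  show "1 + (\<Sum>b\<in>C. \<bar>x (l b)\<bar>) \<le> 4"
    using le width_bound(1)[OF S C r, folded x_def] by linarith
  assume "\<exists>z\<in>Z. \<not> integral_over S z"
  then show "1 + (\<Sum>b\<in>C. \<bar>x (l b)\<bar>) \<le> 2"
    using le width_bound(2)[OF S C r, folded x_def] by linarith
qed

section \<open>Dependence modulo a basis vector and circuit elimination\<close>

text \<open>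
Linear dependence of the vectors in \<open>C\<close> themselves, as opposed to their lifts; the multiple of \<open>e\<close>
absorbs the first coordinates.
\<close>

definition dep_mod_e :: "'i set \<Rightarrow> bool" where
  "dep_mod_e C \<longleftrightarrow> (\<exists>c \<phi>. (\<exists>b\<in>C. c b \<noteq> 0) \<and> (\<Sum>b\<in>C. c b *s l b) = \<phi> *s e)"

definition circ_mod_e :: "'i set \<Rightarrow> bool" where
  "circ_mod_e C \<longleftrightarrow> dep_mod_e C \<and> (\<forall>C' \<subset> C. \<not> dep_mod_e C')"

lemma dep_mod_e_I: "b \<in> C \<Longrightarrow> c b \<noteq> 0 \<Longrightarrow> (\<Sum>b\<in>C. c b *s l b) = \<phi> *s e \<Longrightarrow> dep_mod_e C"
  unfolding dep_mod_e_def by blast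

lemma independent_lifts:
  assumes C: "C \<subseteq> M" "\<not> dep_mod_e C"
  shows "independent (insert e (l ` C))"
proof
  have fin: "finite C" using C(1) finite_M finite_subset by blast
  have inj: "inj_on l C" using inj_l C(1) inj_on_subset by blast
  assume "dependent (insert e (l ` C))"
  then obtain u where u: "\<exists>v\<in>insert e (l ` C). u v \<noteq> 0" "(\<Sum>v\<in>insert e (l ` C). u v *s v) = 0"
    using dependent_finite[of "insert e (l ` C)"] fin by auto
  then have eq: "u e *s e + (\<Sum>b\<in>C. u (l b) *s l b) = 0"
    using fin e_notin_lifts[OF C(1)] by (simp add: sum.reindex[OF inj])
  then have "(\<Sum>b\<in>C. u (l b) *s l b) = (- u e) *s e"
    unfolding scale_minus_left eq_neg_iff_add_eq_0 by (subst add.commute)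
  then have zero: "\<forall>b\<in>C. u (l b) = 0"
    using C(2) dep_mod_e_I[where c = "\<lambda>b. u (l b)"] by blast
  then have "u e *s e = 0" using eq by simp
  then show False using e_nonzero zero u(1) by auto
qed

lemma dep_contains_circ:
  assumes "finite C" "dep_mod_e C"
  shows "\<exists>C'\<subseteq>C. circ_mod_e C'"
  using assms
proof (induction C rule: finite_psubset_induct)
  case (psubset C)
  show ?case
  proof (cases "circ_mod_e C")
    case False
    then obtain C' where "C' \<subset> C" "dep_mod_e C'" using psubset.prems by (auto simp: circ_mod_e_def)
    then show ?thesis using psubset.IH[of C'] by blast
  qed blast
qed

lemma circ_nonzero:
  assumes "circ_mod_e C" "finite C"
  obtains c \<phi> where "\<And>b. b \<in> C \<Longrightarrow> c b \<noteq> 0" "(\<Sum>b\<in>C. c b *s l b) = \<phi> *s e"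
proof -
  obtain g \<psi> r where g: "r \<in> C" "g r \<noteq> 0" "(\<Sum>b\<in>C. g b *s l b) = \<psi> *s e"
    using assms(1) unfolding circ_mod_e_def dep_mod_e_def by blast
  have "g b \<noteq> 0" if "b \<in> C" for b
  proof
    assume b0: "g b = 0"
    then have "(\<Sum>b\<in>C - {b}. g b *s l b) = \<psi> *s e"
      using g(3) sum.remove[OF assms(2) that, of "\<lambda>b. g b *s l b"] by simp
    then have "dep_mod_e (C - {b})" using dep_mod_e_I[of r "C - {b}" g \<psi>] g(1,2) b0 by auto
    then show False using assms(1) that by (auto simp: circ_mod_e_def)
  qed
  then show thesis using that g(3) by blast
qed

lemma circ_not_subset: "circ_mod_e C \<Longrightarrow> circ_mod_e C' \<Longrightarrow> C \<subseteq> C' \<Longrightarrow> C = C'"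
  by (auto simp: circ_mod_e_def)

text \<open>
Cancel \<open>x\<close> between the two relations; a vector of \<open>C - C'\<close> keeps a nonzero coefficient.
\<close>

lemma circ_elim:
  assumes C: "finite C" "finite C'" "circ_mod_e C" "circ_mod_e C'" "C \<noteq> C'" "x \<in> C" "x \<in> C'"
  shows "\<exists>D. circ_mod_e D \<and> D \<subseteq> C \<union> C' - {x}"
proof -
  obtain c \<phi> where c: "\<And>b. b \<in> C \<Longrightarrow> c b \<noteq> 0" "(\<Sum>b\<in>C. c b *s l b) = \<phi> *s e"
    using circ_nonzero[OF C(3,1)] by blast
  obtain c' \<phi>' where c': "\<And>b. b \<in> C' \<Longrightarrow> c' b \<noteq> 0" "(\<Sum>b\<in>C'. c' b *s l b) = \<phi>' *s e"
    using circ_nonzero[OF C(4,2)] by blast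
  obtain y where y: "y \<in> C" "y \<notin> C'" using circ_not_subset[OF C(3,4)] C(5) by blast
  define g where "g b = c' x * (if b \<in> C then c b else 0) - c x * (if b \<in> C' then c' b else 0)" for b
  let ?U = "C \<union> C'"
  have fin: "finite ?U" using C(1,2) by simp
  have 1: "(\<Sum>b\<in>?U. (if b \<in> C then c b else 0) *s l b) = \<phi> *s e"
  proof -
    have "(\<Sum>b\<in>?U. (if b \<in> C then c b else 0) *s l b) = (\<Sum>b\<in>C. c b *s l b)"
      by (rule sum.mono_neutral_cong_right[OF fin]) auto
    then show ?thesis using c(2) by simp
  qed
  have 2: "(\<Sum>b\<in>?U. (if b \<in> C' then c' b else 0) *s l b) = \<phi>' *s e"
  proof -
    have "(\<Sum>b\<in>?U. (if b \<in> C' then c' b else 0) *s l b) = (\<Sum>b\<in>C'. c' b *s l b)"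
      by (rule sum.mono_neutral_cong_right[OF fin]) auto
    then show ?thesis using c'(2) by simp
  qed
  have "(\<Sum>b\<in>?U. g b *s l b) = c' x *s (\<Sum>b\<in>?U. (if b \<in> C then c b else 0) *s l b)
      - c x *s (\<Sum>b\<in>?U. (if b \<in> C' then c' b else 0) *s l b)"
    unfolding g_def scale_sum_right sum_subtractf[symmetric]
    by (rule sum.cong) (simp_all add: scale_left_diff_distrib)
  also have "\<dots> = (c' x * \<phi> - c x * \<phi>') *s e"
    unfolding 1 2 by (simp add: scale_left_diff_distrib)
  finally have sum: "(\<Sum>b\<in>?U. g b *s l b) = (c' x * \<phi> - c x * \<phi>') *s e" .
  have gx: "g x = 0" using C(6,7) by (simp add: g_def)
  have "(\<Sum>b\<in>?U. g b *s l b) = g x *s l x + (\<Sum>b\<in>?U - {x}. g b *s l b)"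
    by (rule sum.remove[OF fin]) (use C(6) in blast)
  then have "(\<Sum>b\<in>?U - {x}. g b *s l b) = (c' x * \<phi> - c x * \<phi>') *s e" using sum gx by simp
  moreover have "g y \<noteq> 0" using y c(1)[of y] c'(1)[OF C(7)] by (simp add: g_def)
  moreover have "y \<in> ?U - {x}" using y C(7) by auto
  ultimately have "dep_mod_e (?U - {x})" using dep_mod_e_I[of y "?U - {x}" g] by blast
  then show ?thesis using dep_contains_circ[of "?U - {x}"] fin by auto
qed

lemma card_le_dim:
  assumes "N \<subseteq> M" "\<not> dep_mod_e N"
  shows "card N + 1 \<le> dim A"
proof -
  have ind: "independent (insert e (l ` N))" by (rule independent_lifts[OF assms])
  have sub: "insert e (l ` N) \<subseteq> A" using e_in_A lift_in_A assms(1) by auto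
  obtain S where S: "insert e (l ` N) \<subseteq> S" "S \<subseteq> A" "independent S" "A \<subseteq> span S"
    using maximal_independent_subset_extend[OF sub ind] by auto
  then have "basis S" by (simp add: basis_def)
  have "card (insert e (l ` N)) \<le> dim A"
    using card_mono[OF basis_finite[OF \<open>basis S\<close>] S(1)] basis_card[OF \<open>basis S\<close>] by simp
  moreover have "card (l ` N) = card N"
    by (rule card_image) (use inj_l assms(1) inj_on_subset in blast)
  moreover have "finite (l ` N)" using assms(1) finite_M finite_subset by blast
  ultimately show ?thesis using e_notin_lifts[OF assms(1)] by simp
qed

text \<open>
Without \<open>X\<close> no circuit is left, so the remaining lifts are independent together with \<open>e\<close>.
\<close>

lemma card_M_le_if_hitting:
  assumes X: "finite X" "\<And>C. C \<subseteq> M \<Longrightarrow> circ_mod_e C \<Longrightarrow> C \<inter> X \<noteq> {}"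
  shows "card M + 1 \<le> dim A + card X"
proof -
  have "\<not> dep_mod_e (M - X)"
    using dep_contains_circ[of "M - X"] finite_M X(2) by blast
  then have "card (M - X) + 1 \<le> dim A" by (intro card_le_dim) auto
  moreover have "card M \<le> card (M - X) + card X"
    using card_Un_le[of "M - X" X] card_mono[of "M - X \<union> X" M] finite_M X(1) by fastforce
  ultimately show ?thesis by linarith
qed

lemma unique_circuit:
  assumes u: "\<And>C. C \<subseteq> M \<Longrightarrow> circ_mod_e C \<Longrightarrow> u \<in> C"
    and C: "C \<subseteq> M" "circ_mod_e C" "C' \<subseteq> M" "circ_mod_e C'"
  shows "C = C'"
proof (rule ccontr)
  assume "C \<noteq> C'"
  moreover have "finite C" "finite C'" using C finite_M finite_subset by blast+
  ultimately obtain D where "circ_mod_e D" "D \<subseteq> C \<union> C' - {u}"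
    using circ_elim[of C C' u] C u by blast
  then show False using u[of D] C by blast
qed

text \<open>
\<open>N\<close> is maximal among the sets of members of \<open>M\<close> outside \<open>span B\<close> whose lifts are independent of \<open>B\<close>.
\<close>

lemma adapted_basis_exists:
  obtains N S where "basis S" "B \<subseteq> S" "N \<subseteq> M" "l ` N \<subseteq> S"
    "\<And>p. p \<in> N \<Longrightarrow> l p \<notin> span B" "\<And>b. b \<in> M \<Longrightarrow> l b \<in> span (B \<union> l ` N)"
proof -
  let ?V = "B \<union> l ` {b \<in> M. l b \<notin> span B}"
  obtain B1 where B1: "B \<subseteq> B1" "B1 \<subseteq> ?V" "independent B1" "?V \<subseteq> span B1"
    using maximal_independent_subset_extend[of B ?V] independent_B by auto
  have "B1 \<subseteq> A" using B1(2) B_subset_A lift_in_A by auto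
  then obtain S where S: "B1 \<subseteq> S" "S \<subseteq> A" "independent S" "A \<subseteq> span S"
    using maximal_independent_subset_extend[of B1 A] B1(3) by auto
  define N where "N = {b \<in> M. l b \<notin> span B \<and> l b \<in> B1}"
  have eq: "B \<union> l ` N = B1" using B1(1,2) by (auto simp: N_def)
  have sp: "l b \<in> span (B \<union> l ` N)" if "b \<in> M" for b
    unfolding eq using B1(4) that span_mono[OF B1(1)] by blast
  show thesis
  proof (rule that)
    show "basis S" using S(2-4) by (simp add: basis_def)
    show "B \<subseteq> S" using B1(1) S(1) by (rule order_trans)
    show "l ` N \<subseteq> S" using S(1) eq by blast
      show "N \<subseteq> M" by (auto simp: N_def)
    show "l p \<notin> span B" if "p \<in> N" for p using that by (simp add: N_def)
  qed (fact sp)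
qed

end

section \<open>Classes outside the span of the half basis\<close>

locale adapted_basis = half_basis_system scale A Z e h B M l \<delta>
  for scale :: "real \<Rightarrow> 'v::ab_group_add \<Rightarrow> 'v" (infixr "*s" 75) and A Z e h B
    and M :: "'i set" and l \<delta> +
  fixes N :: "'i set" and S\<^sub>0 :: "'v set"
  assumes basis_S0: "basis S\<^sub>0"
    and B_subset_S0: "B \<subseteq> S\<^sub>0"
    and N_subset_M: "N \<subseteq> M"
    and N_subset_S0: "l ` N \<subseteq> S\<^sub>0"
    and N_outside: "p \<in> N \<Longrightarrow> l p \<notin> span B"
    and M_spanned: "b \<in> M \<Longrightarrow> l b \<in> span (B \<union> l ` N)"
begin

abbreviation coord :: "'v \<Rightarrow> 'v \<Rightarrow> real" where
  "coord \<equiv> representation S\<^sub>0"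

lemma independent_S0: "independent S\<^sub>0"
  using basis_S0 by (simp add: basis_def)

lemma e_in_S0: "e \<in> S\<^sub>0"
  using e_in_B B_subset_S0 by blast

lemma finite_N: "finite N"
  using N_subset_M finite_M finite_subset by blast

text \<open>
The coordinates \<open>1/2\<close> show that a basis containing \<open>B\<close> does not generate all integral vectors.
\<close>

lemma coord_h: "coord h s = (if s \<in> B then 1 / 2 else 0)"
proof -
  have "(1 / 2) *s (h + h) = (1 / 2 + 1 / 2) *s h"
    by (simp only: scale_right_distrib scale_left_distrib)
  then have "h = (1 / 2) *s (h + h)" by simp
  then have h: "h = (\<Sum>b\<in>B. (1 / 2) *s b)" by (simp add: twice_h scale_sum_right)
  have B: "coord ((1 / 2) *s b) = (\<lambda>s. 1 / 2 * (if s = b then 1 else 0))" if "b \<in> B" for b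
    using that B_subset_S0 independent_S0
    by (subst representation_scale) (auto simp: span_base representation_basis)
  have "coord h s = (\<Sum>b\<in>B. coord ((1 / 2) *s b) s)"
    by (subst h, subst representation_sum[OF independent_S0])
      (use B_subset_S0 in \<open>auto intro: span_scale span_base\<close>)
  also have "\<dots> = (\<Sum>b\<in>B. if s = b then 1 / 2 else 0)"
    by (rule sum.cong) (simp_all add: B)
  also have "\<dots> = (if s \<in> B then 1 / 2 else 0)" using finite_B by simp
  finally show ?thesis .
qed

lemma half_notin_Ints: "(1 / 2 :: real) \<notin> \<int>"
proof
  assume "(1 / 2 :: real) \<in> \<int>"
  then obtain n :: int where "1 / 2 = real_of_int n" by (auto elim: Ints_cases)
  then have "2 * n = 1" by linarith
  then show False by presburger
qed

lemma h_not_integral: "\<not> integral_over S\<^sub>0 h"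
  using e_in_B half_notin_Ints by (auto simp: integral_over_def coord_h intro!: exI[of _ e])

text \<open>
Since the index is 2, the class of \<open>h\<close> is the only nontrivial one.
\<close>

lemma integral_or_shifted_by_h:
  assumes "z \<in> Z"
  shows "integral_over S\<^sub>0 z \<or> (\<forall>s. coord z s - (if s \<in> B then 1 / 2 else 0) \<in> \<int>)"
proof (cases "integral_over S\<^sub>0 z")
  case False
  then have "integral_over S\<^sub>0 (z - h)"
    using basis_index_2[OF basis_S0 assms h_in_Z] h_not_integral by blast
  then show ?thesis
    unfolding integral_over_def
      representation_diff[OF independent_S0 basis_span[OF basis_S0 h_in_Z] basis_span[OF basis_S0 assms]]
    by (simp only: coord_h simp_thms)
qed simp

lemma coord_outside:
  assumes "b \<in> M" "s \<notin> B \<union> l ` N"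
  shows "coord (l b) s = 0"
proof -
  have "coord (l b) = representation (B \<union> l ` N) (l b)"
    using representation_extend[OF independent_S0 M_spanned[OF assms(1)]] B_subset_S0 N_subset_S0 by auto
  then show ?thesis using assms(2) by (simp add: representation_outside)
qed

lemma coord_inside:
  assumes "l b \<in> span B"
  shows "coord (l b) = representation B (l b)"
  by (rule representation_extend[OF independent_S0 assms B_subset_S0])

lemma in_span_B_if:
  assumes "v \<in> Z" "\<And>s. s \<notin> B \<Longrightarrow> coord v s = 0"
  shows "v = (\<Sum>s\<in>B. coord v s *s s)" "v \<in> span B"
proof -
  have "v = (\<Sum>s\<in>S\<^sub>0. coord v s *s s)" by (rule basis_expansion[OF basis_S0 assms(1)])
  also have "\<dots> = (\<Sum>s\<in>B. coord v s *s s)"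
    by (rule sum.mono_neutral_right) (use basis_finite[OF basis_S0] B_subset_S0 assms(2) in auto)
  finally show "v = (\<Sum>s\<in>B. coord v s *s s)" .
  then show "v \<in> span B" by (metis (no_types, lifting) span_base span_scale span_sum)
qed

text \<open>
The coordinates at \<open>l ` N\<close> are integers of total absolute value at most 1, and they do not all vanish.
So the estimate of \<open>width_bound\<close> holds with equality. The gaps are then 1, and the extreme choices of lifts
bring the coordinate at \<open>e\<close> to \<open>-1\<close> and \<open>1\<close>; it differs from these by integers, so it is an integer.
As the coordinates along \<open>B\<close> differ from it by integers, all of them are integers.
\<close>

lemma outside_span_B:
  assumes r: "r \<in> M" "l r \<notin> span B"
  shows "integral_over S\<^sub>0 (l r)" "\<delta> r = 1"
    "\<exists>p\<in>N. \<bar>coord (l r) (l p)\<bar> = 1 \<and> (\<forall>q\<in>N. q \<noteq> p \<longrightarrow> coord (l r) (l q) = 0)"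
proof -
  let ?x = "coord (l r)"
  have non: "\<exists>z\<in>Z. \<not> integral_over S\<^sub>0 z" using h_in_Z h_not_integral by blast
  have lNB: "l p \<notin> B" if "p \<in> N" for p using N_outside[OF that] span_base by blast
  have int: "?x (l p) \<in> \<int>" if "p \<in> N" for p
  proof -
    have "?x (l p) \<in> \<int> \<or> ?x (l p) - (if l p \<in> B then 1 / 2 else 0) \<in> \<int>"
      using integral_or_shifted_by_h[OF l_in_Z[OF r(1)]] unfolding integral_over_def by blast
    then show ?thesis using lNB[OF that] by simp
  qed
  have sum: "(\<Sum>p\<in>N. \<bar>?x (l p)\<bar>) \<le> 1"
    using sum_coords_bound(2)[OF basis_S0 e_in_S0 N_subset_M N_subset_S0 r(1) non] by simp
  have "\<exists>p\<in>N. ?x (l p) \<noteq> 0"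
    using in_span_B_if(2)[OF l_in_Z[OF r(1)]] r coord_outside[OF r(1)] by blast
  then obtain p where p: "p \<in> N" "?x (l p) \<noteq> 0" by blast
  have ge: "\<bar>?x (l p)\<bar> \<ge> 1" using int[OF p(1)] p(2) Ints_nonzero_abs_ge1 by blast
  have split: "(\<Sum>p\<in>N. \<bar>?x (l p)\<bar>) = \<bar>?x (l p)\<bar> + (\<Sum>p\<in>N - {p}. \<bar>?x (l p)\<bar>)"
    by (rule sum.remove[OF finite_N p(1)])
  have rest: "(\<Sum>p\<in>N - {p}. \<bar>?x (l p)\<bar>) \<ge> 0" by (simp add: sum_nonneg)
  have abs: "\<bar>?x (l p)\<bar> = 1" and rest0: "(\<Sum>p\<in>N - {p}. \<bar>?x (l p)\<bar>) = 0"
    using split sum ge rest by linarith+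
  have "\<forall>q\<in>N - {p}. \<bar>?x (l q)\<bar> = 0"
    by (subst sum_nonneg_eq_0_iff[symmetric]) (use finite_N rest0 in auto)
  then show "\<exists>p\<in>N. \<bar>?x (l p)\<bar> = 1 \<and> (\<forall>q\<in>N. q \<noteq> p \<longrightarrow> ?x (l q) = 0)"
    using p(1) abs by auto
  have pM: "{p} \<subseteq> M" "l ` {p} \<subseteq> S\<^sub>0" using p(1) N_subset_M N_subset_S0 by auto
  have "real_of_int (\<delta> r) + real_of_int (\<delta> p) \<le> 2"
    using width_bound(2)[OF basis_S0 e_in_S0 pM r(1) non] abs by simp
  then show \<delta>: "\<delta> r = 1" using gap_pos[OF r(1)] gap_pos[of p] pM(1) by auto
  have \<delta>p: "\<delta> p = 1"
    using \<open>real_of_int (\<delta> r) + real_of_int (\<delta> p) \<le> 2\<close> gap_pos[OF r(1)] gap_pos[of p] pM(1) by auto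
  note bound = shifted_coord_bound(2)[OF basis_S0 e_in_S0 pM r(1) _ _ non, unfolded \<delta>]
  have b: "\<bar>?x e + real_of_int t - ?x (l p) * real_of_int u\<bar> \<le> 1" if "t \<in> {0, 1}" "u \<in> {0, 1}" for t u
    using bound[of t "\<lambda>_. u"] that \<delta>p by auto
  have "?x e \<in> {0, -1}"
  proof (cases "?x (l p) = 1")
    case True
    then show ?thesis using b[of 0 1] b[of 1 0] by auto
  next
    case False
    then have "?x (l p) = -1" using abs by linarith
    then show ?thesis using b[of 0 0] b[of 1 1] by auto
  qed
  then have xe: "?x e \<in> \<int>" by auto
  have "?x e - 1 / 2 \<notin> \<int>"
  proof
    assume "?x e - 1 / 2 \<in> \<int>"
    then have "?x e - (?x e - 1 / 2) \<in> \<int>" using xe by (rule Ints_diff[rotated])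
    then show False using half_notin_Ints by simp
  qed
  then have "\<not> (\<forall>s. ?x s - (if s \<in> B then 1 / 2 else 0) \<in> \<int>)"
    using e_in_B by (auto intro!: exI[of _ e])
  then show "integral_over S\<^sub>0 (l r)"
    using integral_or_shifted_by_h[OF l_in_Z[OF r(1)]] by blast
qed

lemma coord_sum:
  assumes "\<And>i. i \<in> I \<Longrightarrow> f i \<in> Z"
  shows "coord (\<Sum>i\<in>I. g i *s f i) s = (\<Sum>i\<in>I. g i * coord (f i) s)"
proof -
  have sp: "f i \<in> span S\<^sub>0" if "i \<in> I" for i
    using basis_span[OF basis_S0 assms[OF that]] .
  have "coord (\<Sum>i\<in>I. g i *s f i) = (\<lambda>s. \<Sum>i\<in>I. coord (g i *s f i) s)"
    by (rule representation_sum[OF independent_S0]) (use sp span_scale in blast)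
  then show ?thesis by (simp add: representation_scale[OF independent_S0 sp])
qed

text \<open>
For \<open>r\<close> outside \<open>span B\<close>, this is the member of \<open>N\<close> to which \<open>r\<close> is congruent modulo \<open>span B\<close>, up to the
sign \<open>sg r\<close>.
\<close>

definition cls :: "'i \<Rightarrow> 'i" where
  "cls r = (SOME p. p \<in> N \<and> \<bar>coord (l r) (l p)\<bar> = 1 \<and> (\<forall>q\<in>N. q \<noteq> p \<longrightarrow> coord (l r) (l q) = 0))"

definition sg :: "'i \<Rightarrow> int" where
  "sg r = (if coord (l r) (l (cls r)) = 1 then 1 else -1)"

lemma cls_props:
  assumes "r \<in> M" "l r \<notin> span B"
  shows "cls r \<in> N" "coord (l r) (l (cls r)) = of_int (sg r)"
    "q \<in> N \<Longrightarrow> q \<noteq> cls r \<Longrightarrow> coord (l r) (l q) = 0" "\<bar>sg r\<bar> = 1"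
proof -
  have *: "cls r \<in> N \<and> \<bar>coord (l r) (l (cls r))\<bar> = 1 \<and> (\<forall>q\<in>N. q \<noteq> cls r \<longrightarrow> coord (l r) (l q) = 0)"
    unfolding cls_def by (rule someI_ex) (use outside_span_B(3)[OF assms] in blast)
  then show "cls r \<in> N" "q \<in> N \<Longrightarrow> q \<noteq> cls r \<Longrightarrow> coord (l r) (l q) = 0" by blast+
  show "coord (l r) (l (cls r)) = of_int (sg r)" using * unfolding sg_def by (auto simp: abs_if split: if_splits)
  show "\<bar>sg r\<bar> = 1" by (simp add: sg_def)
qed

section \<open>Coefficients of circuits\<close>

text \<open>
All but one of the lifts of the circuit and \<open>e\<close> extend to a basis, and the bound on the coordinates of
the remaining one, multiplied by the index of the basis, bounds the coefficients of the relation.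

If the circuit avoided \<open>span B\<close>, then this basis, being completed from \<open>S\<^sub>0\<close>, would lie in the lattice
generated by \<open>S\<^sub>0\<close>. Both lattices have index 2, so they coincide. The coordinates of the remaining lift at
the others would be nonzero integers of total absolute value at most 1, which leaves only circuits of at
most two elements. But no member of \<open>M\<close> is zero, and no two of them are equal or opposite.
\<close>

lemma circuit_coeffs:
  assumes C: "C \<subseteq> M" "circ_mod_e C"
  obtains c :: "'i \<Rightarrow> int" and \<phi> where "\<And>b. b \<in> C \<Longrightarrow> c b \<noteq> 0" "(\<Sum>b\<in>C. \<bar>c b\<bar>) \<le> 4"
    "(\<Sum>b\<in>C. of_int (c b) *s l b) = \<phi> *s e" "\<exists>b\<in>C. l b \<in> span B"
proof -
  note result = that
  have fin: "finite C" using C(1) finite_M finite_subset by blast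
  obtain g \<psi> where gne: "\<And>b. b \<in> C \<Longrightarrow> g b \<noteq> 0" and gsum: "(\<Sum>b\<in>C. g b *s l b) = \<psi> *s e"
    by (rule circ_nonzero[OF C(2) fin]) (rule that; assumption)
  obtain r where "r \<in> C" using C(2) by (auto simp: circ_mod_e_def dep_mod_e_def)
  then have g: "r \<in> C" "g r \<noteq> 0" "(\<Sum>b\<in>C. g b *s l b) = \<psi> *s e" using gne gsum by auto
  have sub: "\<not> dep_mod_e (C - {r})" using C(2) g(1) unfolding circ_mod_e_def by blast
  let ?C = "C - {r}"
  have C': "?C \<subseteq> M" using C(1) by blast
  have rM: "r \<in> M" using g(1) C(1) by blast
  have ind: "independent (insert e (l ` ?C))" by (rule independent_lifts[OF C' sub])
  have subA: "insert e (l ` ?C) \<subseteq> A" using e_in_A lift_in_A C' by auto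
  obtain S where S: "basis S" "insert e (l ` ?C) \<subseteq> S" "S \<subseteq> S\<^sub>0 \<union> insert e (l ` ?C)"
    using basis_extend[OF ind subA basis_S0] .
  have indS: "independent S" using S(1) by (simp add: basis_def)
  define x where "x b = - (g b / g r)" for b
  define \<xi> where "\<xi> = \<psi> / g r"
  have lr: "l r = \<xi> *s e + (\<Sum>b\<in>?C. x b *s l b)"
  proof -
    have "g r *s l r = \<psi> *s e - (\<Sum>b\<in>?C. g b *s l b)"
      using g(3) sum.remove[OF fin g(1), of "\<lambda>b. g b *s l b"] by (simp add: algebra_simps)
    then have "(1 / g r) *s (g r *s l r) = (1 / g r) *s (\<psi> *s e - (\<Sum>b\<in>?C. g b *s l b))"
      by (rule arg_cong)
    then show ?thesis
      using g(2) by (simp add: scale_right_diff_distrib scale_sum_right \<xi>_def x_def sum_negf scale_minus_left)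
  qed
  have repe: "representation S e = (\<lambda>v. if v = e then 1 else 0)"
    using representation_basis[OF indS] S(2) by blast
  have repl: "representation S (l b) = (\<lambda>v. if v = l b then 1 else 0)" if "b \<in> ?C" for b
    using representation_basis[OF indS, of "l b"] S(2) that by blast
  have eS: "e \<in> S" and lS: "l ` ?C \<subseteq> S" using S(2) by auto
  have rep: "representation S (l r) v = \<xi> * (if v = e then 1 else 0) + (\<Sum>b\<in>?C. x b * (if v = l b then 1 else 0))" for v
  proof -
    have sp: "l b \<in> span S" if "b \<in> ?C" for b using lS that span_base by blast
    have "representation S (\<xi> *s e + (\<Sum>b\<in>?C. x b *s l b)) =
        (\<lambda>v. representation S (\<xi> *s e) v + representation S (\<Sum>b\<in>?C. x b *s l b) v)"
      by (rule representation_add[OF indS span_sum span_scale[OF span_base[OF eS]]])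
        (use sp span_scale in blast)
    moreover have "representation S (\<xi> *s e) = (\<lambda>v. \<xi> * representation S e v)"
      by (rule representation_scale[OF indS span_base[OF eS]])
    moreover have "representation S (\<Sum>b\<in>?C. x b *s l b) = (\<lambda>v. \<Sum>b\<in>?C. representation S (x b *s l b) v)"
      by (rule representation_sum[OF indS]) (use sp span_scale in blast)
    moreover have "representation S (x b *s l b) = (\<lambda>v. x b * representation S (l b) v)" if "b \<in> ?C" for b
      by (rule representation_scale[OF indS sp[OF that]])
    ultimately show ?thesis unfolding lr by (simp add: repe repl)
  qed
  have inj: "inj_on l ?C" using inj_l C' inj_on_subset by blast
  have xb: "representation S (l r) (l b) = x b" if "b \<in> ?C" for b
  proof -
    have "(\<Sum>b'\<in>?C. x b' * (if l b = l b' then 1 else 0)) = (\<Sum>b'\<in>?C. if b' = b then x b' else 0)"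
      by (rule sum.cong) (use inj that in \<open>auto simp: inj_on_def\<close>)
    also have "\<dots> = x b" using that fin by simp
    finally show ?thesis using rep[of "l b"] e_notin_lifts[OF C'] that by auto
  qed
  have xne: "x b \<noteq> 0" if "b \<in> C" for b using gne[OF that] g(2) by (simp add: x_def)
  have sum_eq: "(\<Sum>b\<in>?C. \<bar>representation S (l r) (l b)\<bar>) = (\<Sum>b\<in>?C. \<bar>x b\<bar>)"
    by (rule sum.cong) (simp_all add: xb)
  note bound = sum_coords_bound[OF S(1) eS C' lS rM, unfolded sum_eq]
  \<comment> \<open>Otherwise the lattice of \<open>S\<close> is contained in that of \<open>S\<^sub>0\<close>, so \<open>h\<close> represents its nontrivial class.\<close>
  have meets: "\<exists>b\<in>C. l b \<in> span B"
  proof (rule ccontr)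
    assume no: "\<not> (\<exists>b\<in>C. l b \<in> span B)"
    have intS: "integral_over S\<^sub>0 s" if "s \<in> S" for s
    proof (cases "s \<in> S\<^sub>0")
      case True
      then show ?thesis by (simp add: integral_over_def representation_basis[OF independent_S0])
    next
      case False
      then obtain b where "b \<in> ?C" "s = l b" using S(3) e_in_S0 \<open>s \<in> S\<close> by blast
      then show ?thesis using outside_span_B(1)[of b] no C(1) by blast
    qed
    have lift: "integral_over S\<^sub>0 z" if z: "z \<in> Z" "integral_over S z" for z
    proof -
      have "s \<in> Z" if "s \<in> S" for s using S(1) that A_subset_Z by (auto simp: basis_def)
      then have "integral_over S\<^sub>0 (\<Sum>s\<in>S. representation S z s *s s)"
        using z(2) by (intro integral_over_sum[OF basis_S0] intS) (auto simp: integral_over_def)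
      then show ?thesis using basis_expansion[OF S(1) z(1)] by simp
    qed
    have hS: "\<not> integral_over S h" using lift[OF h_in_Z] h_not_integral by blast
    have rI: "integral_over S\<^sub>0 (l r)" using outside_span_B(1)[OF rM] no g(1) by blast
    have "integral_over S (l r)"
    proof (rule ccontr)
      assume "\<not> integral_over S (l r)"
      then have "integral_over S (h - l r)"
        using basis_index_2[OF S(1) h_in_Z l_in_Z[OF rM] hS] by blast
      then have "integral_over S\<^sub>0 (h - l r)" using lift Z_diff[OF h_in_Z l_in_Z[OF rM]] by blast
      then have "representation S\<^sub>0 (h - l r) e + representation S\<^sub>0 (l r) e \<in> \<int>"
        using rI by (auto simp: integral_over_def)
      then show False
        using representation_diff[OF independent_S0 basis_span[OF basis_S0 l_in_Z[OF rM]] basis_span[OF basis_S0 h_in_Z]]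
          half_notin_Ints e_in_B by (simp add: coord_h)
    qed
    then have xint: "x b \<in> \<int>" if "b \<in> ?C" for b
      using xb[OF that] unfolding integral_over_def by metis
    have x1: "\<bar>x b\<bar> \<ge> 1" if "b \<in> ?C" for b
      using xint[OF that] xne that Ints_nonzero_abs_ge1 by blast
    have le1: "(\<Sum>b\<in>?C. \<bar>x b\<bar>) \<le> 1" using bound(2) hS h_in_Z by auto
    have "real (card ?C) \<le> (\<Sum>b\<in>?C. \<bar>x b\<bar>)" using sum_bounded_below[of ?C 1 "\<lambda>b. \<bar>x b\<bar>"] x1 by simp
    then have "card ?C \<le> 1" using le1 by linarith
    then consider "?C = {}" | b where "?C = {b}"
      using fin by (metis One_nat_def card_0_eq card_1_singletonE finite_Diff le_Suc_eq le_zero_eq)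
    then show False
    proof cases
      case 1
      have "l r = \<xi> *s e" using lr unfolding 1 by simp
      then show ?thesis using lift_not_in_span[OF rM] span_scale[OF span_base, of e "{e}" \<xi>] by simp
    next
      case 2
      then have b: "b \<in> M" "b \<noteq> r" using C' by auto
      have lrb: "l r = \<xi> *s e + x b *s l b" using lr unfolding 2 by simp
      have "\<bar>x b\<bar> = 1" using le1 x1[of b] unfolding 2 by simp
      then have "l r - l b = \<xi> *s e \<or> l r + l b = \<xi> *s e"
        using lrb by (auto simp: abs_if split: if_splits)
      then show ?thesis
        using lifts_differ[OF rM b(1)] b(2) span_scale[OF span_base, of e "{e}" \<xi>] by auto
    qed
  qed
  \<comment> \<open>\<open>w\<close> is the index of the lattice of \<open>S\<close>, and clears the denominators.\<close>
  have build: thesis if w: "w \<in> {1, 2 :: int}" "\<And>b. b \<in> ?C \<Longrightarrow> of_int w * x b \<in> \<int>"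
    "of_int w * (1 + (\<Sum>b\<in>?C. \<bar>x b\<bar>)) \<le> 4" for w
  proof -
    define c where "c b = (if b = r then - w else \<lfloor>of_int w * x b\<rfloor>)" for b
    have cb: "real_of_int (c b) = of_int w * x b" if "b \<in> ?C" for b
      using w(2)[OF that] that by (auto simp: c_def elim: Ints_cases)
    have cr: "c r = - w" by (simp add: c_def)
    show thesis
    proof (rule result[OF _ _ _ meets])
      show "c b \<noteq> 0" if "b \<in> C" for b
      proof (cases "b = r")
        case True
        then show ?thesis using w(1) cr by auto
      next
        case False
        then show ?thesis using cb[of b] w(1) xne[of b] that by auto
      qed
      have "real_of_int (\<Sum>b\<in>C. \<bar>c b\<bar>) = of_int \<bar>c r\<bar> + (\<Sum>b\<in>?C. \<bar>real_of_int (c b)\<bar>)"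
        by (subst sum.remove[OF fin g(1)]) simp
      also have "(\<Sum>b\<in>?C. \<bar>real_of_int (c b)\<bar>) = (\<Sum>b\<in>?C. of_int w * \<bar>x b\<bar>)"
        by (rule sum.cong) (use w(1) in \<open>auto simp: cb abs_mult\<close>)
      also have "of_int \<bar>c r\<bar> + \<dots> = of_int w * (1 + (\<Sum>b\<in>?C. \<bar>x b\<bar>))"
        using w(1) by (auto simp: cr sum_distrib_left[symmetric])
      finally show "(\<Sum>b\<in>C. \<bar>c b\<bar>) \<le> 4" using w(3) by linarith
      have "(\<Sum>b\<in>C. real_of_int (c b) *s l b) = of_int (c r) *s l r + (\<Sum>b\<in>?C. of_int (c b) *s l b)"
        by (rule sum.remove[OF fin g(1)])
      also have "(\<Sum>b\<in>?C. of_int (c b) *s l b) = of_int w *s (\<Sum>b\<in>?C. x b *s l b)"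
        by (simp add: cb scale_sum_right)
      also have "(\<Sum>b\<in>?C. x b *s l b) = l r - \<xi> *s e" by (subst lr) simp
      also have "of_int (c r) *s l r + of_int w *s (l r - \<xi> *s e) = (- of_int w * \<xi>) *s e"
        by (simp add: cr scale_right_diff_distrib scale_minus_left)
      finally show "(\<Sum>b\<in>C. real_of_int (c b) *s l b) = (- of_int w * \<xi>) *s e" .
    qed
  qed
  show thesis
  proof (cases "\<exists>z\<in>Z. \<not> integral_over S z")
    case True
    show thesis
    proof (rule build[of 2])
      show "of_int 2 * x b \<in> \<int>" if "b \<in> ?C" for b
        using basis_half_integral[OF S(1) l_in_Z[OF rM], of "l b"] xb[OF that] by simp
      show "of_int 2 * (1 + (\<Sum>b\<in>?C. \<bar>x b\<bar>)) \<le> 4" using bound(2)[OF True] by simp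
    qed simp
  next
    case False
    show thesis
    proof (rule build[of 1])
      show "of_int 1 * x b \<in> \<int>" if "b \<in> ?C" for b
        using False l_in_Z[OF rM] xb[OF that] unfolding integral_over_def by (metis mult_1 of_int_1)
      show "of_int 1 * (1 + (\<Sum>b\<in>?C. \<bar>x b\<bar>)) \<le> 4" using bound(1) by simp
    qed simp
  qed
qed

text \<open>
Comparing coordinates at a member of \<open>N\<close> shows that the signed coefficients of a class add up to zero,
so the absolute values in a class that occurs have an even sum, at least 2. Since some weight lies
in \<open>span B\<close> and the total is at most 4, only one class occurs and its weight is exactly 2.
\<close>

lemma circuit_shape:
  assumes C: "C \<subseteq> M" "circ_mod_e C" and out: "\<not> (\<forall>b\<in>C. l b \<in> span B)"
  obtains c :: "'i \<Rightarrow> int" and \<phi> b b' where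
    "(\<Sum>b\<in>C. of_int (c b) *s l b) = \<phi> *s e" "\<And>b. b \<in> C \<Longrightarrow> c b \<noteq> 0"
    "b \<noteq> b'" "{b \<in> C. l b \<notin> span B} = {b, b'}" "cls b = cls b'" "\<bar>c b\<bar> = 1" "\<bar>c b'\<bar> = 1"
    "(\<Sum>u | u \<in> C \<and> l u \<in> span B. \<bar>c u\<bar>) \<le> 2" "\<exists>u\<in>C. l u \<in> span B"
proof -
  have fin: "finite C" using C(1) finite_M finite_subset by blast
  obtain c :: "'i \<Rightarrow> int" and \<phi> where c: "\<And>b. b \<in> C \<Longrightarrow> c b \<noteq> 0" "(\<Sum>b\<in>C. \<bar>c b\<bar>) \<le> 4"
    "(\<Sum>b\<in>C. of_int (c b) *s l b) = \<phi> *s e" "\<exists>b\<in>C. l b \<in> span B"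
    using circuit_coeffs[OF C] by blast
  let ?O = "{b \<in> C. l b \<notin> span B}" and ?P = "{u. u \<in> C \<and> l u \<in> span B}"
  have finO: "finite ?O" "finite ?P" using fin by auto
  have "?O \<union> ?P = C" "?O \<inter> ?P = {}" by auto
  then have tot: "(\<Sum>b\<in>?O. \<bar>c b\<bar>) + (\<Sum>b\<in>?P. \<bar>c b\<bar>) \<le> 4"
    using sum.union_disjoint[OF finO, of "\<lambda>b. \<bar>c b\<bar>"] c(2) by simp
  obtain u where u: "u \<in> ?P" using c(4) by blast
  have "\<bar>c u\<bar> \<le> (\<Sum>b\<in>?P. \<bar>c b\<bar>)" by (rule member_le_sum[OF u]) (use finO in auto)
  then have P1: "(\<Sum>b\<in>?P. \<bar>c b\<bar>) \<ge> 1" using c(1)[of u] u by auto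
  have zero: "(\<Sum>b | b \<in> ?O \<and> cls b = p. c b * sg b) = 0" if p: "p \<in> N" for p
  proof -
    have lp: "l p \<in> S\<^sub>0" "l p \<notin> B" using p N_subset_S0 N_outside[OF p] span_base by blast+
    have "coord (\<Sum>b\<in>C. of_int (c b) *s l b) (l p) = (\<Sum>b\<in>C. of_int (c b) * coord (l b) (l p))"
      by (rule coord_sum) (use l_in_Z C(1) in blast)
    moreover have "coord (\<phi> *s e) (l p) = 0"
      using lp(2) e_in_B representation_scale[OF independent_S0 span_base[OF e_in_S0]]
      by (auto simp: representation_basis[OF independent_S0 e_in_S0])
    ultimately have "(\<Sum>b\<in>C. of_int (c b) * coord (l b) (l p)) = 0" using c(3) by simp
    moreover have "(\<Sum>b\<in>C. of_int (c b) * coord (l b) (l p)) =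
        (\<Sum>b\<in>{b \<in> ?O. cls b = p}. of_int (c b) * coord (l b) (l p))"
    proof (rule sum.mono_neutral_right[OF fin])
      show "\<forall>b\<in>C - {b \<in> ?O. cls b = p}. of_int (c b) * coord (l b) (l p) = 0"
      proof
        fix b assume b: "b \<in> C - {b \<in> ?O. cls b = p}"
        then have bM: "b \<in> M" using C(1) by blast
        show "of_int (c b) * coord (l b) (l p) = 0"
        proof (cases "l b \<in> span B")
          case True
          then show ?thesis using coord_inside[OF True] representation_outside[OF lp(2)] by simp
        next
          case False
          then show ?thesis using cls_props(3)[OF bM False p] b by auto
        qed
      qed
    qed auto
    moreover have "\<dots> = (\<Sum>b\<in>{b \<in> ?O. cls b = p}. of_int (c b * sg b))"
      by (rule sum.cong) (use cls_props(2) C(1) in auto)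
    ultimately have "real_of_int (\<Sum>b | b \<in> ?O \<and> cls b = p. c b * sg b) = 0" by simp
    then show ?thesis by linarith
  qed
  have sg1: "\<bar>sg b\<bar> = 1" if "b \<in> ?O" for b using cls_props(4)[of b] that C(1) by blast
  have clsN: "cls b \<in> N" if "b \<in> ?O" for b using cls_props(1)[of b] that C(1) by blast
  let ?Q = "\<lambda>p. {b. b \<in> ?O \<and> cls b = p}"
  have finQ: "finite (?Q p)" for p using fin by auto
  have even: "even (\<Sum>b\<in>?Q p. \<bar>c b\<bar>)" if "p \<in> N" for p
  proof -
    have "even (\<Sum>b\<in>?Q p. \<bar>c b\<bar> - c b * sg b)"
    proof (rule dvd_sum)
      fix b assume "b \<in> ?Q p"
      then have "\<bar>sg b\<bar> = 1" using sg1 by blast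
      then have "sg b = 1 \<or> sg b = -1" by linarith
      then show "even (\<bar>c b\<bar> - c b * sg b)" by (auto simp: abs_if)
    qed
    then show ?thesis using zero[OF that] by (simp add: sum_subtractf)
  qed
  have ge: "\<bar>c b\<bar> \<ge> 1" if "b \<in> C" for b using c(1)[OF that] by linarith
  have two: "(\<Sum>b\<in>?Q (cls b). \<bar>c b\<bar>) \<ge> 2" if b: "b \<in> ?O" for b
  proof -
    have "b \<in> ?Q (cls b)" using b by blast
    then have "\<bar>c b\<bar> \<le> (\<Sum>b\<in>?Q (cls b). \<bar>c b\<bar>)" by (intro member_le_sum) (use finQ in auto)
    then have "(\<Sum>b\<in>?Q (cls b). \<bar>c b\<bar>) \<ge> 1" using ge[of b] b by auto
    then show ?thesis using even[OF clsN[OF b]] by presburger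
  qed
  obtain b where b: "b \<in> ?O" using out by blast
  let ?p = "cls b"
  have bQ: "b \<in> ?Q ?p" using b by blast
  have QO: "?Q ?p = ?O"
  proof (rule ccontr)
    assume "?Q ?p \<noteq> ?O"
    then obtain b2 where b2: "b2 \<in> ?O" "cls b2 \<noteq> ?p" by blast
    have "(\<Sum>b\<in>?Q ?p \<union> ?Q (cls b2). \<bar>c b\<bar>) = (\<Sum>b\<in>?Q ?p. \<bar>c b\<bar>) + (\<Sum>b\<in>?Q (cls b2). \<bar>c b\<bar>)"
      by (rule sum.union_disjoint[OF finQ finQ]) (use b2 in auto)
    moreover have "(\<Sum>b\<in>?Q ?p \<union> ?Q (cls b2). \<bar>c b\<bar>) \<le> (\<Sum>b\<in>?O. \<bar>c b\<bar>)"
      by (rule sum_mono2[OF finO(1)]) auto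
    ultimately show False using two[OF b] two[OF b2(1)] tot P1 by linarith
  qed
  have O2: "(\<Sum>b\<in>?O. \<bar>c b\<bar>) = 2"
    using two[OF b] even[OF clsN[OF b]] tot P1 unfolding QO by presburger
  have "\<exists>b'\<in>?O. b' \<noteq> b"
  proof (rule ccontr)
    assume "\<not> ?thesis"
    then have "?Q ?p = {b}" using bQ QO by blast
    then show False using zero[OF clsN[OF b]] c(1)[of b] sg1[OF b] b by auto
  qed
  then obtain b' where b': "b' \<in> ?O" "b' \<noteq> b" by blast
  have "(\<Sum>b\<in>?O. \<bar>c b\<bar>) = \<bar>c b\<bar> + (\<Sum>b\<in>?O - {b}. \<bar>c b\<bar>)"
    by (rule sum.remove[OF finO(1) b])
  also have "(\<Sum>b\<in>?O - {b}. \<bar>c b\<bar>) = \<bar>c b'\<bar> + (\<Sum>b\<in>?O - {b} - {b'}. \<bar>c b\<bar>)"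
    by (rule sum.remove) (use finO b' in auto)
  finally have eq: "2 = \<bar>c b\<bar> + (\<bar>c b'\<bar> + (\<Sum>b\<in>?O - {b} - {b'}. \<bar>c b\<bar>))" using O2 by simp
  have nn: "(\<Sum>b\<in>?O - {b} - {b'}. \<bar>c b\<bar>) \<ge> 0" by (simp add: sum_nonneg)
  have ge_b: "\<bar>c b\<bar> \<ge> 1" "\<bar>c b'\<bar> \<ge> 1" using ge[of b] ge[of b'] b b' by auto
  have c1: "\<bar>c b\<bar> = 1" "\<bar>c b'\<bar> = 1" and r0: "(\<Sum>b\<in>?O - {b} - {b'}. \<bar>c b\<bar>) = 0"
    using eq nn ge_b by linarith+
  have "?O - {b} - {b'} = {}"
  proof (rule ccontr)
    assume "?O - {b} - {b'} \<noteq> {}"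
    then obtain d where d: "d \<in> ?O - {b} - {b'}" by blast
    then have "\<bar>c d\<bar> \<le> (\<Sum>b\<in>?O - {b} - {b'}. \<bar>c b\<bar>)" by (intro member_le_sum) (use finO in auto)
    then show False using r0 ge[of d] d by auto
  qed
  then have Oeq: "?O = {b, b'}" using b b' by blast
  have "b' \<in> ?Q ?p" using b'(1) unfolding QO .
  then have "cls b = cls b'" by simp
  moreover have "(\<Sum>b\<in>?P. \<bar>c b\<bar>) \<le> 2" using tot O2 by linarith
  ultimately show thesis
    using that[of c \<phi> b b'] c b'(2) Oeq c1 by blast
qed

lemma coord_add: "u \<in> Z \<Longrightarrow> v \<in> Z \<Longrightarrow> coord (u + v) s = coord u s + coord v s"
  using representation_add[OF independent_S0] basis_span[OF basis_S0] by simp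

lemma coord_scale: "v \<in> Z \<Longrightarrow> coord (c *s v) s = c * coord v s"
  using representation_scale[OF independent_S0] basis_span[OF basis_S0] by simp

lemma coord_e: "coord e s = (if s = e then 1 else 0)"
  by (simp add: representation_basis[OF independent_S0 e_in_S0])

text \<open>
If \<open>n\<close> is odd, replace \<open>l b\<close> by its other lift. The gap is 1, so this makes the multiple of \<open>e\<close> even and the
half-sum of the two lifts integral. Two independent columns then compete with \<open>B\<close> for minimality.
\<close>

lemma half_sum_of_pair:
  assumes b: "b \<in> M" "l b \<notin> span B" "b' \<in> M" "\<not> dep_mod_e {b, b'}" "b \<noteq> b'"
    and \<epsilon>: "\<bar>\<epsilon>\<bar> = 1" "\<bar>\<epsilon>'\<bar> = (1::int)"
    and w: "w \<in> Z" "of_int \<epsilon> *s l b + of_int \<epsilon>' *s l b' = (w + w) + of_int n *s e"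
  shows "card B = 2"
proof -
  define t where "t = (if even n then 0 else 1 :: int)"
  define a where "a = l b + of_int t *s e"
  have aA: "a \<in> A"
    using lift_in_A[OF b(1)] shifted_lift_in_A[OF b(1)] outside_span_B(2)[OF b(1,2)]
    by (simp add: a_def t_def)
  have b'A: "l b' \<in> A" by (rule lift_in_A[OF b(3)])
  have comb: "x = 0 \<and> y = 0" if "x *s a + y *s l b' = 0" for x y
  proof (rule ccontr)
    assume ne: "\<not> (x = 0 \<and> y = 0)"
    have "x *s l b + y *s l b' + (x * of_int t) *s e = 0"
      using that by (simp add: a_def algebra_simps)
    then have "x *s l b + y *s l b' = - ((x * of_int t) *s e)"
      by (simp only: eq_neg_iff_add_eq_0)
    then have "(\<Sum>i\<in>{b, b'}. (if i = b then x else y) *s l i) = (- (x * of_int t)) *s e"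
      using b(5) by (simp add: scale_minus_left)
    from dep_mod_e_I[OF _ _ this, of b] dep_mod_e_I[OF _ _ this, of b'] have "dep_mod_e {b, b'}"
      using ne b(5) by auto
    then show False using b(4) by simp
  qed
  have "a \<noteq> l b'" using comb[of 1 "-1"] by auto
  have ind: "independent {a, l b'}"
  proof
    assume "dependent {a, l b'}"
    then obtain f where "f a \<noteq> 0 \<or> f (l b') \<noteq> 0" "f a *s a + f (l b') *s l b' = 0"
      using dependent_finite[of "{a, l b'}"] \<open>a \<noteq> l b'\<close> by auto
    then show False using comb by blast
  qed
  obtain n' where n': "n + \<epsilon> * t = 2 * n'"
  proof -
    have "\<epsilon> = 1 \<or> \<epsilon> = -1" using \<epsilon>(1) by linarith
    then have "even (n + \<epsilon> * t)" by (auto simp: t_def)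
    then show thesis by (rule evenE) (rule that)
  qed
  obtain k where k: "1 - \<epsilon> = 2 * k" using \<epsilon>(1) that[of 0] that[of 1] by (auto simp: abs_if split: if_splits)
  obtain k' where k': "1 - \<epsilon>' = 2 * k'" using \<epsilon>(2) that[of 0] that[of 1] by (auto simp: abs_if split: if_splits)
  define z where "z = w + of_int n' *s e + of_int k *s a + of_int k' *s l b'"
  have zZ: "z \<in> Z"
    unfolding z_def using w(1) e_in_Z aA b'A A_subset_Z by (intro Z_closed(3) Z_of_int) auto
  have "z + z = (w + w) + (of_int n' *s e + of_int n' *s e) + (of_int k *s a + of_int k *s a) + (of_int k' *s l b' + of_int k' *s l b')"
    by (simp add: z_def algebra_simps)
  also have "\<dots> = (w + w) + of_int (2 * n') *s e + of_int (2 * k) *s a + of_int (2 * k') *s l b'"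
    by (simp add: scale_left_distrib[symmetric])
  also have "\<dots> = ((w + w) + of_int n *s e) + of_int (\<epsilon> * t) *s e + of_int (1 - \<epsilon>) *s a + of_int (1 - \<epsilon>') *s l b'"
    unfolding n'[symmetric] k[symmetric] k'[symmetric] by (simp add: scale_left_distrib add.assoc)
  also have "\<dots> = a + l b'"
    unfolding w(2)[symmetric] a_def by (simp add: algebra_simps)
  finally have "z + z = \<Sum>{a, l b'}" using \<open>a \<noteq> l b'\<close> by simp
  then have "card B \<le> card {a, l b'}"
    using minimal[of "{a, l b'}" z] aA b'A ind zZ by simp
  then show ?thesis using \<open>a \<noteq> l b'\<close> card_B by simp
qed

text \<open>
A single vector \<open>u\<close> of the circuit in \<open>span B\<close> cannot have coefficient \<open>\<plusminus>1\<close>: the two others are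
integral over \<open>S\<^sub>0\<close>, whereas \<open>u\<close> is not, even at a basis vector other than \<open>e\<close>.
\<close>

lemma circuit_cases:
  assumes C: "C \<subseteq> M" "circ_mod_e C" and out: "\<not> (\<forall>b\<in>C. l b \<in> span B)"
  obtains (one) b b' u and \<sigma> \<tau> :: int and \<phi> where
      "C = {b, b', u}" "l b \<notin> span B" "l b' \<notin> span B" "l u \<in> span B" "b \<noteq> b'" "card B = 2"
      "\<bar>\<sigma>\<bar> = 1" "\<bar>\<tau>\<bar> = 1" "l b' = of_int \<sigma> *s l b + of_int (2 * \<tau>) *s l u + \<phi> *s e"
  | (two) b b' u u' and \<sigma> \<tau> \<tau>' :: int and \<phi> where
      "C = {b, b', u, u'}" "l b \<notin> span B" "l b' \<notin> span B" "l u \<in> span B" "l u' \<in> span B"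
      "b \<noteq> b'" "u \<noteq> u'" "cls b = cls b'"
      "\<bar>\<sigma>\<bar> = 1" "\<bar>\<tau>\<bar> = 1" "\<bar>\<tau>'\<bar> = 1"
      "l b' = of_int \<sigma> *s l b + of_int \<tau> *s l u + of_int \<tau>' *s l u' + \<phi> *s e"
proof -
  have fin: "finite C" using C(1) finite_M finite_subset by blast
  obtain c :: "'i \<Rightarrow> int" and \<phi> b b' where c:
    "(\<Sum>b\<in>C. of_int (c b) *s l b) = \<phi> *s e" "\<And>b. b \<in> C \<Longrightarrow> c b \<noteq> 0"
    "b \<noteq> b'" "{b \<in> C. l b \<notin> span B} = {b, b'}" "cls b = cls b'" "\<bar>c b\<bar> = 1" "\<bar>c b'\<bar> = 1"
    "(\<Sum>u | u \<in> C \<and> l u \<in> span B. \<bar>c u\<bar>) \<le> 2" "\<exists>u\<in>C. l u \<in> span B"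
    using circuit_shape[OF C out] by blast
  let ?P = "{u. u \<in> C \<and> l u \<in> span B}"
  have finP: "finite ?P" using fin by simp
  have ge: "\<bar>c b\<bar> \<ge> 1" if "b \<in> C" for b using c(2)[OF that] by linarith
  obtain u where u: "u \<in> ?P" using c(9) by blast
  have CP: "C = {b, b'} \<union> ?P" using c(4) by blast
  have b: "b \<in> C" "b' \<in> C" "l b \<notin> span B" "l b' \<notin> span B" using c(4) by auto
  have bM: "b \<in> M" "b' \<in> M" using b C(1) by auto
  have uM: "u \<in> M" using u C(1) by blast
  have sq: "c b' * c b' = 1" using c(7) by (auto simp: abs_if split: if_splits)
  have rem: "(\<Sum>v\<in>?P. \<bar>c v\<bar>) = \<bar>c u\<bar> + (\<Sum>v\<in>?P - {u}. \<bar>c v\<bar>)"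
    by (rule sum.remove[OF finP u])
  have sg: "\<bar>- (c b' * c b)\<bar> = 1" using c(6,7) by (simp add: abs_mult)
  show thesis
  proof (cases "?P = {u}")
    case True
    then have Ceq: "C = {b, b', u}" using CP by blast
    have du: "u \<noteq> b" "u \<noteq> b'" using u b by auto
    have rel: "of_int (c b) *s l b + of_int (c b') *s l b' + of_int (c u) *s l u = \<phi> *s e"
      using c(1) c(3) du unfolding Ceq by (simp add: add.assoc)
    have relc: "of_int (c b) * coord (l b) s + of_int (c b') * coord (l b') s + of_int (c u) * coord (l u) s
        = \<phi> * (if s = e then 1 else 0)" for s
      using arg_cong[OF rel, of "\<lambda>v. coord v s"] bM uM l_in_Z Z_of_int e_in_Z
      by (simp add: coord_add coord_scale coord_e Z_closed(3))
    have int: "coord (l b) s \<in> \<int>" "coord (l b') s \<in> \<int>" for s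
      using outside_span_B(1)[OF bM(1) b(3)] outside_span_B(1)[OF bM(2) b(4)] by (auto simp: integral_over_def)
    have "\<not> B \<subseteq> {e}" using card_B card_mono[of "{e}" B] by auto
    then obtain s where s: "s \<in> B" "s \<noteq> e" by blast
    have "\<bar>c u\<bar> \<le> 2" using c(8) True by simp
    moreover have "\<bar>c u\<bar> \<noteq> 1"
    proof
      assume cu: "\<bar>c u\<bar> = 1"
      have "of_int (c u) * coord (l u) s = - (of_int (c b) * coord (l b) s + of_int (c b') * coord (l b') s)"
        using relc[of s] s(2) by simp
      also have "\<dots> \<in> \<int>" by (intro Ints_minus Ints_add Ints_mult int Ints_of_int)
      finally have "of_int (c u) * coord (l u) s \<in> \<int>" .
      moreover have "c u = 1 \<or> c u = -1" using cu by linarith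
      ultimately have "coord (l u) s \<in> \<int>" by auto
      then show False
        using coords_in_span_B[OF uM _ s(1)] u coord_inside[of u] by simp
    qed
    ultimately have cu: "\<bar>c u\<bar> = 2" using ge[of u] u by auto
    then obtain \<tau> where \<tau>: "c u = 2 * \<tau>" "\<bar>\<tau>\<bar> = 1"
      using that by (metis abs_mult abs_numeral mult_cancel_left1 mult_minus_right abs_if one_neq_zero zero_neq_numeral abs_1)
    have "\<phi> \<in> \<int>"
    proof -
      have "\<phi> = of_int (c b) * coord (l b) e + of_int (c b') * coord (l b') e + of_int \<tau> * (2 * coord (l u) e)"
        using relc[of e] \<tau>(1) by simp
      also have "\<dots> \<in> \<int>"
        by (intro Ints_add Ints_mult int Ints_of_int basis_half_integral[OF basis_S0 l_in_Z[OF uM]])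
      finally show ?thesis .
    qed
    then obtain n where n: "\<phi> = of_int n" by (auto elim: Ints_cases)
    have nd: "\<not> dep_mod_e {b, b'}"
    proof -
      have "{b, b'} \<subset> C" unfolding Ceq using du by auto
      then show ?thesis using C(2) by (auto simp: circ_mod_e_def)
    qed
    have w: "of_int (- \<tau>) *s l u \<in> Z" by (rule Z_of_int[OF l_in_Z[OF uM]])
    have weq: "of_int (c b) *s l b + of_int (c b') *s l b' =
        (of_int (- \<tau>) *s l u + of_int (- \<tau>) *s l u) + of_int n *s e"
    proof -
      have "of_int (c u) *s l u = of_int \<tau> *s l u + of_int \<tau> *s l u"
        by (simp add: \<tau>(1) scale_left_distrib[symmetric])
      then show ?thesis using rel n by (simp add: scale_minus_left algebra_simps)
    qed
    have card2: "card B = 2"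
      by (rule half_sum_of_pair[OF bM(1) b(3) bM(2) nd c(3) c(6,7) w weq])
    have "l b' = of_int (c b') *s (of_int (c b') *s l b')" using sq by (simp flip: of_int_mult)
    also have "of_int (c b') *s l b' = \<phi> *s e - of_int (c b) *s l b - of_int (c u) *s l u"
      using rel by (simp add: algebra_simps)
    also have "of_int (c b') *s \<dots> = of_int (- (c b' * c b)) *s l b + of_int (2 * - (c b' * \<tau>)) *s l u + (of_int (c b') * \<phi>) *s e"
      by (simp add: \<tau>(1) algebra_simps scale_minus_left)
    finally have fin_eq: "l b' = of_int (- (c b' * c b)) *s l b + of_int (2 * - (c b' * \<tau>)) *s l u + (of_int (c b') * \<phi>) *s e" .
    have sg2: "\<bar>- (c b' * \<tau>)\<bar> = 1" using c(7) \<tau>(2) by (simp add: abs_mult)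
    show thesis
      by (rule one[OF Ceq b(3,4) _ c(3) card2 sg sg2 fin_eq]) (use u in simp)
  next
    case False
    then obtain u' where u': "u' \<in> ?P" "u' \<noteq> u" using u by blast
    have rem2: "(\<Sum>v\<in>?P - {u}. \<bar>c v\<bar>) = \<bar>c u'\<bar> + (\<Sum>v\<in>?P - {u} - {u'}. \<bar>c v\<bar>)"
      by (rule sum.remove) (use finP u' in auto)
    have nn: "(\<Sum>v\<in>?P - {u} - {u'}. \<bar>c v\<bar>) \<ge> 0" by (simp add: sum_nonneg)
    have ge_u: "\<bar>c u\<bar> \<ge> 1" "\<bar>c u'\<bar> \<ge> 1" using ge u u' by auto
    have cu: "\<bar>c u\<bar> = 1" "\<bar>c u'\<bar> = 1" and r0: "(\<Sum>v\<in>?P - {u} - {u'}. \<bar>c v\<bar>) = 0"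
      using rem rem2 nn ge_u c(8) by linarith+
    have "?P - {u} - {u'} = {}"
    proof (rule ccontr)
      assume "?P - {u} - {u'} \<noteq> {}"
      then obtain d where d: "d \<in> ?P - {u} - {u'}" by blast
      then have "\<bar>c d\<bar> \<le> (\<Sum>v\<in>?P - {u} - {u'}. \<bar>c v\<bar>)" by (intro member_le_sum) (use finP in auto)
      then show False using r0 ge[of d] d by auto
    qed
    then have "?P = {u, u'}" using u u' by blast
    then have Ceq: "C = {b, b', u, u'}" using CP by blast
    have du: "u \<noteq> b" "u \<noteq> b'" "u' \<noteq> b" "u' \<noteq> b'" using u u' b by auto
    have rel: "of_int (c b) *s l b + of_int (c b') *s l b' + of_int (c u) *s l u + of_int (c u') *s l u' = \<phi> *s e"
      using c(1) c(3) du u'(2) unfolding Ceq by (simp add: add.assoc)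
    have "l b' = of_int (c b') *s (of_int (c b') *s l b')" using sq by (simp flip: of_int_mult)
    also have "of_int (c b') *s l b' = \<phi> *s e - of_int (c b) *s l b - of_int (c u) *s l u - of_int (c u') *s l u'"
      using rel by (simp add: algebra_simps)
    also have "of_int (c b') *s \<dots> = of_int (- (c b' * c b)) *s l b + of_int (- (c b' * c u)) *s l u
        + of_int (- (c b' * c u')) *s l u' + (of_int (c b') * \<phi>) *s e"
      by (simp add: algebra_simps scale_minus_left)
    finally have fin_eq: "l b' = of_int (- (c b' * c b)) *s l b + of_int (- (c b' * c u)) *s l u
        + of_int (- (c b' * c u')) *s l u' + (of_int (c b') * \<phi>) *s e" .
    have sgs: "\<bar>- (c b' * c u)\<bar> = 1" "\<bar>- (c b' * c u')\<bar> = 1" using c(7) cu by (simp_all add: abs_mult)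
    show thesis
      by (rule two[OF Ceq b(3,4) _ _ c(3) u'(2)[symmetric] c(5) sg sgs fin_eq]) (use u u' in simp_all)
  qed
qed

section \<open>Size of the classes\<close>

lemma coord_diff_same_class:
  assumes b: "b \<in> M" "l b \<notin> span B" and b': "b' \<in> M" "l b' \<notin> span B"
    and cl: "cls b = cls b'" and s: "s \<notin> B"
  shows "coord (l b) s - of_int (sg b * sg b') * coord (l b') s = 0"
proof (cases "s \<in> l ` N")
  case False
  then show ?thesis using coord_outside[OF b(1)] coord_outside[OF b'(1)] s by simp
next
  case True
  then obtain p where p: "p \<in> N" "s = l p" by blast
  show ?thesis
  proof (cases "p = cls b")
    case True
    have "sg b' * sg b' = 1" using cls_props(4)[OF b'] by (auto simp: abs_if split: if_splits)
    then have "of_int (sg b * sg b') * real_of_int (sg b') = real_of_int (sg b)"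
      by (metis mult.assoc mult.right_neutral of_int_mult)
    then show ?thesis using cls_props(2)[OF b] cls_props(2)[OF b'] True cl p(2) by simp
  next
    case False
    then show ?thesis using cls_props(3)[OF b p(1)] cls_props(3)[OF b' p(1)] cl p(2) by simp
  qed
qed

text \<open>
Coordinates of \<open>l b\<close> minus or plus \<open>l b'\<close>, the sign being chosen so that the result lies in \<open>span B\<close> if
\<open>b\<close> and \<open>b'\<close> are in the same class.
\<close>

definition diff_coord :: "'i \<Rightarrow> 'i \<Rightarrow> 'v \<Rightarrow> int" where
  "diff_coord b b' s = \<lfloor>coord (l b) s - of_int (sg b * sg b') * coord (l b') s\<rfloor>"

lemma diff_coord:
  assumes b: "b \<in> M" "l b \<notin> span B" and b': "b' \<in> M" "l b' \<notin> span B"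
  shows "of_int (diff_coord b b' s) = coord (l b) s - of_int (sg b * sg b') * coord (l b') s"
proof -
  have "coord (l b) s - of_int (sg b * sg b') * coord (l b') s \<in> \<int>"
    using outside_span_B(1)[OF b] outside_span_B(1)[OF b']
    by (intro Ints_diff Ints_mult Ints_of_int) (auto simp: integral_over_def)
  then show ?thesis unfolding diff_coord_def by (auto elim: Ints_cases)
qed

lemma same_class_diff:
  assumes b: "b \<in> M" "l b \<notin> span B" and b': "b' \<in> M" "l b' \<notin> span B" and cl: "cls b = cls b'"
  shows "l b = of_int (sg b * sg b') *s l b' + (\<Sum>s\<in>B. of_int (diff_coord b b' s) *s s)"
proof -
  let ?d = "l b - of_int (sg b * sg b') *s l b'"
  have Z: "?d \<in> Z" by (intro Z_diff Z_of_int l_in_Z b(1) b'(1))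
  have d: "coord ?d s = of_int (diff_coord b b' s)" for s
  proof -
    have "coord ?d s = coord (l b) s - coord (of_int (sg b * sg b') *s l b') s"
      by (subst representation_diff[OF independent_S0 basis_span[OF basis_S0] basis_span[OF basis_S0]])
        (intro Z_of_int l_in_Z b(1) b'(1), rule l_in_Z[OF b(1)], rule refl)
    then show ?thesis using diff_coord[OF b b'] coord_scale[OF l_in_Z[OF b'(1)]] by simp
  qed
  have "coord ?d s = 0" if "s \<notin> B" for s
    unfolding d diff_coord[OF b b'] by (rule coord_diff_same_class[OF b b' cl that])
  from in_span_B_if(1)[OF Z this] show ?thesis unfolding d by (simp add: algebra_simps)
qed

text \<open>
Let \<open>J\<close> be the set of odd coordinates along \<open>B - {e}\<close>. Choose the lift of \<open>b\<close> such that the coordinate at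
\<open>e\<close> is odd as well. Modulo \<open>2 Z\<close> the two lifts then add up to the sum of \<open>{e} \<union> J\<close>, so together with
\<open>B - {e} - J\<close> they form an independent set with integral half-sum; its cardinality is
\<open>card B + 1 - card J\<close>, and minimality gives the first claim. If \<open>J\<close> is empty, then the lift with even
coordinate at \<open>e\<close> makes the half-sum of the two lifts alone integral, which is impossible if \<open>B\<close> has
at least three elements.
\<close>

lemma odd_coords_same_class:
  assumes b: "b \<in> M" "l b \<notin> span B" and b': "b' \<in> M" "l b' \<notin> span B"
    and cl: "cls b = cls b'" and ne: "b \<noteq> b'"
  defines "J \<equiv> {s \<in> B - {e}. odd (diff_coord b b' s)}"
  shows "card J \<le> 1" "card B \<ge> 3 \<Longrightarrow> J \<noteq> {}"
proof -
  define \<epsilon> where "\<epsilon> = sg b * sg b'"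
  let ?y = "diff_coord b b'"
  have \<epsilon>: "\<epsilon> = 1 \<or> \<epsilon> = -1"
    using cls_props(4)[OF b] cls_props(4)[OF b'] unfolding \<epsilon>_def by (auto simp: abs_if split: if_splits)
  have eq: "l b = of_int \<epsilon> *s l b' + (\<Sum>s\<in>B. of_int (?y s) *s s)"
    using same_class_diff[OF b b' cl] unfolding \<epsilon>_def .
  have eB: "e \<in> B" by (rule e_in_B)
  have shift: "l b + of_int t *s e \<in> A" if "t \<in> {0, 1}" for t :: int
    using that lift_in_A[OF b(1)] shifted_lift_in_A[OF b(1)] outside_span_B(2)[OF b] by auto
  \<comment> \<open>The lift \<open>a\<close> of \<open>b\<close> is chosen such that its coordinate at \<open>e\<close> is odd, so that \<open>e\<close> can be left out.\<close>
  obtain t :: int where t: "t \<in> {0, 1}" "odd (?y e + t)"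
    using that[of 0] that[of 1] by (cases "even (?y e)") auto
  define a where "a = l b + of_int t *s e"
  define y where "y s = ?y s + (if s = e then t else 0)" for s
  have sum_e: "(\<Sum>s\<in>B. of_int (if s = e then t else 0) *s s) = of_int t *s e"
  proof -
    have "(\<Sum>s\<in>B. of_int (if s = e then t else 0) *s s) = (\<Sum>s\<in>B. if s = e then of_int t *s e else 0)"
      by (rule sum.cong) auto
    then show ?thesis using eB finite_B by simp
  qed
  have a_eq: "a = of_int \<epsilon> *s l b' + (\<Sum>s\<in>B. of_int (y s) *s s)"
    unfolding a_def y_def eq by (simp add: scale_left_distrib sum.distrib sum_e add.assoc)
  let ?R = "B - {e} - J"
  have RB: "?R \<subseteq> B" by blast
  have b'R: "l b' \<notin> span ?R" using b'(2) span_mono[OF RB] by blast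
  have indR: "independent (insert (l b') ?R)"
    by (rule independent_insertI[OF b'R independent_mono[OF independent_B RB]])
  have aR: "a \<notin> span (insert (l b') ?R)"
  proof
    assume "a \<in> span (insert (l b') ?R)"
    then obtain k where k: "a - k *s l b' \<in> span ?R" by (auto simp: span_breakdown_eq)
    have sumB: "(\<Sum>s\<in>B. of_int (y s) *s s) \<in> span B"
      by (intro span_sum span_scale span_base)
    have "a - k *s l b' \<in> span B" using k span_mono[OF RB] by blast
    then have "a - k *s l b' - (\<Sum>s\<in>B. of_int (y s) *s s) \<in> span B"
      using sumB by (rule span_diff)
    then have "(of_int \<epsilon> - k) *s l b' \<in> span B"
      unfolding a_eq by (simp add: algebra_simps)
    then have "k = of_int \<epsilon>"
    proof (rule contrapos_pp)
      assume "k \<noteq> of_int \<epsilon>"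
      then have nz: "of_int \<epsilon> - k \<noteq> 0" by simp
      show "(of_int \<epsilon> - k) *s l b' \<notin> span B"
      proof
        assume "(of_int \<epsilon> - k) *s l b' \<in> span B"
        then have "(1 / (of_int \<epsilon> - k)) *s ((of_int \<epsilon> - k) *s l b') \<in> span B" by (rule span_scale)
        then show False using b'(2) nz by simp
      qed
    qed
    then have "(\<Sum>s\<in>B. of_int (y s) *s s) \<in> span ?R" using k unfolding a_eq by (simp add: algebra_simps)
    then have "representation B (\<Sum>s\<in>B. of_int (y s) *s s) = representation ?R (\<Sum>s\<in>B. of_int (y s) *s s)"
      by (rule representation_extend[OF independent_B _ RB])
    then have "representation B (\<Sum>s\<in>B. of_int (y s) *s s) e = 0"
      by (simp add: representation_outside)
    moreover have "representation B (\<Sum>s\<in>B. of_int (y s) *s s) e = of_int (y e)"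
    proof -
      have "representation B (\<Sum>s\<in>B. of_int (y s) *s s) = (\<lambda>v. \<Sum>s\<in>B. representation B (of_int (y s) *s s) v)"
        by (rule representation_sum[OF independent_B]) (intro span_scale span_base)
      also have "\<dots> = (\<lambda>v. \<Sum>s\<in>B. if s = v then of_int (y s) else 0)"
        by (intro ext sum.cong) (auto simp: representation_scale[OF independent_B span_base]
            representation_basis[OF independent_B])
      finally show ?thesis using eB finite_B by simp
    qed
    ultimately have "y e = 0" by simp
    then have "?y e + t = 0" by (simp add: y_def)
    then show False using t(2) by simp
  qed
  have indep: "independent (insert a (insert (l b') ?R))"
    by (rule independent_insertI[OF aR indR])
  have notin: "a \<notin> insert (l b') ?R" "l b' \<notin> ?R"
    using aR b'R span_base[of a "insert (l b') ?R"] span_base[of "l b'" ?R] by blast+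
  have finR: "finite ?R" using finite_B by simp
  have JB: "J \<subseteq> B - {e}" by (auto simp: J_def)
  have sub: "insert a (insert (l b') ?R) \<subseteq> A"
    using shift[OF t(1)] lift_in_A[OF b'(1)] B_subset_A by (auto simp: a_def)
  define n where "n s = (if s \<in> ?R then y s + 1 - 1 else y s - 1) div 2" for s
  have yn: "y s + (if s \<in> ?R then 1 else 0) = 1 + 2 * n s" if "s \<in> B" for s
  proof (cases "s \<in> ?R")
    case True
    then have "even (y s)" using that by (auto simp: J_def y_def)
    then show ?thesis using True by (simp add: n_def)
  next
    case False
    then have "odd (y s)" using that t(2) by (auto simp: J_def y_def)
    then show ?thesis using False unfolding n_def by (simp add: odd_two_times_div_two_succ)
  qed
  obtain k where k: "1 + \<epsilon> = 2 * k" using \<epsilon> that[of 1] that[of 0] by auto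
  define w where "w = (\<Sum>s\<in>B. of_int (n s) *s s)"
  have wZ: "w \<in> Z"
    unfolding w_def using eB finite_B B_subset_A A_subset_Z by (intro Z_sum Z_of_int) auto
  define z where "z = h + w + of_int k *s l b'"
  have zZ: "z \<in> Z" unfolding z_def by (intro Z_closed(3) Z_of_int h_in_Z wZ l_in_Z b'(1))
  have sumR: "\<Sum>?R = (\<Sum>s\<in>B. of_int (if s \<in> ?R then 1 else 0) *s s)"
    by (rule sum.mono_neutral_cong_left) (use finite_B in auto)
  have "\<Sum>(insert a (insert (l b') ?R)) = a + (l b' + \<Sum>?R)"
    using finR notin by simp
  also have "\<dots> = (of_int (1 + \<epsilon>) *s l b') + ((\<Sum>s\<in>B. of_int (y s) *s s) + (\<Sum>s\<in>B. of_int (if s \<in> ?R then 1 else 0) *s s))"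
    unfolding a_eq sumR by (simp add: algebra_simps)
  also have "(\<Sum>s\<in>B. of_int (y s) *s s) + (\<Sum>s\<in>B. of_int (if s \<in> ?R then 1 else 0) *s s)
      = (\<Sum>s\<in>B. of_int (y s + (if s \<in> ?R then 1 else 0)) *s s)"
    by (simp add: sum.distrib scale_left_distrib)
  also have "\<dots> = (\<Sum>s\<in>B. of_int (1 + 2 * n s) *s s)"
    by (rule sum.cong) (simp_all only: yn)
  also have "\<dots> = \<Sum>B + (w + w)"
  proof -
    have "of_int (1 + 2 * n s) *s s = s + (of_int (n s) *s s + of_int (n s) *s s)" for s
    proof -
      have "real_of_int (1 + 2 * n s) = 1 + (of_int (n s) + of_int (n s))" by simp
      then show ?thesis by (simp only: scale_left_distrib scale_one)
    qed
    then show ?thesis unfolding w_def by (simp add: sum.distrib)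
  qed
  also have "of_int (1 + \<epsilon>) *s l b' = of_int k *s l b' + of_int k *s l b'"
    unfolding k by (simp add: scale_left_distrib[symmetric])
  finally have zz: "z + z = \<Sum>(insert a (insert (l b') ?R))"
    unfolding z_def twice_h[symmetric] by (simp add: algebra_simps)
  have "card B \<le> card (insert a (insert (l b') ?R))"
    by (rule minimal[OF sub _ indep zZ zz]) simp
  also have "\<dots> = 2 + card ?R" using finR notin by simp
  also have "card ?R = card B - 1 - card J"
    using eB finite_B JB by (simp add: card_Diff_subset finite_subset)
  finally show J1: "card J \<le> 1" using card_B card_mono[OF _ JB] finite_B eB by simp
  assume B3: "card B \<ge> 3"
  show "J \<noteq> {}"
  proof
    assume "J = {}"
    then have even: "even (?y s)" if "s \<in> B" "s \<noteq> e" for s using that by (auto simp: J_def)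
    define w where "w = (\<Sum>s\<in>B. of_int (if s = e then 0 else ?y s div 2) *s s)"
    have wZ: "w \<in> Z"
      unfolding w_def using eB finite_B B_subset_A A_subset_Z by (intro Z_sum Z_of_int) auto
    have w2: "(\<Sum>s\<in>B. of_int (?y s) *s s) = (w + w) + of_int (?y e) *s e"
    proof -
      have "(\<Sum>s\<in>B. of_int (?y s) *s s) = (\<Sum>s\<in>B. (of_int (if s = e then 0 else ?y s div 2) *s s
          + of_int (if s = e then 0 else ?y s div 2) *s s) + (if s = e then of_int (?y e) *s e else 0))"
      proof (rule sum.cong[OF refl])
        fix s assume "s \<in> B"
        then show "of_int (?y s) *s s = (of_int (if s = e then 0 else ?y s div 2) *s s
          + of_int (if s = e then 0 else ?y s div 2) *s s) + (if s = e then of_int (?y e) *s e else 0)"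
        proof (cases "s = e")
          case False
          then have "?y s = ?y s div 2 + ?y s div 2" using even[OF \<open>s \<in> B\<close> False] by auto
          then have "of_int (?y s) *s s = of_int (?y s div 2) *s s + of_int (?y s div 2) *s s"
            by (metis of_int_add scale_left_distrib)
          then show ?thesis using False by simp
        qed simp
      qed
      then show ?thesis unfolding w_def using eB finite_B by (simp add: sum.distrib)
    qed
    have nd: "\<not> dep_mod_e {b, b'}"
    proof
      assume "dep_mod_e {b, b'}"
      then obtain c \<phi> where c: "\<exists>i\<in>{b, b'}. c i \<noteq> 0" "(\<Sum>i\<in>{b, b'}. c i *s l i) = \<phi> *s e"
        unfolding dep_mod_e_def by blast
      have c2: "c b *s l b + c b' *s l b' = \<phi> *s e" using c(2) ne by simp
      have "(c b * of_int \<epsilon> + c b') *s l b' = \<phi> *s e - c b *s (\<Sum>s\<in>B. of_int (?y s) *s s)"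
        using c2 unfolding eq by (simp add: algebra_simps)
      also have "\<dots> \<in> span B" using eB by (intro span_diff span_scale span_sum span_base)
      finally have in_B: "(c b * of_int \<epsilon> + c b') *s l b' \<in> span B" .
      have "c b * of_int \<epsilon> + c b' = 0"
      proof (rule ccontr)
        assume nz: "c b * of_int \<epsilon> + c b' \<noteq> 0"
        have "(1 / (c b * of_int \<epsilon> + c b')) *s ((c b * of_int \<epsilon> + c b') *s l b') \<in> span B"
          using in_B by (rule span_scale)
        then show False using b'(2) nz by simp
      qed
      then have cb: "c b' = - (c b * of_int \<epsilon>)" by simp
      have cbn: "c b \<noteq> 0" using c(1) cb by auto
      have "c b *s (l b - of_int \<epsilon> *s l b') = \<phi> *s e"
        using c2 unfolding cb by (simp add: algebra_simps scale_minus_left)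
      then have "(1 / c b) *s (c b *s (l b - of_int \<epsilon> *s l b')) = (1 / c b) *s (\<phi> *s e)" by (rule arg_cong)
      then have "l b - of_int \<epsilon> *s l b' = (\<phi> / c b) *s e" using cbn by simp
      moreover have "(\<phi> / c b) *s e \<in> span {e}" by (intro span_scale span_base) simp
      ultimately show False
        using lifts_differ[OF b(1) b'(1) ne] \<epsilon> by (auto simp: scale_minus_left)
    qed
    have weq: "of_int 1 *s l b + of_int (- \<epsilon>) *s l b' = (w + w) + of_int (?y e) *s e"
      using eq unfolding w2 by (simp add: algebra_simps scale_minus_left)
    have "\<bar>- \<epsilon>\<bar> = 1" using \<epsilon> by auto
    then have "card B = 2"
      using half_sum_of_pair[OF b b'(1) nd ne _ _ wZ weq] by simp
    then show False using B3 by simp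
  qed
qed

text \<open>
The parities of the three differences are related by a sum, but three singletons never satisfy
that one is the symmetric difference of the other two.
\<close>

lemma class_size:
  assumes B3: "card B \<ge> 3"
    and b: "b \<in> M" "l b \<notin> span B" and b': "b' \<in> M" "l b' \<notin> span B" and b'': "b'' \<in> M" "l b'' \<notin> span B"
    and cl: "cls b = cls b'" "cls b' = cls b''" and ne: "b \<noteq> b'" "b' \<noteq> b''" "b \<noteq> b''"
  shows False
proof -
  let ?J = "\<lambda>b b'. {s \<in> B - {e}. odd (diff_coord b b' s)}"
  have one: "\<exists>s. ?J b b' = {s}" if "b \<in> M" "l b \<notin> span B" "b' \<in> M" "l b' \<notin> span B" "cls b = cls b'" "b \<noteq> b'" for b b'
  proof -
    have fin: "finite (?J b b')" using finite_B by simp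
    have "card (?J b b') = 1"
      using odd_coords_same_class(1)[OF that] odd_coords_same_class(2)[OF that B3] fin
        card_0_eq[OF fin] by linarith
    then show ?thesis by (auto simp: card_1_singleton_iff)
  qed
  have sq: "sg b' * sg b' = 1" using cls_props(4)[OF b'] by (auto simp: abs_if split: if_splits)
  have odd_sg: "odd (sg b * sg b')" using cls_props(4)[OF b] cls_props(4)[OF b'] by (auto simp: abs_if split: if_splits)
  have add: "diff_coord b b'' s = diff_coord b b' s + sg b * sg b' * diff_coord b' b'' s" for s
  proof -
    have sqr: "real_of_int (sg b') * real_of_int (sg b') = 1" using sq by (simp flip: of_int_mult)
    have "real_of_int (diff_coord b b' s + sg b * sg b' * diff_coord b' b'' s) =
        coord (l b) s - of_int (sg b) * of_int (sg b') * coord (l b') s + of_int (sg b) * of_int (sg b') * coord (l b') s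
        - of_int (sg b) * (of_int (sg b') * of_int (sg b')) * of_int (sg b'') * coord (l b'') s"
      unfolding of_int_add of_int_mult diff_coord[OF b b'] diff_coord[OF b' b''] by (simp add: algebra_simps)
    also have "\<dots> = real_of_int (diff_coord b b'' s)"
      unfolding sqr using diff_coord[OF b b''] by simp
    finally show ?thesis by linarith
  qed
  obtain s1 s2 s3 where J: "?J b b' = {s1}" "?J b' b'' = {s2}" "?J b b'' = {s3}"
    using one[OF b b' cl(1) ne(1)] one[OF b' b'' cl(2) ne(2)] one[OF b b'' _ ne(3)] cl by auto
  have "s \<in> ?J b b'' \<longleftrightarrow> (s \<in> ?J b b') \<noteq> (s \<in> ?J b' b'')" for s
    using odd_sg by (auto simp: add)
  then have iff: "s \<in> {s3} \<longleftrightarrow> (s \<in> {s1}) \<noteq> (s \<in> {s2})" for s unfolding J .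
  from iff[of s1] iff[of s2] iff[of s3] show False by (cases "s1 = s2") auto
qed

end

section \<open>Circuits meeting a quadruple\<close>

text \<open>
The circuits for \<open>k = 4\<close>, with \<open>Q = C\<^sup>*\<close>. Outside \<open>Q\<close>, a circuit other than \<open>Q\<close> is a class
of two elements, which is why circuits that meet outside \<open>Q\<close> agree there.
\<close>

locale circuits_meeting_quadruple =
  fixes F :: "'a set \<Rightarrow> bool" and Q :: "'a set"
  assumes finite_circuit: "F C \<Longrightarrow> finite C"
    and elim: "F C \<Longrightarrow> F C' \<Longrightarrow> C \<noteq> C' \<Longrightarrow> x \<in> C \<Longrightarrow> x \<in> C' \<Longrightarrow> \<exists>D. F D \<and> D \<subseteq> C \<union> C' - {x}"
    and card_Q: "card Q = 4"
    and Q_circuit: "Q \<subseteq> C \<union> C' \<Longrightarrow> F C \<Longrightarrow> F C' \<Longrightarrow> F Q"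
    and mixed: "F C \<Longrightarrow> C \<noteq> Q \<Longrightarrow> card (C \<inter> Q) = 2 \<and> card (C - Q) = 2"
    and class_pair: "F C \<Longrightarrow> F C' \<Longrightarrow> b \<in> C - Q \<Longrightarrow> b \<in> C' - Q \<Longrightarrow> C - Q = C' - Q"
begin

lemma ex_mem_if_card_2: "card S = 2 \<Longrightarrow> \<exists>x. x \<in> S"
  by (cases "S = {}") auto

lemma finite_Q: "finite Q"
  using card_Q card.infinite by fastforce

text \<open>
If the circuits also met inside \<open>Q\<close>, then eliminating a vector outside \<open>Q\<close> would give a circuit with at
most three vectors in \<open>Q\<close> and at most one outside. So they meet \<open>Q\<close> in complementary pairs.
\<close>

lemma same_pair:
  assumes C: "F C" "C \<noteq> Q" "F C'" "C' \<noteq> Q" "C - Q = C' - Q" "C \<noteq> C'"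
  shows "C' = sym_diff C Q"
proof -
  have c: "card (C \<inter> Q) = 2" "card (C' \<inter> Q) = 2" "card (C - Q) = 2"
    using mixed[OF C(1,2)] mixed[OF C(3,4)] by auto
  have disj: "C \<inter> C' \<inter> Q = {}"
  proof (rule ccontr)
    assume ne: "C \<inter> C' \<inter> Q \<noteq> {}"
    obtain b where b: "b \<in> C - Q" using ex_mem_if_card_2[OF c(3)] by blast
    obtain D where D: "F D" "D \<subseteq> C \<union> C' - {b}" using elim[OF C(1,3,6), of b] b C(5) by blast
    have "card ((C \<inter> Q) \<union> (C' \<inter> Q)) + card ((C \<inter> Q) \<inter> (C' \<inter> Q)) = 4"
      using card_Un_Int[of "C \<inter> Q" "C' \<inter> Q"] c finite_Q by simp
    moreover have "card ((C \<inter> Q) \<inter> (C' \<inter> Q)) > 0"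
      using ne finite_Q by (auto simp: card_gt_0_iff)
    ultimately have "card ((C \<inter> Q) \<union> (C' \<inter> Q)) < card Q" using card_Q by linarith
    moreover have "D = Q \<Longrightarrow> Q \<subseteq> (C \<inter> Q) \<union> (C' \<inter> Q)" using D(2) by blast
    ultimately have "D \<noteq> Q"
      using card_mono[of "(C \<inter> Q) \<union> (C' \<inter> Q)" Q] finite_Q by fastforce
    then have "card (D - Q) = 2" using mixed[OF D(1)] by blast
    moreover have "D - Q \<subseteq> C - Q - {b}" using D(2) C(5) by blast
    moreover have "card (C - Q - {b}) = 1" using b c(3) by simp
    moreover have "finite (C - Q - {b})" using finite_circuit[OF C(1)] by simp
    ultimately show False using card_mono[of "C - Q - {b}" "D - Q"] by simp
  qed
  have "card ((C \<inter> Q) \<union> (C' \<inter> Q)) = card Q"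
    using card_Un_disjoint[of "C \<inter> Q" "C' \<inter> Q"] disj c finite_Q card_Q by auto
  then have "(C \<inter> Q) \<union> (C' \<inter> Q) = Q"
    using card_subset_eq[OF finite_Q, of "(C \<inter> Q) \<union> (C' \<inter> Q)"] by blast
  then show ?thesis using disj C(5) by blast
qed

text \<open>
Otherwise eliminate the common vector \<open>x\<close>. The new circuit has the class of one of the two circuits, and
meets \<open>Q\<close> in the complement of that circuit by \<open>same_pair\<close>. But of this complement at most one
vector is available.
\<close>

lemma pairs_equal_if_meeting:
  assumes C: "F C" "C \<noteq> Q" "F C'" "C' \<noteq> Q" and x: "x \<in> C \<inter> C' \<inter> Q"
  shows "C - Q = C' - Q"
proof (rule ccontr)
  assume ne: "C - Q \<noteq> C' - Q"
  have c: "card (C \<inter> Q) = 2" "card (C' \<inter> Q) = 2"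
    using mixed[OF C(1,2)] mixed[OF C(3,4)] by auto
  have neC: "C \<noteq> C'" using ne by blast
  obtain D where D: "F D" "D \<subseteq> C \<union> C' - {x}" using elim[OF C(1,3) neC, of x] x by blast
  have DQ: "D \<noteq> Q" using D(2) x by blast
  have d: "card (D \<inter> Q) = 2" "card (D - Q) = 2" using mixed[OF D(1) DQ] by auto
  obtain b where b: "b \<in> D - Q" using ex_mem_if_card_2[OF d(2)] by blast
  have key: False if E: "F E" "E \<noteq> Q" "F E'" "card (E' \<inter> Q) = 2" "x \<in> E \<inter> E' \<inter> Q" "D \<subseteq> E \<union> E' - {x}" "b \<in> E - Q" for E E'
  proof -
    have "D - Q = E - Q" by (rule class_pair[OF D(1) E(1) b E(7)])
    moreover have "D \<noteq> E" using E(5,6) by blast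
    ultimately have "D = sym_diff E Q" using same_pair[OF E(1,2) D(1) DQ] by simp
    then have "D \<inter> Q \<subseteq> E' \<inter> Q - {x}" using E(6) by blast
    moreover have "card (E' \<inter> Q - {x}) = 1" using E(4,5) by simp
    ultimately show False
      using d(1) card_mono[of "E' \<inter> Q - {x}" "D \<inter> Q"] finite_Q by simp
  qed
  from b D(2) have "b \<in> C - Q \<or> b \<in> C' - Q" by blast
  then show False
    using key[OF C(1,2,3) c(2) x D(2)] key[OF C(3,4,1) c(1)] x D(2) by blast
qed

text \<open>
Circuits meeting \<open>Q\<close> in complementary pairs cover \<open>Q\<close>, so \<open>Q\<close> is a circuit. Eliminating between \<open>C\<close> and
\<open>Q\<close> gives the circuit \<open>sym_diff C Q\<close>, which has the class of \<open>C\<close> and meets \<open>C'\<close> in \<open>Q\<close>.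
\<close>

lemma pairs_equal:
  assumes C: "F C" "C \<noteq> Q" "F C'" "C' \<noteq> Q"
  shows "C - Q = C' - Q"
proof (cases "C \<inter> C' \<inter> Q = {}")
  case False
  then show ?thesis using pairs_equal_if_meeting[OF C] by blast
next
  case True
  have c: "card (C \<inter> Q) = 2" "card (C' \<inter> Q) = 2"
    using mixed[OF C(1,2)] mixed[OF C(3,4)] by auto
  have "card ((C \<inter> Q) \<union> (C' \<inter> Q)) = card Q"
    using card_Un_disjoint[of "C \<inter> Q" "C' \<inter> Q"] True c finite_Q card_Q by auto
  then have "(C \<inter> Q) \<union> (C' \<inter> Q) = Q"
    using card_subset_eq[OF finite_Q, of "(C \<inter> Q) \<union> (C' \<inter> Q)"] by blast
  then have FQ: "F Q" using Q_circuit[OF _ C(1,3)] by blast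
  obtain x where x: "x \<in> C \<inter> Q" using ex_mem_if_card_2[OF c(1)] by blast
  obtain D where D: "F D" "D \<subseteq> C \<union> Q - {x}" using elim[OF C(1) FQ C(2), of x] x by blast
  have DQ: "D \<noteq> Q" using D(2) x by blast
  have d: "card (D \<inter> Q) = 2" "card (D - Q) = 2" using mixed[OF D(1) DQ] by auto
  obtain b where b: "b \<in> D - Q" using ex_mem_if_card_2[OF d(2)] by blast
  have eq: "D - Q = C - Q" using class_pair[OF D(1) C(1), of b] b D(2) by blast
  moreover have "D \<noteq> C" using D(2) x by blast
  ultimately have "D = sym_diff C Q" using same_pair[OF C(1,2) D(1) DQ] by simp
  moreover obtain y where "y \<in> C' \<inter> Q" using ex_mem_if_card_2[OF c(2)] by blast
  ultimately have "y \<in> D \<inter> C' \<inter> Q" using True by blast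
  then have "D - Q = C' - Q" by (rule pairs_equal_if_meeting[OF D(1) DQ C(3,4)])
  then show ?thesis using eq by simp
qed

theorem circuits_cases:
  assumes C: "F C" "C \<noteq> Q"
  shows "F D \<Longrightarrow> D = C \<or> D = Q \<or> D = sym_diff C Q"
  using same_pair[OF C] pairs_equal[OF C] by blast

theorem three_circuits:
  assumes C: "F C" "C \<noteq> Q" and C': "F C'" "C' \<noteq> C"
  shows "{D. F D} = {C, Q, sym_diff C Q}" "card {D. F D} = 3"
proof -
  have FQ: "F Q"
  proof (cases "C' = Q")
    case False
    then have "C' = sym_diff C Q" using circuits_cases[OF C C'(1)] C'(2) by blast
    then show ?thesis using Q_circuit[OF _ C(1) C'(1)] by blast
  qed (use C' in simp)
  have c: "card (C \<inter> Q) = 2" using mixed[OF C] by blast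
  obtain x where x: "x \<in> C \<inter> Q" using ex_mem_if_card_2[OF c] by blast
  obtain D where D: "F D" "D \<subseteq> C \<union> Q - {x}" using elim[OF C(1) FQ C(2), of x] x by blast
  then have "D = sym_diff C Q" using circuits_cases[OF C D(1)] x by blast
  then have FS: "F (sym_diff C Q)" using D(1) by simp
  show eq: "{D. F D} = {C, Q, sym_diff C Q}"
    using circuits_cases[OF C] C(1) FQ FS by blast
  have "C \<noteq> {}" "Q \<noteq> {}" using c card_Q by auto
  then have "C \<noteq> sym_diff C Q" "Q \<noteq> sym_diff C Q" by blast+
  then show "card {D. F D} = 3" unfolding eq using C(2) by simp
qed

text \<open>
For a circuit \<open>C \<noteq> Q\<close>, a vector in \<open>C \<inter> Q\<close> hits \<open>C\<close> and \<open>Q\<close>, and one in \<open>C - Q\<close> hits the third.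
\<close>

theorem hitting_pair:
  assumes "F C0"
  obtains X where "finite X" "card X \<le> 2" "\<And>D. F D \<Longrightarrow> D \<inter> X \<noteq> {}"
proof (cases "\<exists>C. F C \<and> C \<noteq> Q")
  case True
  then obtain C where C: "F C" "C \<noteq> Q" by blast
  have c: "card (C \<inter> Q) = 2" "card (C - Q) = 2" using mixed[OF C] by auto
  obtain x b where "x \<in> C \<inter> Q" "b \<in> C - Q"
    using ex_mem_if_card_2[OF c(1)] ex_mem_if_card_2[OF c(2)] by blast
  then show thesis using that[of "{x, b}"] circuits_cases[OF C] card_insert_le_m1[of 2 "{b}" x] by auto
next
  case False
  obtain x where "x \<in> Q" using card_Q by fastforce
  then show thesis using that[of "{x}"] False by auto
qed

end

section \<open>Determinants and coordinates\<close>

text \<open>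
Up to the factor \<open>det P\<close>, the coordinates of an integral vector are determinants of integral matrices.
\<close>

lemma real_cramer:
  fixes P :: "int mat"
  assumes P: "P \<in> carrier_mat m m" and z: "z \<in> carrier_vec m" and x: "x \<in> carrier_vec m"
    and eq: "map_mat real_of_int P *\<^sub>v x = map_vec real_of_int z" and k: "k < m"
  shows "of_int (det (replace_col P z k)) = x $ k * of_int (det P)"
proof -
  have "map_mat real_of_int (replace_col P z k) = replace_col (map_mat real_of_int P) (map_vec real_of_int z) k"
    using P z by (intro eq_matI) (auto simp: replace_col_def)
  then have "of_int (det (replace_col P z k)) = det (replace_col (map_mat real_of_int P) (map_vec real_of_int z) k)"
    by (metis of_int_hom.hom_det)
  also have "\<dots> = x $ k * det (map_mat real_of_int P)"
    unfolding eq[symmetric] by (rule cramer_lemma_mat) (use P x k in auto)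
  finally show ?thesis by simp
qed

text \<open>
Replacing column \<open>j\<close> of \<open>P\<close> by \<open>z\<close> and then column \<open>k\<close> by \<open>z'\<close>, where \<open>k \<noteq> j\<close>, gives an integral
determinant. Twice it is, up to sign, \<open>Y'\<^sub>k Y\<^sub>j - Y'\<^sub>j Y\<^sub>k\<close>, where \<open>Y\<close> and \<open>Y'\<close> are the numerators
of the coordinates. So this expression is even, also for \<open>k = j\<close>. Since \<open>Y\<^sub>j\<close> is odd and \<open>Y'\<close> is not
even throughout, \<open>Y\<close> and \<open>Y'\<close> are congruent modulo 2.
\<close>

lemma det_2_coords_congruent:
  fixes P :: "int mat"
  assumes P: "P \<in> carrier_mat m m" and d: "\<bar>det P\<bar> = 2"
    and z: "z \<in> carrier_vec m" "z' \<in> carrier_vec m" and y: "y \<in> carrier_vec m" "y' \<in> carrier_vec m"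
    and eq: "map_mat real_of_int P *\<^sub>v y = map_vec real_of_int z"
      "map_mat real_of_int P *\<^sub>v y' = map_vec real_of_int z'"
    and j: "j < m" "y $ j \<notin> \<int>" and j': "j' < m" "y' $ j' \<notin> \<int>" and i: "i < m"
  shows "y $ i - y' $ i \<in> \<int>"
proof -
  let ?R = "map_mat real_of_int"
  let ?Y = "\<lambda>k. det (replace_col P z k)" and ?Y' = "\<lambda>k. det (replace_col P z' k)"
  note cr = real_cramer[OF P z(1) y(1) eq(1)] real_cramer[OF P z(2) y(2) eq(2)]
  have d2: "det P = 2 \<or> det P = -2" using d by linarith
  have half: "even (?Y k) \<longleftrightarrow> y $ k \<in> \<int>" "even (?Y' k) \<longleftrightarrow> y' $ k \<in> \<int>" if "k < m" for k
  proof -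
    have *: "even n \<longleftrightarrow> x \<in> \<int>" if "real_of_int n = x * of_int (det P)" for n x
    proof
      assume "even n"
      then obtain q where "n = 2 * q" by (rule evenE)
      then have "x = of_int q \<or> x = of_int (- q)" using d2 that by auto
      then show "x \<in> \<int>" by (metis Ints_of_int)
    next
      assume "x \<in> \<int>"
      then obtain q where "x = of_int q" by (auto elim: Ints_cases)
      then have "n = q * det P" using that by (metis of_int_eq_iff of_int_mult)
      then show "even n" using d2 by auto
    qed
    show "even (?Y k) \<longleftrightarrow> y $ k \<in> \<int>" "even (?Y' k) \<longleftrightarrow> y' $ k \<in> \<int>"
      using *[OF cr(1)[OF that]] *[OF cr(2)[OF that]] by auto
  qed
  have yj: "y $ j \<noteq> 0" using j(2) by auto
  let ?T = "replace_col P z j"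
  have T: "?T \<in> carrier_mat m m" using P by (simp add: replace_col_def)
  define c where "c = y' $ j / y $ j"
  \<comment> \<open>the coordinates of \<open>z'\<close> with respect to the columns of \<open>?T\<close>\<close>
  define w where "w = vec m (\<lambda>k. if k = j then c else y' $ k - c * y $ k)"
  have w: "w \<in> carrier_vec m" by (simp add: w_def)
  have entry: "map_vec real_of_int z $ r = (\<Sum>k = 0..<m. real_of_int (P $$ (r, k)) * y $ k)" if "r < m" for r
    using that P y(1) eq(1)[symmetric] by (simp add: scalar_prod_def)
  have entry': "map_vec real_of_int z' $ r = (\<Sum>k = 0..<m. real_of_int (P $$ (r, k)) * y' $ k)" if "r < m" for r
    using that P y(2) eq(2)[symmetric] by (simp add: scalar_prod_def)
  have Tw: "?R ?T *\<^sub>v w = map_vec real_of_int z'"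
  proof (rule eq_vecI)
    fix r assume "r < dim_vec (map_vec real_of_int z')"
    then have r: "r < m" using z(2) by simp
    have "(?R ?T *\<^sub>v w) $ r = (\<Sum>k = 0..<m. real_of_int (?T $$ (r, k)) * w $ k)"
      using r T w by (simp add: scalar_prod_def)
    also have "\<dots> = (\<Sum>k = 0..<m. (if k = j then c * real_of_int (z $ r) else 0)
        + (real_of_int (P $$ (r, k)) * y' $ k - c * (real_of_int (P $$ (r, k)) * y $ k)))"
    proof (rule sum.cong[OF refl])
      fix k assume "k \<in> {0..<m}"
      then show "real_of_int (?T $$ (r, k)) * w $ k = (if k = j then c * real_of_int (z $ r) else 0)
        + (real_of_int (P $$ (r, k)) * y' $ k - c * (real_of_int (P $$ (r, k)) * y $ k))"
        using r P yj by (auto simp: replace_col_def w_def c_def field_simps)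
    qed
    also have "\<dots> = c * real_of_int (z $ r) + ((\<Sum>k = 0..<m. real_of_int (P $$ (r, k)) * y' $ k)
        - c * (\<Sum>k = 0..<m. real_of_int (P $$ (r, k)) * y $ k))"
      using j(1) by (simp add: sum.distrib sum_subtractf sum_distrib_left)
    also have "\<dots> = map_vec real_of_int z' $ r"
      using entry[OF r] entry'[OF r] r z by simp
    finally show "(?R ?T *\<^sub>v w) $ r = map_vec real_of_int z' $ r" .
  qed (use T z in simp)
  have cong: "even (?Y' k * ?Y j - ?Y' j * ?Y k)" if k: "k < m" for k
  proof (cases "k = j")
    case False
    have "of_int (det (replace_col ?T z' k)) = w $ k * of_int (?Y j)"
      by (rule real_cramer[OF T z(2) w Tw k])
    also have "w $ k = y' $ k - c * y $ k" using k False by (simp add: w_def)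
    finally have "of_int (det (replace_col ?T z' k)) = (y' $ k - c * y $ k) * of_int (?Y j)" .
    then have "of_int (det (replace_col ?T z' k)) * of_int (det P) =
        (y' $ k - c * y $ k) * of_int (?Y j) * of_int (det P)"
      by (rule arg_cong)
    also have "\<dots> = (y' $ k * of_int (det P)) * of_int (?Y j) - c * (y $ k * of_int (det P)) * of_int (?Y j)"
      by (simp add: algebra_simps)
    also have "\<dots> = of_int (?Y' k) * of_int (?Y j) - c * of_int (?Y k) * of_int (?Y j)"
      using cr(1)[OF k] cr(2)[OF k] by simp
    also have "c * of_int (?Y k) * of_int (?Y j) = of_int (?Y k) * (c * of_int (?Y j))"
      by (simp only: ac_simps)
    also have "c * of_int (?Y j) = of_int (?Y' j)"
      unfolding cr(1)[OF j(1)] cr(2)[OF j(1)] using yj by (simp add: c_def)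
    finally have "real_of_int (det (replace_col ?T z' k) * det P) = of_int (?Y' k * ?Y j - ?Y k * ?Y' j)"
      by simp
    then have "det (replace_col ?T z' k) * det P = ?Y' k * ?Y j - ?Y k * ?Y' j"
      by (simp only: of_int_eq_iff)
    moreover have "even (det (replace_col ?T z' k) * det P)" using d2 by auto
    ultimately show ?thesis by (simp add: mult.commute)
  qed simp
  have oddj: "odd (?Y j)" using half(1)[OF j(1)] j(2) by simp
  have "odd (?Y' j')" using half(2)[OF j'(1)] j'(2) by simp
  then have oddj': "odd (?Y' j)" using cong[OF j'(1)] oddj by auto
  have "even (?Y i - ?Y' i)" using cong[OF i] oddj oddj' by auto
  then obtain q where "?Y i - ?Y' i = 2 * q" by (rule evenE)
  then have "real_of_int (?Y i) - of_int (?Y' i) = 2 * of_int q"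
    by (metis of_int_diff of_int_mult of_int_numeral)
  then have "(y $ i - y' $ i) * of_int (det P) = 2 * of_int q"
    using cr(1)[OF i] cr(2)[OF i] by (simp add: left_diff_distrib)
  then have "y $ i - y' $ i = of_int q \<or> y $ i - y' $ i = of_int (- q)" using d2 by auto
  then show ?thesis by (metis Ints_of_int)
qed

text \<open>
The minors in the definition of bimodularity take the columns in increasing order; an arbitrary selection
differs by a permutation, or has a repeated column.
\<close>

lemma bimodular_minor:
  assumes A: "bimodular A" "dim_row A = m" and f: "\<And>j. j < m \<Longrightarrow> f j < dim_col A"
  shows "\<bar>det (mat m m (\<lambda>(i, j). A $$ (i, f j)))\<bar> \<le> 2"
proof (cases "inj_on f {0..<m}")
  case False
  then obtain i j where ij: "i < m" "j < m" "i \<noteq> j" "f i = f j" by (auto simp: inj_on_def)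
  have "det (mat m m (\<lambda>(i, j). A $$ (i, f j))) = 0"
    by (rule det_identical_columns[of _ m i j]) (use ij in \<open>auto intro!: eq_vecI\<close>)
  then show ?thesis by simp
next
  case True
  define J where "J = f ` {0..<m}"
  have J: "J \<subseteq> {..<dim_col A}" "card J = m" "finite J"
    using f True by (auto simp: J_def card_image)
  have eqJ: "{j. j < dim_col A \<and> j \<in> J} = J" using J(1) by auto
  define g where "g = inv_into {0..<m} f"
  have pickJ: "pick J j \<in> J" if "j < m" for j
    using pick_in_set_le[of j J] that J(2) by simp
  have pick_less: "pick J j < pick J j'" if "j < j'" "j' < m" for j j'
    using pick_mono_le[of j' J j] that J(2) by simp
  have pick_inj: "j = j'" if "j < m" "j' < m" "pick J j = pick J j'" for j j'
    using pick_less[of j j'] pick_less[of j' j] that by (cases j j' rule: linorder_cases) auto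
  define p where "p j = (if j < m then g (pick J j) else j)" for j
  have fp: "f (p j) = pick J j" "p j < m" if "j < m" for j
    using f_inv_into_f[of "pick J j" f "{0..<m}"] inv_into_into[of "pick J j" f "{0..<m}"] pickJ[OF that] that
    by (auto simp: p_def g_def J_def)
  have "inj_on p {0..<m}"
  proof (rule inj_onI)
    fix i j assume "i \<in> {0..<m}" "j \<in> {0..<m}" "p i = p j"
    then show "i = j" using fp(1)[of i] fp(1)[of j] pick_inj[of i j] by simp
  qed
  then have perm: "p permutes {0..<m}"
    by (rule inj_imp_permutes) (use fp(2) in \<open>auto simp: p_def\<close>)
  let ?P = "mat m m (\<lambda>(i, j). A $$ (i, f j))"
  have "det (mat m m (\<lambda>(i, j). transpose_mat ?P $$ (p i, j))) = signof p * det (transpose_mat ?P)"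
    by (rule det_permute_rows[OF _ perm]) simp
  moreover have "det (transpose_mat ?P) = det ?P" by (rule det_transpose[of _ m]) simp
  moreover have "mat m m (\<lambda>(i, j). transpose_mat ?P $$ (p i, j)) =
      transpose_mat (mat m m (\<lambda>(i, j). ?P $$ (i, p j)))"
    using fp(2) by (intro eq_matI) auto
  moreover have "det (transpose_mat (mat m m (\<lambda>(i, j). ?P $$ (i, p j)))) = det (mat m m (\<lambda>(i, j). ?P $$ (i, p j)))"
    by (rule det_transpose[of _ m]) simp
  ultimately have "det (mat m m (\<lambda>(i, j). ?P $$ (i, p j))) = signof p * det ?P" by simp
  moreover have "mat m m (\<lambda>(i, j). ?P $$ (i, p j)) = submatrix A UNIV J"
    unfolding submatrix_def eqJ using A(2) J(2) fp by (intro eq_matI) (auto simp: pick_UNIV)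
  moreover have "\<bar>det (submatrix A UNIV J)\<bar> \<le> 2"
    using A J by (simp add: bimodular_def)
  ultimately show ?thesis by (auto simp: sign_def abs_mult split: if_splits)
qed

section \<open>Linear algebra of integral vectors\<close>

lemma fun_sum_apply: "(\<Sum>i\<in>I. f i) x = (\<Sum>i\<in>I. f i x)"
  by (induction I rule: infinite_finite_induct) auto

text \<open>
Integral vectors of all dimensions embed into the real functions on \<open>\<nat>\<close>, where linear algebra without
carrier sets is available; dimension \<open>m\<close> corresponds to functions vanishing from \<open>m\<close> on.
\<close>

interpretation fs: vector_space "\<lambda>(c::real) (f::nat \<Rightarrow> real) i. c * f i"
  by unfold_locales (auto simp: fun_eq_iff algebra_simps)

lemma inj_on_factor: "inj_on f X \<Longrightarrow> \<exists>g. \<forall>x\<in>X. g (f x) = c x"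
  by (rule exI[of _ "\<lambda>y. c (inv_into X f y)"]) (simp add: inv_into_f_f)

lemma lin_dep_iff:
  assumes X: "X \<subseteq> carrier_vec n" "finite X"
  shows "LinearCombinations.module.lin_dep class_ring (module_vec TYPE(real) n) X \<longleftrightarrow>
    (\<exists>c. (\<exists>x\<in>X. c x \<noteq> 0) \<and> (\<forall>i<n. (\<Sum>x\<in>X. c x * x $ i) = 0))"
proof -
  interpret vec_space "TYPE(real)" n .
  show ?thesis
  proof
    assume "lin_dep X"
    then obtain Y a v where Y: "finite Y" "Y \<subseteq> X" "lincomb a Y = 0\<^sub>v n" "v \<in> Y" "a v \<noteq> 0"
      unfolding lin_dep_def by auto
    let ?c = "\<lambda>x. if x \<in> Y then a x else 0"
    have "(\<Sum>x\<in>X. ?c x * x $ i) = 0" if "i < n" for i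
    proof -
      have "(\<Sum>x\<in>X. ?c x * x $ i) = (\<Sum>x\<in>Y. a x * x $ i)"
        by (rule sum.mono_neutral_cong_right) (use X Y in auto)
      also have "\<dots> = lincomb a Y $ i"
        by (rule lincomb_index[symmetric]) (use that X Y in auto)
      finally show ?thesis using Y that by simp
    qed
    then show "\<exists>c. (\<exists>x\<in>X. c x \<noteq> 0) \<and> (\<forall>i<n. (\<Sum>x\<in>X. c x * x $ i) = 0)"
      using Y by (intro exI[of _ ?c]) auto
  next
    assume "\<exists>c. (\<exists>x\<in>X. c x \<noteq> 0) \<and> (\<forall>i<n. (\<Sum>x\<in>X. c x * x $ i) = 0)"
    then obtain c x where c: "x \<in> X" "c x \<noteq> 0" "\<forall>i<n. (\<Sum>x\<in>X. c x * x $ i) = 0" by blast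
    have "lincomb c X = 0\<^sub>v n"
    proof (rule eq_vecI)
      show "dim_vec (lincomb c X) = dim_vec (0\<^sub>v n :: real vec)"
        using lincomb_dim[OF X(2,1)] by simp
    qed (use c(3) X in \<open>simp add: lincomb_index\<close>)
    then show "lin_dep X" unfolding lin_dep_def using c X by (auto intro!: exI[of _ X] exI[of _ c] exI[of _ x])
  qed
qed

lemma in_span_if:
  fixes v :: "int vec"
  assumes X: "X \<subseteq> carrier_vec n" "finite X" and v: "v \<in> carrier_vec n"
    and eq: "\<And>i. i < n \<Longrightarrow> real_of_int (v $ i) = (\<Sum>x\<in>X. c x * real_of_int (x $ i))"
  shows "in_span n v X"
proof -
  interpret vec_space "TYPE(real)" n .
  have R: "real_vecs X \<subseteq> carrier_vec n" "finite (real_vecs X)" using X by (auto simp: real_vecs_def)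
  have inj: "inj_on (map_vec real_of_int) X"
    by (auto simp: inj_on_def of_int_hom.vec_hom_inj)
  let ?a = "\<lambda>y. c (inv_into X (map_vec real_of_int) y)"
  have "map_vec real_of_int v = lincomb ?a (real_vecs X)"
  proof (rule eq_vecI)
    show "dim_vec (map_vec real_of_int v) = dim_vec (lincomb ?a (real_vecs X))"
      using lincomb_dim[OF R(2,1)] v by simp
    fix i assume "i < dim_vec (lincomb ?a (real_vecs X))"
    then have i: "i < n" using lincomb_dim[OF R(2,1)] by simp
    have "lincomb ?a (real_vecs X) $ i = (\<Sum>y\<in>real_vecs X. ?a y * y $ i)"
      by (rule lincomb_index[OF i R(1)])
    also have "\<dots> = (\<Sum>x\<in>X. c x * real_of_int (x $ i))"
      unfolding real_vecs_def
      by (subst sum.reindex[OF inj]) (use X i in \<open>auto simp: inv_into_f_f[OF inj] intro!: sum.cong\<close>)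
    finally show "map_vec real_of_int v $ i = lincomb ?a (real_vecs X) $ i"
      using eq[OF i] v i by simp
  qed
  then show ?thesis
    unfolding in_span_def span_def using R by blast
qed

lemma lin_dependent_iff:
  assumes X: "X \<subseteq> carrier_vec n" "finite X"
  shows "lin_dependent n X \<longleftrightarrow>
    (\<exists>c. (\<exists>x\<in>X. c x \<noteq> 0) \<and> (\<forall>i<n. (\<Sum>x\<in>X. c x * real_of_int (x $ i)) = 0))"
    (is "_ \<longleftrightarrow> ?R")
proof -
  have inj: "inj_on (map_vec real_of_int) X"
    by (auto simp: inj_on_def of_int_hom.vec_hom_inj)
  have R: "real_vecs X \<subseteq> carrier_vec n" "finite (real_vecs X)" using X by (auto simp: real_vecs_def)
  have sum: "(\<Sum>y\<in>real_vecs X. f y * y $ i) = (\<Sum>x\<in>X. f (map_vec real_of_int x) * real_of_int (x $ i))"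
    if "i < n" for f i
    unfolding real_vecs_def
    by (subst sum.reindex[OF inj]) (use X that in \<open>auto intro!: sum.cong\<close>)
  have "lin_dependent n X \<longleftrightarrow>
      (\<exists>f. (\<exists>y\<in>real_vecs X. f y \<noteq> 0) \<and> (\<forall>i<n. (\<Sum>y\<in>real_vecs X. f y * y $ i) = 0))"
    unfolding lin_dependent_def by (rule lin_dep_iff[OF R])
  also have "\<dots> \<longleftrightarrow> (\<exists>f. (\<exists>x\<in>X. f (map_vec real_of_int x) \<noteq> 0) \<and>
      (\<forall>i<n. (\<Sum>x\<in>X. f (map_vec real_of_int x) * real_of_int (x $ i)) = 0))"
    by (simp add: sum) (simp add: real_vecs_def)
  also have "\<dots> \<longleftrightarrow> ?R"
  proof
    assume ?R
    then obtain c where c: "\<exists>x\<in>X. c x \<noteq> 0" "\<forall>i<n. (\<Sum>x\<in>X. c x * real_of_int (x $ i)) = 0" by blast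
    obtain g where g: "\<forall>x\<in>X. g (map_vec real_of_int x) = c x"
      using inj_on_factor[OF inj] by blast
    have "(\<Sum>x\<in>X. g (map_vec real_of_int x) * real_of_int (x $ i)) = (\<Sum>x\<in>X. c x * real_of_int (x $ i))" for i
      by (rule sum.cong) (simp_all only: g)
    moreover have "\<exists>x\<in>X. g (map_vec real_of_int x) \<noteq> 0" using c(1) g by metis
    ultimately show "\<exists>f. (\<exists>x\<in>X. f (map_vec real_of_int x) \<noteq> 0) \<and>
        (\<forall>i<n. (\<Sum>x\<in>X. f (map_vec real_of_int x) * real_of_int (x $ i)) = 0)"
      using c(2) by (intro exI[of _ g]) (simp only: simp_thms)
  next
    assume "\<exists>f. (\<exists>x\<in>X. f (map_vec real_of_int x) \<noteq> 0) \<and>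
      (\<forall>i<n. (\<Sum>x\<in>X. f (map_vec real_of_int x) * real_of_int (x $ i)) = 0)"
    then obtain f where "(\<exists>x\<in>X. f (map_vec real_of_int x) \<noteq> 0) \<and>
      (\<forall>i<n. (\<Sum>x\<in>X. f (map_vec real_of_int x) * real_of_int (x $ i)) = 0)" by (rule exE)
    then show ?R by (rule exI[of _ "\<lambda>x. f (map_vec real_of_int x)"])
  qed
  finally show ?thesis .
qed

definition real_fun :: "int vec \<Rightarrow> nat \<Rightarrow> real" where
  "real_fun v = (\<lambda>i. if i < dim_vec v then real_of_int (v $ i) else 0)"

lemma real_fun_apply: "v \<in> carrier_vec m \<Longrightarrow> real_fun v i = (if i < m then real_of_int (v $ i) else 0)"
  by (auto simp: real_fun_def)

lemma inj_real_fun: "inj_on real_fun (carrier_vec m)"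
proof (rule inj_onI)
  fix u v assume uv: "u \<in> carrier_vec m" "v \<in> carrier_vec m" "real_fun u = real_fun v"
  show "u = v"
  proof (rule eq_vecI)
    fix i assume "i < dim_vec v"
    then show "u $ i = v $ i" using real_fun_apply[OF uv(1), of i] real_fun_apply[OF uv(2), of i] uv(3) carrier_vecD[OF uv(2)]
      by simp
  qed (use uv in simp)
qed

lemma real_fun_diff: "u \<in> carrier_vec m \<Longrightarrow> v \<in> carrier_vec m \<Longrightarrow> real_fun (u - v) = real_fun u - real_fun v"
  by (auto simp: real_fun_def fun_eq_iff)

lemma dependent_real_fun_iff:
  assumes X: "X \<subseteq> carrier_vec n" "finite X"
  shows "fs.dependent (real_fun ` X) \<longleftrightarrow> lin_dependent n X"
proof -
  have inj: "inj_on real_fun X" using inj_real_fun X(1) inj_on_subset by blast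
  have sum: "(\<Sum>v\<in>real_fun ` X. (\<lambda>i. u v * v i)) = 0 \<longleftrightarrow>
      (\<forall>i<n. (\<Sum>x\<in>X. u (real_fun x) * real_of_int (x $ i)) = 0)" for u
  proof -
    have *: "(\<Sum>v\<in>real_fun ` X. (\<lambda>i. u v * v i)) i = (if i < n then \<Sum>x\<in>X. u (real_fun x) * real_of_int (x $ i) else 0)" for i
      unfolding fun_sum_apply sum.reindex[OF inj] o_def
      using X(1) by (cases "i < n") (auto intro!: sum.cong sum.neutral simp: real_fun_apply subset_iff)
    show ?thesis unfolding fun_eq_iff * by auto
  qed
  have "fs.dependent (real_fun ` X) \<longleftrightarrow> (\<exists>u. (\<exists>x\<in>X. u (real_fun x) \<noteq> 0) \<and>
      (\<forall>i<n. (\<Sum>x\<in>X. u (real_fun x) * real_of_int (x $ i)) = 0))"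
    using X(2) by (subst fs.dependent_finite) (auto simp: sum)
  also have "\<dots> \<longleftrightarrow> (\<exists>c. (\<exists>x\<in>X. c x \<noteq> 0) \<and> (\<forall>i<n. (\<Sum>x\<in>X. c x * real_of_int (x $ i)) = 0))"
    (is "?L \<longleftrightarrow> ?R")
  proof
    assume ?R
    then obtain c where c: "\<exists>x\<in>X. c x \<noteq> 0" "\<forall>i<n. (\<Sum>x\<in>X. c x * real_of_int (x $ i)) = 0" by blast
    obtain g where g: "\<forall>x\<in>X. g (real_fun x) = c x"
      using inj_on_factor[OF inj] by blast
    have "(\<Sum>x\<in>X. g (real_fun x) * real_of_int (x $ i)) = (\<Sum>x\<in>X. c x * real_of_int (x $ i))" for i
      by (rule sum.cong) (simp_all only: g)
    moreover have "\<exists>x\<in>X. g (real_fun x) \<noteq> 0" using c(1) g by metis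
    ultimately show ?L using c(2) by (intro exI[of _ g]) (simp only: simp_thms)
  next
    assume ?L
    then obtain u where "(\<exists>x\<in>X. u (real_fun x) \<noteq> 0) \<and>
      (\<forall>i<n. (\<Sum>x\<in>X. u (real_fun x) * real_of_int (x $ i)) = 0)" by (rule exE)
    then show ?R by (rule exI[of _ "\<lambda>x. u (real_fun x)"])
  qed
  finally show ?thesis using lin_dependent_iff[OF X] by simp
qed

lemma span_real_fun_in_span:
  assumes X: "X \<subseteq> carrier_vec n" "finite X" and v: "v \<in> carrier_vec n"
    and sp: "real_fun v \<in> fs.span (real_fun ` X)"
  shows "in_span n v X"
proof -
  have inj: "inj_on real_fun X" using inj_real_fun X(1) inj_on_subset by blast
  obtain u where u: "real_fun v = (\<Sum>y\<in>real_fun ` X. (\<lambda>i. u y * y i))"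
    using sp X(2) by (subst (asm) fs.span_finite) auto
  have "real_of_int (v $ i) = (\<Sum>x\<in>X. u (real_fun x) * real_of_int (x $ i))" if "i < n" for i
  proof -
    have "real_of_int (v $ i) = real_fun v i" using v that by (simp add: real_fun_apply)
    also have "\<dots> = (\<Sum>x\<in>X. u (real_fun x) * real_fun x i)"
      unfolding u fun_sum_apply sum.reindex[OF inj] by simp
    also have "\<dots> = (\<Sum>x\<in>X. u (real_fun x) * real_of_int (x $ i))"
      by (rule sum.cong) (use X(1) that in \<open>auto simp: real_fun_apply subset_iff\<close>)
    finally show ?thesis .
  qed
  then show ?thesis by (rule in_span_if[OF X v])
qed

lemma support_span:
  "fs.span ((\<lambda>i j. if j = i then 1 else 0) ` {..<m}) = {f. \<forall>j\<ge>m. f j = 0}" (is "fs.span ?U = ?V")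
proof
  show "fs.span ?U \<subseteq> ?V"
    by (rule fs.span_minimal) (auto simp: fs.subspace_def)
  show "?V \<subseteq> fs.span ?U"
  proof
    fix f :: "nat \<Rightarrow> real" assume f: "f \<in> ?V"
    have "f = (\<Sum>i<m. (\<lambda>j. f i * (if j = i then 1 else 0)))"
    proof
      fix j
      have "(\<Sum>i<m. f i * (if j = i then 1 else 0)) = (\<Sum>i<m. if i = j then f i else 0)"
        by (rule sum.cong) auto
      also have "\<dots> = f j" using f by auto
      finally show "f j = (\<Sum>i<m. (\<lambda>j. f i * (if j = i then 1 else 0))) j"
        unfolding fun_sum_apply by simp
    qed
    also have "\<dots> \<in> fs.span ?U"
      by (intro fs.span_sum fs.span_scale fs.span_base) auto
    finally show "f \<in> fs.span ?U" .
  qed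
qed

lemma real_fun_support: "v \<in> carrier_vec m \<Longrightarrow> real_fun v \<in> {f. \<forall>j\<ge>m. f j = 0}"
  by (auto simp: real_fun_def)

lemma independent_support_card:
  assumes "fs.independent S" "S \<subseteq> {f. \<forall>j\<ge>m. f j = 0}"
  shows "finite S" "card S \<le> m"
proof -
  have "finite S \<and> card S \<le> card ((\<lambda>i j. if j = i then 1 else 0 :: real) ` {..<m})"
    by (rule fs.independent_span_bound) (use assms support_span in auto)
  then show "finite S" "card S \<le> m"
    using card_image_le[of "{..<m}" "\<lambda>i j. if j = i then 1 else 0 :: real"] by auto
qed

lemma independent_support_spans:
  assumes "fs.independent S" "S \<subseteq> {f. \<forall>j\<ge>m. f j = 0}" "card S = m"
  shows "{f. \<forall>j\<ge>m. f j = 0} \<subseteq> fs.span S"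
proof
  fix f :: "nat \<Rightarrow> real" assume f: "f \<in> {f. \<forall>j\<ge>m. f j = 0}"
  show "f \<in> fs.span S"
  proof (rule ccontr)
    assume nf: "f \<notin> fs.span S"
    then have "fs.independent (insert f S)" by (rule fs.independent_insertI[OF _ assms(1)])
    then have "card (insert f S) \<le> m" using independent_support_card(2) f assms(2) by blast
    moreover have "f \<notin> S" using nf fs.span_base by blast
    ultimately show False using assms independent_support_card(1)[OF assms(1,2)] by simp
  qed
qed

lemma full_rank_dim:
  assumes A: "bimodular A" "dim_row A = m"
  shows "fs.dim (real_fun ` set (cols A)) = m"
    and "real_fun ` carrier_vec m \<subseteq> fs.span (real_fun ` set (cols A))"
proof -
  interpret V: vec_space "TYPE(real)" m .
  let ?R = "map_mat real_of_int A"
  have cols: "set (cols A) \<subseteq> carrier_vec m" using A(2) cols_dim by blast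
  have R: "?R \<in> carrier_mat m (dim_col A)" using A(2) by auto
  have "V.lin_indpt {}" by (simp add: V.lin_dep_def)
  then obtain S where S: "maximal S (\<lambda>T. T \<subseteq> set (cols ?R) \<and> V.lin_indpt T)"
    using maximal_exists_superset[of "set (cols ?R)" "\<lambda>T. T \<subseteq> set (cols ?R) \<and> V.lin_indpt T" "{}"] by auto
  have Ssub: "S \<subseteq> set (cols ?R)" "V.lin_indpt S" using S by (auto simp: maximal_def)
  have "card S = m"
    using V.rank_card_indpt[OF R S] A by (simp add: bimodular_def)
  have "set (cols ?R) = map_vec real_of_int ` set (cols A)" by (auto simp: cols_def)
  then obtain X where X: "X \<subseteq> set (cols A)" "S = real_vecs X"
    using Ssub(1) by (auto simp: subset_image_iff real_vecs_def)
  have Xc: "X \<subseteq> carrier_vec m" "finite X" using X(1) cols finite_subset by auto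
  have ind: "fs.independent (real_fun ` X)"
    using dependent_real_fun_iff[OF Xc] Ssub(2) X(2) by (simp add: lin_dependent_def)
  have "inj_on (map_vec real_of_int) X" by (auto simp: inj_on_def of_int_hom.vec_hom_inj)
  then have "card X = m" using \<open>card S = m\<close> X(2) by (simp add: real_vecs_def card_image)
  then have cX: "card (real_fun ` X) = m"
    using inj_real_fun Xc(1) by (metis card_image inj_on_subset)
  have supp: "real_fun ` X \<subseteq> {f. \<forall>j\<ge>m. f j = 0}" "real_fun ` set (cols A) \<subseteq> {f. \<forall>j\<ge>m. f j = 0}"
    "real_fun ` carrier_vec m \<subseteq> {f. \<forall>j\<ge>m. f j = 0}"
    using real_fun_support Xc(1) cols by blast+
  have sp: "{f. \<forall>j\<ge>m. f j = 0} \<subseteq> fs.span (real_fun ` X)"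
    by (rule independent_support_spans[OF ind supp(1) cX])
  have XA: "real_fun ` X \<subseteq> real_fun ` set (cols A)" using X(1) by blast
  show "fs.dim (real_fun ` set (cols A)) = m"
    using fs.basis_card_eq_dim[OF XA _ ind] supp(2) sp cX by auto
  show "real_fun ` carrier_vec m \<subseteq> fs.span (real_fun ` set (cols A))"
    using supp(3) sp fs.span_mono[OF XA] by blast
qed

lemma frame_matrix:
  fixes p :: "'a \<Rightarrow> nat \<Rightarrow> real"
  assumes A: "bimodular A" "dim_row A = m" and fr: "fs.frame (real_fun ` set (cols A)) I p"
  obtains P q where "P \<in> carrier_mat m m" "bij_betw q {0..<m} I" "\<bar>det P\<bar> = 1 \<or> \<bar>det P\<bar> = 2"
    "\<And>z x. z \<in> carrier_vec m \<Longrightarrow> real_fun z = (\<Sum>i\<in>I. (\<lambda>r. x i * p i r)) \<Longrightarrow>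
      map_mat real_of_int P *\<^sub>v vec m (\<lambda>j. x (q j)) = map_vec real_of_int z"
    "\<And>a j. a \<in> set (cols A) \<Longrightarrow> j < m \<Longrightarrow> \<bar>det (replace_col P a j)\<bar> \<le> 2"
proof -
  have I: "finite I" "card I = m" "p ` I \<subseteq> real_fun ` set (cols A)"
    and indep: "\<And>x. (\<Sum>i\<in>I. (\<lambda>r. x i * p i r)) = 0 \<Longrightarrow> \<forall>i\<in>I. x i = 0"
    using fr full_rank_dim(1)[OF A] unfolding fs.frame_def by auto
  obtain q where q: "bij_betw q {0..<m} I" using ex_bij_betw_nat_finite[OF I(1)] I(2) by blast
  have "\<exists>g<dim_col A. p (q j) = real_fun (col A g)" if "j < m" for j
  proof -
    have "q j \<in> I" using q that by (auto simp: bij_betw_def)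
    then have "p (q j) \<in> real_fun ` set (cols A)" using I(3) by blast
    then show ?thesis by (auto simp: cols_def)
  qed
  then obtain f where f: "\<And>j. j < m \<Longrightarrow> f j < dim_col A \<and> p (q j) = real_fun (col A (f j))" by metis
  define P where "P = mat m m (\<lambda>(i, j). A $$ (i, f j))"
  have P: "P \<in> carrier_mat m m" by (simp add: P_def)
  have entry: "p (q j) r = (if r < m then real_of_int (P $$ (r, j)) else 0)" if "j < m" for r j
  proof -
    have "col A (f j) \<in> carrier_vec m" using A(2) by auto
    then show ?thesis using f[OF that] that A(2) by (simp add: real_fun_apply P_def)
  qed
  have sum: "(\<Sum>i\<in>I. (\<lambda>r. x i * p i r)) r = (if r < m then (\<Sum>j = 0..<m. real_of_int (P $$ (r, j)) * x (q j)) else 0)" for x r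
  proof -
    have "(\<Sum>i\<in>I. (\<lambda>r. x i * p i r)) r = (\<Sum>j = 0..<m. x (q j) * p (q j) r)"
      unfolding fun_sum_apply by (rule sum.reindex_bij_betw[OF q, symmetric])
    also have "\<dots> = (\<Sum>j = 0..<m. x (q j) * (if r < m then real_of_int (P $$ (r, j)) else 0))"
      by (rule sum.cong) (simp_all add: entry)
    finally show ?thesis by (simp add: mult.commute)
  qed
  have mult: "(map_mat real_of_int P *\<^sub>v v) $ r = (\<Sum>j = 0..<m. real_of_int (P $$ (r, j)) * v $ j)"
    if "v \<in> carrier_vec m" "r < m" for v r
    using that P by (simp add: scalar_prod_def)
  show thesis
  proof (rule that[OF P q])
    have "det P \<noteq> 0"
    proof
      assume "det P = 0"
      then have "det (map_mat real_of_int P) = 0" by (simp add: of_int_hom.hom_det)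
      then obtain v where v: "v \<in> carrier_vec m" "v \<noteq> 0\<^sub>v m" "map_mat real_of_int P *\<^sub>v v = 0\<^sub>v m"
        using det_0_iff_vec_prod_zero_field[of "map_mat real_of_int P" m] P by auto
      define x where "x i = v $ (inv_into {0..<m} q i)" for i
      have xq: "x (q j) = v $ j" if "j < m" for j
        using that q by (simp add: x_def bij_betw_def inv_into_f_f)
      have "(\<Sum>i\<in>I. (\<lambda>r. x i * p i r)) r = 0" for r
      proof (cases "r < m")
        case True
        have "(\<Sum>j = 0..<m. real_of_int (P $$ (r, j)) * x (q j)) = (\<Sum>j = 0..<m. real_of_int (P $$ (r, j)) * v $ j)"
          by (rule sum.cong) (simp_all add: xq)
        also have "\<dots> = 0" using mult[OF v(1) True] v(3) True by simp
        finally show ?thesis unfolding sum using True by simp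
      qed (simp add: sum)
      then have "(\<Sum>i\<in>I. (\<lambda>r. x i * p i r)) = 0" by (simp add: fun_eq_iff)
      then have x0: "\<forall>i\<in>I. x i = 0" by (rule indep)
      have "v $ j = 0" if "j < m" for j
      proof -
        have "q j \<in> I" using q that by (auto simp: bij_betw_def)
        then show ?thesis using xq[OF that] x0 by simp
      qed
      then have "v = 0\<^sub>v m" using v(1) by (intro eq_vecI) auto
      then show False using v(2) by simp
    qed
    moreover have "\<bar>det P\<bar> \<le> 2"
      unfolding P_def by (rule bimodular_minor[OF A]) (use f in blast)
    ultimately show "\<bar>det P\<bar> = 1 \<or> \<bar>det P\<bar> = 2" by linarith
    show "map_mat real_of_int P *\<^sub>v vec m (\<lambda>j. x (q j)) = map_vec real_of_int z"
      if z: "z \<in> carrier_vec m" "real_fun z = (\<Sum>i\<in>I. (\<lambda>r. x i * p i r))" for z x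
    proof (rule eq_vecI)
      fix r assume "r < dim_vec (map_vec real_of_int z)"
      then have r: "r < m" using z(1) by simp
      have "(map_mat real_of_int P *\<^sub>v vec m (\<lambda>j. x (q j))) $ r = (\<Sum>i\<in>I. (\<lambda>r. x i * p i r)) r"
        using r by (simp add: mult sum)
      also have "\<dots> = map_vec real_of_int z $ r"
        unfolding z(2)[symmetric] using r z(1) by (simp add: real_fun_apply)
      finally show "(map_mat real_of_int P *\<^sub>v vec m (\<lambda>j. x (q j))) $ r = map_vec real_of_int z $ r" .
    qed (use P z in simp)
    show "\<bar>det (replace_col P a j)\<bar> \<le> 2" if a: "a \<in> set (cols A)" "j < m" for a j
    proof -
      obtain g where g: "g < dim_col A" "a = col A g" using a(1) by (auto simp: cols_def)
      have "replace_col P a j = mat m m (\<lambda>(i, k). A $$ (i, (f(j := g)) k))"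
        using A(2) g by (intro eq_matI) (auto simp: replace_col_def P_def)
      moreover have "\<bar>det (mat m m (\<lambda>(i, k). A $$ (i, (f(j := g)) k)))\<bar> \<le> 2"
        by (rule bimodular_minor[OF A]) (use f g in auto)
      ultimately show ?thesis by simp
    qed
  qed
qed

text \<open>
\<open>d\<close> is the determinant of the matrix with the columns \<open>p i\<close>.
\<close>

lemma frame_denominator:
  fixes p :: "'a \<Rightarrow> nat \<Rightarrow> real"
  assumes A: "bimodular A" "dim_row A = m" and fr: "fs.frame (real_fun ` set (cols A)) I p"
  obtains d :: int where "\<bar>d\<bar> = 1 \<or> \<bar>d\<bar> = 2"
    "\<And>z y i. z \<in> real_fun ` carrier_vec m \<Longrightarrow> z = (\<Sum>i\<in>I. (\<lambda>r. y i * p i r)) \<Longrightarrow> i \<in> I \<Longrightarrow>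
      y i * of_int d \<in> \<int>"
    "\<And>a x i. a \<in> real_fun ` set (cols A) \<Longrightarrow> a = (\<Sum>i\<in>I. (\<lambda>r. x i * p i r)) \<Longrightarrow> i \<in> I \<Longrightarrow>
      \<bar>x i * of_int d\<bar> \<le> 2"
    "\<And>z y j z' y' j' i. \<bar>d\<bar> = 2 \<Longrightarrow>
      z \<in> real_fun ` carrier_vec m \<Longrightarrow> z = (\<Sum>i\<in>I. (\<lambda>r. y i * p i r)) \<Longrightarrow> j \<in> I \<Longrightarrow> y j \<notin> \<int> \<Longrightarrow>
      z' \<in> real_fun ` carrier_vec m \<Longrightarrow> z' = (\<Sum>i\<in>I. (\<lambda>r. y' i * p i r)) \<Longrightarrow> j' \<in> I \<Longrightarrow> y' j' \<notin> \<int> \<Longrightarrow>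
      i \<in> I \<Longrightarrow> y i - y' i \<in> \<int>"
proof -
  obtain P q where P: "P \<in> carrier_mat m m" "bij_betw q {0..<m} I" "\<bar>det P\<bar> = 1 \<or> \<bar>det P\<bar> = 2"
    "\<And>z x. z \<in> carrier_vec m \<Longrightarrow> real_fun z = (\<Sum>i\<in>I. (\<lambda>r. x i * p i r)) \<Longrightarrow>
      map_mat real_of_int P *\<^sub>v vec m (\<lambda>j. x (q j)) = map_vec real_of_int z"
    "\<And>a j. a \<in> set (cols A) \<Longrightarrow> j < m \<Longrightarrow> \<bar>det (replace_col P a j)\<bar> \<le> 2"
    by (rule frame_matrix[OF A fr]) (rule that; assumption)
  have cols: "set (cols A) \<subseteq> carrier_vec m" using A(2) cols_dim by blast
  have index: "\<exists>j<m. q j = i" if "i \<in> I" for i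
    using P(2) that by (auto simp: bij_betw_def)
  have coord: "y (q j) * of_int (det P) = of_int (det (replace_col P w j))"
    if w: "w \<in> carrier_vec m" "real_fun w = (\<Sum>i\<in>I. (\<lambda>r. y i * p i r))" and j: "j < m" for w y j
  proof -
    have "of_int (det (replace_col P w j)) = vec m (\<lambda>j. y (q j)) $ j * of_int (det P)"
      by (rule real_cramer[OF P(1) w(1) _ P(4)[OF w] j]) simp
    then show ?thesis using j by simp
  qed
  show thesis
  proof (rule that[OF P(3)])
    show "y i * of_int (det P) \<in> \<int>"
      if z: "z \<in> real_fun ` carrier_vec m" "z = (\<Sum>i\<in>I. (\<lambda>r. y i * p i r))" "i \<in> I" for z y i
    proof -
      obtain w where w: "w \<in> carrier_vec m" "z = real_fun w" using z(1) by blast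
      obtain j where j: "j < m" "q j = i" using index[OF z(3)] by blast
      have "real_fun w = (\<Sum>i\<in>I. (\<lambda>r. y i * p i r))" using z(2) w(2) by simp
      from coord[OF w(1) this j(1)] show ?thesis unfolding j(2) by (metis Ints_of_int)
    qed
    show "\<bar>x i * of_int (det P)\<bar> \<le> 2"
      if a: "a \<in> real_fun ` set (cols A)" "a = (\<Sum>i\<in>I. (\<lambda>r. x i * p i r))" "i \<in> I" for a x i
    proof -
      obtain w where w: "w \<in> set (cols A)" "a = real_fun w" using a(1) by blast
      have wc: "w \<in> carrier_vec m" using w(1) cols by blast
      obtain j where j: "j < m" "q j = i" using index[OF a(3)] by blast
      have "real_fun w = (\<Sum>i\<in>I. (\<lambda>r. x i * p i r))" using a(2) w(2) by simp
      from coord[OF wc this j(1)] have "x i * of_int (det P) = of_int (det (replace_col P w j))"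
        unfolding j(2) .
      then show ?thesis using P(5)[OF w(1) j(1)] by linarith
    qed
    fix z y j z' y' j' i
    assume d: "\<bar>det P\<bar> = 2"
      and z: "z \<in> real_fun ` carrier_vec m" "z = (\<Sum>i\<in>I. (\<lambda>r. y i * p i r))" "j \<in> I" "y j \<notin> \<int>"
      and z': "z' \<in> real_fun ` carrier_vec m" "z' = (\<Sum>i\<in>I. (\<lambda>r. y' i * p i r))" "j' \<in> I" "y' j' \<notin> \<int>"
      and i: "i \<in> I"
    obtain w w' where w: "w \<in> carrier_vec m" "z = real_fun w" "w' \<in> carrier_vec m" "z' = real_fun w'"
      using z(1) z'(1) by blast
    obtain r r' s where r: "r < m" "q r = j" "r' < m" "q r' = j'" "s < m" "q s = i"
      using index[OF z(3)] index[OF z'(3)] index[OF i] by blast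
    have eq: "map_mat real_of_int P *\<^sub>v vec m (\<lambda>j. y (q j)) = map_vec real_of_int w"
      "map_mat real_of_int P *\<^sub>v vec m (\<lambda>j. y' (q j)) = map_vec real_of_int w'"
      using P(4)[OF w(1)] P(4)[OF w(3)] w z z' by auto
    have "vec m (\<lambda>j. y (q j)) $ s - vec m (\<lambda>j. y' (q j)) $ s \<in> \<int>"
      by (rule det_2_coords_congruent[OF P(1) d w(1,3) _ _ eq r(1) _ r(3) _ r(5)])
        (use r z(4) z'(4) in auto)
    then show "y i - y' i \<in> \<int>" using r by simp
  qed
qed

lemma bimodular_system_cols:
  assumes A: "bimodular A" "dim_row A = m"
  shows "bimodular_system (\<lambda>(c::real) (f::nat \<Rightarrow> real) i. c * f i) (real_fun ` set (cols A)) (real_fun ` carrier_vec m)"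
proof -
  have cols: "set (cols A) \<subseteq> carrier_vec m" using A(2) cols_dim by blast
  have int_if_unit: "y \<in> \<int>" if "y * of_int d \<in> \<int>" "\<bar>d\<bar> = 1" for y :: real and d :: int
  proof -
    have "d = 1 \<or> d = -1" using that(2) by linarith
    then show ?thesis using that(1) by auto
  qed
  show ?thesis
  proof
    show "finite (real_fun ` set (cols A))" by simp
    show "real_fun ` set (cols A) \<subseteq> real_fun ` carrier_vec m" using cols by blast
    show "u - v \<in> real_fun ` carrier_vec m"
      if uv: "u \<in> real_fun ` carrier_vec m" "v \<in> real_fun ` carrier_vec m" for u v
    proof -
      obtain u' v' where "u = real_fun u'" "v = real_fun v'" "u' \<in> carrier_vec m" "v' \<in> carrier_vec m"
        using uv by blast
      then show ?thesis using real_fun_diff[of u' m v'] minus_carrier_vec[of u' m v'] by (metis imageI)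
    qed
    show "real_fun ` carrier_vec m \<subseteq> fs.span (real_fun ` set (cols A))" by (rule full_rank_dim(2)[OF A])
  next
    fix I :: "(nat \<Rightarrow> real) set" and p :: "(nat \<Rightarrow> real) \<Rightarrow> nat \<Rightarrow> real"
    assume fr: "fs.frame (real_fun ` set (cols A)) I p"
    obtain d :: int where d: "\<bar>d\<bar> = 1 \<or> \<bar>d\<bar> = 2"
      "\<And>z y i. z \<in> real_fun ` carrier_vec m \<Longrightarrow> z = (\<Sum>i\<in>I. (\<lambda>r. y i * p i r)) \<Longrightarrow> i \<in> I \<Longrightarrow>
        y i * of_int d \<in> \<int>"
      "\<And>a x i. a \<in> real_fun ` set (cols A) \<Longrightarrow> a = (\<Sum>i\<in>I. (\<lambda>r. x i * p i r)) \<Longrightarrow> i \<in> I \<Longrightarrow>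
        \<bar>x i * of_int d\<bar> \<le> 2"
      "\<And>z y j z' y' j' i. \<bar>d\<bar> = 2 \<Longrightarrow>
        z \<in> real_fun ` carrier_vec m \<Longrightarrow> z = (\<Sum>i\<in>I. (\<lambda>r. y i * p i r)) \<Longrightarrow> j \<in> I \<Longrightarrow> y j \<notin> \<int> \<Longrightarrow>
        z' \<in> real_fun ` carrier_vec m \<Longrightarrow> z' = (\<Sum>i\<in>I. (\<lambda>r. y' i * p i r)) \<Longrightarrow> j' \<in> I \<Longrightarrow> y' j' \<notin> \<int> \<Longrightarrow>
        i \<in> I \<Longrightarrow> y i - y' i \<in> \<int>"
      by (rule frame_denominator[OF A fr]) (rule that; assumption)
    have d2: "\<bar>d\<bar> = 2" if "z \<in> real_fun ` carrier_vec m" "z = (\<Sum>i\<in>I. (\<lambda>r. y i * p i r))" "j \<in> I" "y j \<notin> \<int>" for z y j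
      using d(1) int_if_unit[OF d(2)[OF that(1-3)]] that(4) by blast
    show "\<bar>x i\<bar> \<le> 2"
      if a: "a \<in> real_fun ` set (cols A)" "a = (\<Sum>i\<in>I. (\<lambda>r. x i * p i r))" "i \<in> I" for a x i
    proof -
      have "1 \<le> \<bar>real_of_int d\<bar>" using d(1) by linarith
      then have "\<bar>x i\<bar> * 1 \<le> \<bar>x i\<bar> * \<bar>real_of_int d\<bar>" by (rule mult_left_mono) simp
      then show ?thesis using d(3)[OF a] by (simp add: abs_mult)
    qed
    show "\<bar>x i\<bar> \<le> 1"
      if z: "z \<in> real_fun ` carrier_vec m" "z = (\<Sum>i\<in>I. (\<lambda>r. y i * p i r))" "j \<in> I" "y j \<notin> \<int>"
        and a: "a \<in> real_fun ` set (cols A)" "a = (\<Sum>i\<in>I. (\<lambda>r. x i * p i r))" "i \<in> I" for z y j a x i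
    proof -
      have "\<bar>real_of_int d\<bar> = 2" using d2[OF z] by linarith
      then show ?thesis using d(3)[OF a] by (simp add: abs_mult)
    qed
    show "2 * y i \<in> \<int>"
      if z: "z \<in> real_fun ` carrier_vec m" "z = (\<Sum>i\<in>I. (\<lambda>r. y i * p i r))" "i \<in> I" for z y i
    proof (cases "\<bar>d\<bar> = 1")
      case True
      then show ?thesis using int_if_unit[OF d(2)[OF z]] by (intro Ints_mult) auto
    next
      case False
      then have "d = 2 \<or> d = -2" using d(1) by linarith
      then show ?thesis using d(2)[OF z] by (auto simp: mult.commute)
    qed
    show "y i - y' i \<in> \<int>"
      if z: "z \<in> real_fun ` carrier_vec m" "z = (\<Sum>i\<in>I. (\<lambda>r. y i * p i r))" "j \<in> I" "y j \<notin> \<int>"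
        and z': "z' \<in> real_fun ` carrier_vec m" "z' = (\<Sum>i\<in>I. (\<lambda>r. y' i * p i r))" "j' \<in> I" "y' j' \<notin> \<int>"
        and i: "i \<in> I" for z y j z' y' j' i
      by (rule d(4)[OF d2[OF z] z z' i])
  qed
qed

section \<open>The contraction\<close>

lemma real_fun_vCons:
  "real_fun (vCons \<beta> b) 0 = of_int \<beta>" "real_fun (vCons \<beta> b) (Suc i) = real_fun b i"
  by (simp_all add: real_fun_def)

text \<open>
Coordinates are counted from 0, so the leading vector of the cube has index \<open>k - 1\<close>.
\<close>

lemma cube_iff:
  assumes "1 \<le> k" "k \<le> n"
  shows "v \<in> cube n k \<longleftrightarrow> v \<in> carrier_vec n \<and> v $ (k - 1) = 1 \<and>
    (\<forall>i<k - 1. v $ i \<in> {0, 1}) \<and> (\<forall>i. k \<le> i \<and> i < n \<longrightarrow> v $ i = 0)"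
proof -
  let ?w = "\<lambda>\<alpha>. unit_vec n (k - 1) + finsum_vec TYPE(int) n (\<lambda>i. \<alpha> i \<cdot>\<^sub>v unit_vec n i) {..<k - 1}"
  have f: "finsum_vec TYPE(int) n (\<lambda>i. \<alpha> i \<cdot>\<^sub>v unit_vec n i) {..<k - 1} \<in> carrier_vec n" for \<alpha> :: "nat \<Rightarrow> int"
    by (rule finsum_vec_closed) auto
  then have c: "?w \<alpha> \<in> carrier_vec n" for \<alpha> :: "nat \<Rightarrow> int" by simp
  have entry: "?w \<alpha> $ j = (if j < k - 1 then \<alpha> j else if j = k - 1 then 1 else 0)" if "j < n" for \<alpha> :: "nat \<Rightarrow> int" and j
  proof -
    have "finsum_vec TYPE(int) n (\<lambda>i. \<alpha> i \<cdot>\<^sub>v unit_vec n i) {..<k - 1} $ j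
        = (\<Sum>i<k - 1. (\<alpha> i \<cdot>\<^sub>v unit_vec n i) $ j)"
      by (rule index_finsum_vec) (use that in auto)
    also have "\<dots> = (\<Sum>i<k - 1. if i = j then \<alpha> i else 0)"
      by (rule sum.cong) (use that assms in auto)
    finally have 1: "finsum_vec TYPE(int) n (\<lambda>i. \<alpha> i \<cdot>\<^sub>v unit_vec n i) {..<k - 1} $ j
        = (if j < k - 1 then \<alpha> j else 0)" by simp
    then show ?thesis using that 1 f[of \<alpha>] assms by (auto simp: unit_vec_def)
  qed
  show ?thesis
  proof
    assume "v \<in> cube n k"
    then obtain \<alpha> where \<alpha>: "v = ?w \<alpha>" "\<forall>i. \<alpha> i \<in> {0, 1}" unfolding cube_def by blast
    show "v \<in> carrier_vec n \<and> v $ (k - 1) = 1 \<and>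
      (\<forall>i<k - 1. v $ i \<in> {0, 1}) \<and> (\<forall>i. k \<le> i \<and> i < n \<longrightarrow> v $ i = 0)"
      unfolding \<alpha>(1) using c entry assms \<alpha>(2) by auto
  next
    assume v: "v \<in> carrier_vec n \<and> v $ (k - 1) = 1 \<and>
      (\<forall>i<k - 1. v $ i \<in> {0, 1}) \<and> (\<forall>i. k \<le> i \<and> i < n \<longrightarrow> v $ i = 0)"
    define \<alpha> where "\<alpha> i = (if i < k - 1 then v $ i else 0)" for i
    have "v = ?w \<alpha>"
    proof (rule eq_vecI)
      show "dim_vec v = dim_vec (?w \<alpha>)" using v c[of \<alpha>] carrier_vecD by metis
      fix j assume "j < dim_vec (?w \<alpha>)"
      then have j: "j < n" using c[of \<alpha>] carrier_vecD by metis
      consider "j < k - 1" | "j = k - 1" | "k \<le> j" using assms by linarith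
      then show "v $ j = ?w \<alpha> $ j"
        unfolding entry[OF j] using v j assms by cases (auto simp: \<alpha>_def)
    qed
    moreover have "\<forall>i. \<alpha> i \<in> {0, 1}" using v by (auto simp: \<alpha>_def)
    ultimately show "v \<in> cube n k" unfolding cube_def by blast
  qed
qed

definition half_basis_vec :: "nat \<Rightarrow> nat \<Rightarrow> nat \<Rightarrow> int vec" where
  "half_basis_vec n k i = vec n (\<lambda>j. if i < k - 1 then (if j = i then 1 else 0)
     else if j < k - 1 then 1 else if j = k - 1 then 2 else 0)"

lemma half_basis_eq:
  assumes "1 \<le> k" "k \<le> n"
  shows "half_basis n k = half_basis_vec n k ` {..<k}"
proof -
  have "unit_vec n i = half_basis_vec n k i" if "i < k - 1" for i
    using that by (intro eq_vecI) (auto simp: half_basis_vec_def unit_vec_def)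
  moreover have "finsum_vec TYPE(int) n (unit_vec n) {..<k - 1} + 2 \<cdot>\<^sub>v unit_vec n (k - 1) = half_basis_vec n k (k - 1)"
    (is "?l = ?r")
  proof (rule eq_vecI)
    have c: "finsum_vec TYPE(int) n (unit_vec n) {..<k - 1} \<in> carrier_vec n"
      by (rule finsum_vec_closed) auto
    show "dim_vec ?l = dim_vec ?r" by (simp add: half_basis_vec_def)
    fix j assume "j < dim_vec ?r"
    then have j: "j < n" by (simp add: half_basis_vec_def)
    have "finsum_vec TYPE(int) n (unit_vec n) {..<k - 1} $ j = (\<Sum>i<k - 1. (unit_vec n i :: int vec) $ j)"
      by (rule index_finsum_vec) (use j in auto)
    also have "\<dots> = (\<Sum>i<k - 1. if i = j then 1 else 0)"
      by (rule sum.cong) (use j assms in auto)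
    finally have "finsum_vec TYPE(int) n (unit_vec n) {..<k - 1} $ j = (if j < k - 1 then 1 else 0)" by simp
    then show "?l $ j = ?r $ j" using j c assms by (auto simp: half_basis_vec_def unit_vec_def)
  qed
  moreover have "{..<k} = insert (k - 1) {..<k - 1}" using assms(1) by auto
  ultimately show ?thesis unfolding half_basis_def by auto
qed

text \<open>
The hypotheses from which the half-basis system is obtained; for \<open>k < 2\<close> the theorem claims nothing.
\<close>

locale contraction_setting =
  fixes m k :: nat and A :: "int mat" and B\<^sub>s :: "int vec set"
  assumes dim_A: "dim_row A = m"
    and bimodular_A: "bimodular A"
    and aligned_A: "aligned_signs A"
    and min_B: "min_half_integral_indep A B\<^sub>s"
    and k_eq: "k = card B\<^sub>s"
    and B_eq: "B\<^sub>s = half_basis m k"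
    and span_B: "\<forall>a \<in> set (cols A). in_span m a B\<^sub>s \<longrightarrow> a \<in> B\<^sub>s \<union> cube m k"
    and k_ge_2: "2 \<le> k"
begin

abbreviation fscale :: "real \<Rightarrow> (nat \<Rightarrow> real) \<Rightarrow> nat \<Rightarrow> real" where
  "fscale \<equiv> \<lambda>c f i. c * f i"

abbreviation M :: "int vec set" where "M \<equiv> multiple_fibers A"

abbreviation e :: "nat \<Rightarrow> real" where "e \<equiv> real_fun (unit_vec m 0)"

abbreviation B :: "(nat \<Rightarrow> real) set" where "B \<equiv> real_fun ` B\<^sub>s"

lemma cols_carrier: "set (cols A) \<subseteq> carrier_vec m"
  using dim_A cols_dim by blast

lemma half_indep: "half_integral_indep A B\<^sub>s"
  using min_B by (simp add: min_half_integral_indep_def)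

lemma B_cols: "B\<^sub>s \<subseteq> set (cols A)"
  using half_indep by (simp add: half_integral_indep_def)

lemma B_carrier: "B\<^sub>s \<subseteq> carrier_vec m"
  using B_cols cols_carrier by blast

lemma finite_Bs: "finite B\<^sub>s"
  using B_cols finite_subset by blast

lemma inj_B: "inj_on real_fun B\<^sub>s"
  using inj_real_fun B_carrier inj_on_subset by blast

lemma independent_B: "fs.independent B"
  using half_indep dependent_real_fun_iff[OF B_carrier finite_Bs] dim_A
  by (simp add: half_integral_indep_def)

lemma card_B_eq: "card B = k"
  using card_image[OF inj_B] k_eq by simp

lemma k_le_m: "k \<le> m"
proof -
  have "B \<subseteq> {f. \<forall>j\<ge>m. f j = 0}" using real_fun_support B_carrier by blast
  then show ?thesis using independent_support_card(2)[OF independent_B] card_B_eq by simp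
qed

abbreviation bs :: "nat \<Rightarrow> int vec" where "bs \<equiv> half_basis_vec m k"

lemma Bs_image: "B\<^sub>s = bs ` {..<k}"
  using half_basis_eq[of k m] B_eq k_ge_2 k_le_m by simp

lemma inj_bs: "inj_on bs {..<k}"
  by (rule eq_card_imp_inj_on) (use Bs_image k_eq in auto)

lemma e_in_B: "e \<in> B"
proof -
  have "bs 0 = unit_vec m 0" using k_ge_2 by (intro eq_vecI) (auto simp: half_basis_vec_def unit_vec_def)
  moreover have "bs 0 \<in> B\<^sub>s" unfolding Bs_image using k_ge_2 by auto
  ultimately show ?thesis by (metis imageI)
qed

lemma e_0: "e 0 = 1"
  using k_ge_2 k_le_m by (simp add: real_fun_def)

lemma e_Suc: "e (Suc i) = 0"
  by (simp add: real_fun_def)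

lemma span_e: "v \<in> fs.span {e} \<Longrightarrow> v (Suc i) = 0"
  using e_Suc by (auto simp: fs.span_singleton)

lemma lifts_exist:
  assumes "b \<in> M"
  shows "\<exists>\<beta> \<gamma>. \<beta> < \<gamma> \<and> vCons \<beta> b \<in> set (cols A) \<and> vCons \<gamma> b \<in> set (cols A)"
proof -
  have "card (fiber A b) \<ge> 2" using assms by (simp add: multiple_fibers_def)
  then obtain a a' where a: "a \<in> fiber A b" "a' \<in> fiber A b" "a \<noteq> a'"
    using card_le_Suc0_iff_eq[of "fiber A b"] card.infinite[of "fiber A b"]
    by (metis Suc_1 not_less_eq_eq zero_le numeral_2_eq_2)
  then obtain \<beta> \<gamma> where "a = vCons \<beta> b" "a' = vCons \<gamma> b" "a \<in> set (cols A)" "a' \<in> set (cols A)"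
    unfolding fiber_def by blast
  then show ?thesis using a(3) by (cases \<beta> \<gamma> rule: linorder_cases) auto
qed

definition lo :: "int vec \<Rightarrow> int" where
  "lo b = (SOME \<beta>. \<exists>\<gamma>. \<beta> < \<gamma> \<and> vCons \<beta> b \<in> set (cols A) \<and> vCons \<gamma> b \<in> set (cols A))"

definition hi :: "int vec \<Rightarrow> int" where
  "hi b = (SOME \<gamma>. lo b < \<gamma> \<and> vCons (lo b) b \<in> set (cols A) \<and> vCons \<gamma> b \<in> set (cols A))"

lemma lo_hi:
  assumes "b \<in> M"
  shows "lo b < hi b" "vCons (lo b) b \<in> set (cols A)" "vCons (hi b) b \<in> set (cols A)"
proof -
  have "\<exists>\<gamma>. lo b < \<gamma> \<and> vCons (lo b) b \<in> set (cols A) \<and> vCons \<gamma> b \<in> set (cols A)"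
    unfolding lo_def by (rule someI_ex) (rule lifts_exist[OF assms])
  then have "lo b < hi b \<and> vCons (lo b) b \<in> set (cols A) \<and> vCons (hi b) b \<in> set (cols A)"
    unfolding hi_def by (rule someI_ex)
  then show "lo b < hi b" "vCons (lo b) b \<in> set (cols A)" "vCons (hi b) b \<in> set (cols A)" by auto
qed

definition l :: "int vec \<Rightarrow> nat \<Rightarrow> real" where
  "l b = real_fun (vCons (lo b) b)"

definition \<delta> :: "int vec \<Rightarrow> int" where
  "\<delta> b = hi b - lo b"

definition h :: "nat \<Rightarrow> real" where
  "h = real_fun (SOME w. w \<in> carrier_vec m \<and> real_fun w + real_fun w = \<Sum>B)"

lemma sum_real_fun:
  assumes "X \<subseteq> carrier_vec m" "finite X"
  shows "(\<Sum>(real_fun ` X)) i = (if i < m then (\<Sum>x\<in>X. real_of_int (x $ i)) else 0)"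
proof -
  have "inj_on real_fun X" using inj_real_fun assms(1) inj_on_subset by blast
  then show ?thesis
    unfolding fun_sum_apply using assms(1)
    by (cases "i < m") (auto simp: sum.reindex real_fun_apply subset_iff intro!: sum.cong sum.neutral)
qed

lemma half_sum_iff:
  assumes X: "X \<subseteq> carrier_vec m" "finite X" and w: "w \<in> carrier_vec m"
  shows "(1 / 2 :: real) \<cdot>\<^sub>v finsum_vec TYPE(real) m (map_vec real_of_int) X = map_vec real_of_int w \<longleftrightarrow>
    real_fun w + real_fun w = \<Sum>(real_fun ` X)"
proof -
  let ?f = "finsum_vec TYPE(real) m (map_vec real_of_int) X"
  have c: "?f \<in> carrier_vec m" using X by (intro finsum_vec_closed) auto
  have f: "?f $ i = (\<Sum>x\<in>X. real_of_int (x $ i))" if "i < m" for i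
    by (subst index_finsum_vec[OF X(2) that]) (use X that in \<open>auto intro!: sum.cong\<close>)
  have "(1 / 2 :: real) \<cdot>\<^sub>v ?f = map_vec real_of_int w \<longleftrightarrow> (\<forall>i<m. 1 / 2 * ?f $ i = real_of_int (w $ i))"
    using c w by (auto simp: vec_eq_iff)
  also have "\<dots> \<longleftrightarrow> (\<forall>i. (real_fun w + real_fun w) i = (\<Sum>(real_fun ` X)) i)"
    unfolding sum_real_fun[OF X] using w f by (auto simp: real_fun_apply)
  also have "\<dots> \<longleftrightarrow> real_fun w + real_fun w = \<Sum>(real_fun ` X)" by (simp only: fun_eq_iff)
  finally show ?thesis .
qed

lemma h_props: "h \<in> real_fun ` carrier_vec m" "h + h = \<Sum>B"
proof -
  have "\<exists>w. w \<in> carrier_vec m \<and> real_fun w + real_fun w = \<Sum>B"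
    using half_indep half_sum_iff[OF B_carrier finite_Bs] dim_A
    unfolding half_integral_indep_def by blast
  then have "(SOME w. w \<in> carrier_vec m \<and> real_fun w + real_fun w = \<Sum>B) \<in> carrier_vec m \<and> h + h = \<Sum>B"
    unfolding h_def by (rule someI_ex)
  then show "h \<in> real_fun ` carrier_vec m" "h + h = \<Sum>B" unfolding h_def by blast+
qed

lemma M_carrier: "b \<in> M \<Longrightarrow> b \<in> carrier_vec (m - 1)"
proof -
  assume "b \<in> M"
  then have "vCons (lo b) b \<in> carrier_vec m" using lo_hi(2) cols_carrier by blast
  then have "Suc (dim_vec b) = m" by (metis carrier_vecD dim_vec_vCons)
  then show ?thesis by (auto intro: carrier_vecI)
qed

lemma m_eq: "m = Suc (m - 1)"
  using k_ge_2 k_le_m by simp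

lemma finite_M: "finite M"
proof -
  have "(\<lambda>b. vCons (lo b) b) ` M \<subseteq> set (cols A)" using lo_hi(2) by blast
  moreover have "inj_on (\<lambda>b. vCons (lo b) b) M" by (auto simp: inj_on_def)
  ultimately show ?thesis using finite_imageD finite_subset by (metis List.finite_set)
qed

lemma l_0: "l b 0 = of_int (lo b)" and l_Suc: "l b (Suc i) = real_fun b i"
  by (simp_all add: l_def real_fun_vCons)

lemma M_nonzero: "b \<in> M \<Longrightarrow> \<exists>i. real_fun b i \<noteq> 0"
proof (rule ccontr)
  assume b: "b \<in> M" and "\<not> (\<exists>i. real_fun b i \<noteq> 0)"
  then have "real_fun b i = 0" for i by blast
  then have "b $ i = 0" if "i < dim_vec b" for i using that unfolding real_fun_def by (metis of_int_eq_0_iff)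
  then have "b = 0\<^sub>v (dim_vec b)" by (intro eq_vecI) auto
  then show False using b by (simp add: multiple_fibers_def contraction_def)
qed

lemma M_not_opposite:
  assumes b: "b \<in> M" "b' \<in> M" "b \<noteq> b'"
  shows "\<exists>i. real_fun b i \<noteq> real_fun b' i" "\<exists>i. real_fun b i + real_fun b' i \<noteq> 0"
proof -
  have c: "b \<in> carrier_vec (m - 1)" "b' \<in> carrier_vec (m - 1)" using M_carrier b by auto
  show "\<exists>i. real_fun b i \<noteq> real_fun b' i"
    using inj_onD[OF inj_real_fun _ c] b(3) by (metis ext)
  show "\<exists>i. real_fun b i + real_fun b' i \<noteq> 0"
  proof (rule ccontr)
    assume "\<not> ?thesis"
    then have z: "real_fun b i + real_fun b' i = 0" for i by blast
    have "b = - b'"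
    proof (rule eq_vecI)
      fix i assume "i < dim_vec (- b')"
      then have "i < m - 1" using c by simp
      then have "real_of_int (b $ i) + real_of_int (b' $ i) = 0"
        using z[of i] c by (simp add: real_fun_apply)
      then have "b $ i + b' $ i = 0" by linarith
      then show "b $ i = (- b') $ i" using c \<open>i < m - 1\<close> by simp
    qed (use c in simp)
    then have "\<not> differ b b'" by (simp add: differ_def)
    then show False using aligned_A lo_hi(2)[OF b(1)] lo_hi(2)[OF b(2)] b(3)
      unfolding aligned_signs_def by blast
  qed
qed

lemma inj_real_bs: "inj_on (\<lambda>i. real_fun (bs i)) {..<k}"
proof -
  have "real_fun ` bs ` {..<k} = B" "inj_on real_fun (bs ` {..<k})" using Bs_image inj_B by auto
  then show ?thesis using comp_inj_on[OF inj_bs] by (simp add: comp_def)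
qed

text \<open>
The last vector of \<open>B\<^sup>*\<close> alone reaches the coordinate \<open>k - 1\<close>, with entry 2, and has entry 1 before.
\<close>

lemma B_coords:
  fixes w :: "int vec"
  assumes w: "w \<in> carrier_vec m" "\<And>i. k \<le> i \<Longrightarrow> i < m \<Longrightarrow> w $ i = 0"
  defines "x i \<equiv> (if i < k - 1 then real_of_int (w $ i) - of_int (w $ (k - 1)) / 2 else of_int (w $ (k - 1)) / 2)"
  shows "real_fun w = (\<Sum>i<k. fscale (x i) (real_fun (bs i)))"
    and "real_fun w \<in> fs.span B"
    and "i < k \<Longrightarrow> fs.representation B (real_fun w) (real_fun (bs i)) = x i"
proof -
  have kk: "{..<k} = insert (k - 1) {..<k - 1}" using k_ge_2 by auto
  show eq: "real_fun w = (\<Sum>i<k. fscale (x i) (real_fun (bs i)))"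
  proof
    fix j
    have "(\<Sum>i<k. fscale (x i) (real_fun (bs i))) j = (\<Sum>i<k. x i * real_fun (bs i) j)"
      unfolding fun_sum_apply ..
    also have "\<dots> = x (k - 1) * real_fun (bs (k - 1)) j + (\<Sum>i<k - 1. x i * real_fun (bs i) j)"
      unfolding kk by (subst sum.insert) auto
    also have "(\<Sum>i<k - 1. x i * real_fun (bs i) j) = (\<Sum>i<k - 1. if i = j then x i else 0)"
      by (rule sum.cong) (use k_le_m in \<open>auto simp: real_fun_def half_basis_vec_def\<close>)
    also have "\<dots> = (if j < k - 1 then x j else 0)" by simp
    also have "x (k - 1) * real_fun (bs (k - 1)) j + \<dots> = real_fun w j"
      using w k_le_m k_ge_2 by (auto simp: x_def real_fun_def half_basis_vec_def)
    finally show "real_fun w j = (\<Sum>i<k. fscale (x i) (real_fun (bs i))) j" ..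
  qed
  have inB: "real_fun (bs i) \<in> B" if "i < k" for i using that Bs_image by blast
  show "real_fun w \<in> fs.span B"
    unfolding eq by (intro fs.span_sum fs.span_scale fs.span_base inB) simp
  assume i: "i < k"
  have "fs.representation B (real_fun w) = (\<lambda>v. \<Sum>i<k. fs.representation B (fscale (x i) (real_fun (bs i))) v)"
    unfolding eq by (rule fs.representation_sum[OF independent_B]) (auto intro: fs.span_scale fs.span_base inB)
  also have "\<dots> = (\<lambda>v. \<Sum>i<k. x i * (if v = real_fun (bs i) then 1 else 0))"
    by (intro ext sum.cong refl)
      (simp add: fs.representation_scale[OF independent_B fs.span_base[OF inB]]
        fs.representation_basis[OF independent_B inB])
  finally have "fs.representation B (real_fun w) (real_fun (bs i)) =
      (\<Sum>j<k. x j * (if real_fun (bs i) = real_fun (bs j) then 1 else 0))" by simp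
  also have "\<dots> = (\<Sum>j<k. if j = i then x j else 0)"
    by (rule sum.cong) (use inj_real_bs i in \<open>auto simp: inj_on_def\<close>)
  also have "\<dots> = x i" using i by simp
  finally show "fs.representation B (real_fun w) (real_fun (bs i)) = x i" .
qed

text \<open>
Both lifts of \<open>b\<close> are in \<open>span B\<^sup>*\<close>, hence in \<open>B\<^sup>*\<close> or in the cube. The entries at \<open>k - 1\<close> are 0 or 2 in the
first case and 1 in the second, so it is the same case for both. Vectors in \<open>B\<^sup>*\<close> that differ do not agree
outside the first entry.
\<close>

lemma lift_in_cube:
  assumes b: "b \<in> M" "l b \<in> fs.span B"
  shows "vCons (lo b) b \<in> cube m k"
proof -
  have e: "e \<in> fs.span B" using e_in_B by (rule fs.span_base)
  have "real_fun (vCons (hi b) b) = l b + fscale (of_int (\<delta> b)) e"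
  proof
    fix i show "real_fun (vCons (hi b) b) i = (l b + fscale (of_int (\<delta> b)) e) i"
      by (cases i) (simp_all add: l_def real_fun_vCons e_0 e_Suc \<delta>_def)
  qed
  then have hi_span: "real_fun (vCons (hi b) b) \<in> fs.span B"
    using fs.span_add[OF b(2) fs.span_scale[OF e]] by simp
  have "in_span m (vCons (lo b) b) B\<^sub>s"
    using span_real_fun_in_span[OF B_carrier finite_Bs] b lo_hi(2)[OF b(1)] cols_carrier
    unfolding l_def by blast
  then have lo: "vCons (lo b) b \<in> B\<^sub>s \<union> cube m k" using span_B lo_hi(2)[OF b(1)] by blast
  have "in_span m (vCons (hi b) b) B\<^sub>s"
    using span_real_fun_in_span[OF B_carrier finite_Bs] hi_span lo_hi(3)[OF b(1)] cols_carrier by blast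
  then have hi: "vCons (hi b) b \<in> B\<^sub>s \<union> cube m k" using span_B lo_hi(3)[OF b(1)] by blast
  have same: "vCons (lo b) b $ j = vCons (hi b) b $ j" if "j \<noteq> 0" for j
    using that by (simp add: vec_index_vCons)
  have ne: "vCons (lo b) b \<noteq> vCons (hi b) b" using lo_hi(1)[OF b(1)] by simp
  have k1: "1 \<le> k" "k - 1 \<noteq> 0" "k - 1 < m" using k_ge_2 k_le_m by auto
  have cube1: "v $ (k - 1) = 1" if "v \<in> cube m k" for v
    using that cube_iff[OF k1(1) k_le_m] by blast
  show ?thesis
  proof (rule ccontr)
    assume nc: "vCons (lo b) b \<notin> cube m k"
    then obtain i where i: "i < k" "vCons (lo b) b = bs i" using lo Bs_image by auto
    have "(bs i) $ (k - 1) \<noteq> 1" using k1 by (auto simp: half_basis_vec_def)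
    then have "vCons (hi b) b \<notin> cube m k" using cube1 same[OF k1(2)] i(2) by metis
    then obtain j where j: "j < k" "vCons (hi b) b = bs j" using hi Bs_image by auto
    have ij: "i \<noteq> j" using ne i(2) j(2) by auto
    have eq: "bs i $ r = bs j $ r" if "r \<noteq> 0" for r using same[OF that] i(2) j(2) by simp
    have "i < k - 1 \<longleftrightarrow> j < k - 1"
      using eq[OF k1(2)] k1 by (auto simp: half_basis_vec_def split: if_splits)
    then have lt: "i < k - 1" "j < k - 1" using i(1) j(1) ij by auto
    have im: "i < m" "j < m" using i(1) j(1) k_le_m by auto
    have "i = 0" using eq[of i] lt im ij by (auto simp: half_basis_vec_def)
    moreover have "j = 0" using eq[of j] lt im ij by (auto simp: half_basis_vec_def)
    ultimately show False using ij by simp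
  qed
qed

lemma lift_coords:
  assumes b: "b \<in> M" "l b \<in> fs.span B" and s: "s \<in> B"
  shows "fs.representation B (l b) s \<notin> \<int>"
proof -
  let ?w = "vCons (lo b) b"
  have w: "?w \<in> carrier_vec m" "?w $ (k - 1) = 1" "\<And>i. k \<le> i \<Longrightarrow> i < m \<Longrightarrow> ?w $ i = 0"
    using lift_in_cube[OF b] cube_iff[of k m] k_ge_2 k_le_m by auto
  obtain i where i: "i < k" "s = real_fun (bs i)" using s Bs_image by auto
  have nh: "real_of_int n + 1 / 2 \<notin> \<int>" for n
  proof
    assume "real_of_int n + 1 / 2 \<in> \<int>"
    then obtain q where "real_of_int n + 1 / 2 = of_int q" by (auto elim: Ints_cases)
    then have "2 * n + 1 = 2 * q" by linarith
    then show False by presburger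
  qed
  have "fs.representation B (l b) s = (if i < k - 1 then real_of_int (?w $ i) - 1 / 2 else 1 / 2)"
    using B_coords(3)[OF w(1,3) i(1)] w(2) unfolding l_def i(2) by simp
  also have "\<dots> = of_int (if i < k - 1 then ?w $ i - 1 else 0) + 1 / 2" by simp
  finally show ?thesis using nh by metis
qed

sublocale H: half_basis_system fscale "real_fun ` set (cols A)" "real_fun ` carrier_vec m" e h B M l \<delta>
proof -
  interpret bimodular_system fscale "real_fun ` set (cols A)" "real_fun ` carrier_vec m"
    by (rule bimodular_system_cols[OF bimodular_A dim_A])
  show "half_basis_system fscale (real_fun ` set (cols A)) (real_fun ` carrier_vec m) e h B M l \<delta>"
  proof
    show "e \<in> B" by (rule e_in_B)
    show "B \<subseteq> real_fun ` set (cols A)" using B_cols by blast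
    show "fs.independent B" by (rule independent_B)
    show "2 \<le> card B" using card_B_eq k_ge_2 by simp
    show "h \<in> real_fun ` carrier_vec m" "h + h = \<Sum>B" by (rule h_props)+
    show "finite M" by (rule finite_M)
    show "card B \<le> card B'"
      if B': "B' \<subseteq> real_fun ` set (cols A)" "B' \<noteq> {}" "fs.independent B'"
        "z \<in> real_fun ` carrier_vec m" "z + z = \<Sum>B'" for B' z
    proof -
      obtain X where X: "X \<subseteq> set (cols A)" "B' = real_fun ` X" using B'(1) by (auto simp: subset_image_iff)
      have Xc: "X \<subseteq> carrier_vec m" "finite X" using X(1) cols_carrier finite_subset by auto
      obtain w where w: "w \<in> carrier_vec m" "z = real_fun w" using B'(4) by blast
      have "\<not> lin_dependent (dim_row A) X"
        using dependent_real_fun_iff[OF Xc] B'(3) X(2) dim_A by simp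
      moreover have "(1 / 2 :: real) \<cdot>\<^sub>v finsum_vec TYPE(real) m (map_vec real_of_int) X = map_vec real_of_int w"
        using half_sum_iff[OF Xc w(1)] B'(5) w(2) X(2) by simp
      ultimately have "half_integral_indep A X"
        unfolding half_integral_indep_def dim_A using X B'(2) w(1) by blast
      then have "card B\<^sub>s \<le> card X" using min_B by (simp add: min_half_integral_indep_def)
      moreover have "card B' = card X"
        unfolding X(2) by (rule card_image) (use inj_real_fun Xc(1) inj_on_subset in blast)
      ultimately show ?thesis using card_B_eq k_eq by simp
    qed
  next
    fix b assume b: "b \<in> M"
    show "l b \<in> real_fun ` set (cols A)" unfolding l_def using lo_hi(2)[OF b] by blast
    show "1 \<le> \<delta> b" using lo_hi(1)[OF b] by (simp add: \<delta>_def)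
    have "l b + fscale (of_int (\<delta> b)) e = real_fun (vCons (hi b) b)"
    proof
      fix i show "(l b + fscale (of_int (\<delta> b)) e) i = real_fun (vCons (hi b) b) i"
        by (cases i) (simp_all add: l_def real_fun_vCons e_0 e_Suc \<delta>_def)
    qed
    then show "l b + fscale (of_int (\<delta> b)) e \<in> real_fun ` set (cols A)" using lo_hi(3)[OF b] by simp
    show "l b \<notin> fs.span {e}" using span_e M_nonzero[OF b] l_Suc by metis
    fix b' assume b': "b' \<in> M" "b \<noteq> b'"
    obtain i j where "real_fun b i \<noteq> real_fun b' i" "real_fun b j + real_fun b' j \<noteq> 0"
      using M_not_opposite[OF b b'] by blast
    then have "(l b - l b') (Suc i) \<noteq> 0" "(l b + l b') (Suc j) \<noteq> 0" by (simp_all add: l_Suc)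
    then show "l b - l b' \<notin> fs.span {e} \<and> l b + l b' \<notin> fs.span {e}" using span_e by blast
  next
    show "fs.representation B (l b) s \<notin> \<int>" if "b \<in> M" "l b \<in> fs.span B" "s \<in> B" for b s
      by (rule lift_coords[OF that])
  qed
qed

end

section \<open>Circuits in the multiple fibers\<close>

text \<open>
The witness is \<open>\<plusminus>b\<close>, with the sign for which adding \<open>d\<close> gives \<open>\<plusminus>b'\<close>.
\<close>

lemma extends_by_pairI:
  fixes C :: "int vec set"
  assumes C: "C = insert b (insert b' X)" "b \<noteq> b'" "b \<notin> X" "b' \<notin> X" "finite X" and b: "b \<in> V"
    and dims: "b \<in> carrier_vec n" "b' \<in> carrier_vec n" "d \<in> carrier_vec n"
    and signs: "\<bar>\<sigma>\<bar> = 1" "\<bar>\<tau>\<bar> = (1::int)"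
    and eq: "\<And>i. i < n \<Longrightarrow> b' $ i = \<sigma> * b $ i + \<tau> * d $ i"
  shows "extends_by_pair V C X d"
proof -
  have s: "\<sigma> = 1 \<or> \<sigma> = -1" "\<tau> = 1 \<or> \<tau> = -1" using signs by linarith+
  have st: "\<tau> * \<sigma> \<in> {1, -1}" "\<tau> \<in> {1, -1}" using s by auto
  have 1: "(\<tau> * \<sigma>) \<cdot>\<^sub>v ((\<tau> * \<sigma>) \<cdot>\<^sub>v b) = b"
    using s dims by (intro eq_vecI) auto
  have 2: "\<tau> \<cdot>\<^sub>v ((\<tau> * \<sigma>) \<cdot>\<^sub>v b + d) = b'"
  proof (rule eq_vecI)
    fix i assume "i < dim_vec b'"
    then have i: "i < n" using dims by simp
    show "(\<tau> \<cdot>\<^sub>v ((\<tau> * \<sigma>) \<cdot>\<^sub>v b + d)) $ i = b' $ i"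
      unfolding eq[OF i] using i dims s by (auto simp: algebra_simps)
  qed (use dims in simp)
  have "mset_set C = mset_set X + {# b, b' #}" unfolding C(1) using C(2-5) by simp
  then have "mset_set C = mset_set X + {# (\<tau> * \<sigma>) \<cdot>\<^sub>v ((\<tau> * \<sigma>) \<cdot>\<^sub>v b), \<tau> \<cdot>\<^sub>v ((\<tau> * \<sigma>) \<cdot>\<^sub>v b + d) #}"
    unfolding 1 2 .
  moreover have "(\<tau> * \<sigma>) \<cdot>\<^sub>v ((\<tau> * \<sigma>) \<cdot>\<^sub>v b) \<in> V" unfolding 1 by (rule b)
  ultimately show ?thesis
    unfolding extends_by_pair_def using st by blast
qed

lemma cube_1:
  assumes n: "1 \<le> n"
  shows "cube n 1 = {unit_vec n 0}"
proof -
  have iff: "v \<in> cube n 1 \<longleftrightarrow> v \<in> carrier_vec n \<and> v $ 0 = 1 \<and> (\<forall>i. 1 \<le> i \<and> i < n \<longrightarrow> v $ i = 0)" for v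
    using cube_iff[OF order_refl n, of v] by simp
  have "v \<in> cube n 1 \<longleftrightarrow> v = unit_vec n 0" for v
  proof
    assume v: "v \<in> cube n 1"
    show "v = unit_vec n 0"
    proof (rule eq_vecI)
      fix i assume "i < dim_vec (unit_vec n 0 :: int vec)"
      then show "v $ i = unit_vec n 0 $ i"
        using v unfolding iff by (cases i) (auto simp: unit_vec_def)
    qed (use v in \<open>simp only: iff carrier_vecD index_unit_vec\<close>)
  next
    assume "v = unit_vec n 0"
    then show "v \<in> cube n 1" unfolding iff using n by (auto simp: unit_vec_def)
  qed
  then show ?thesis by blast
qed

definition cube_vec_2 :: "nat \<Rightarrow> int \<Rightarrow> int vec" where
  "cube_vec_2 n x = vec n (\<lambda>i. if i = 0 then x else if i = 1 then 1 else 0)"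

definition cube_vec_3 :: "nat \<Rightarrow> int \<Rightarrow> int \<Rightarrow> int vec" where
  "cube_vec_3 n x y = vec n (\<lambda>i. if i = 0 then x else if i = 1 then y else if i = 2 then 1 else 0)"

lemma cube_2: "2 \<le> n \<Longrightarrow> cube n 2 = {cube_vec_2 n 0, cube_vec_2 n 1}"
proof -
  assume n: "2 \<le> n"
  have iff: "v \<in> cube n 2 \<longleftrightarrow> v \<in> carrier_vec n \<and> v $ 1 = 1 \<and> v $ 0 \<in> {0, 1} \<and> (\<forall>i. 2 \<le> i \<and> i < n \<longrightarrow> v $ i = 0)" for v
    using cube_iff[OF _ n, of v] by (auto simp: less_Suc_eq)
  have "v \<in> cube n 2 \<longleftrightarrow> v \<in> {cube_vec_2 n 0, cube_vec_2 n 1}" for v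
  proof
    assume v: "v \<in> cube n 2"
    have "v = cube_vec_2 n (v $ 0)"
    proof (rule eq_vecI)
      fix i assume "i < dim_vec (cube_vec_2 n (v $ 0))"
      then have i: "i < n" by (simp add: cube_vec_2_def)
      consider "i = 0" | "i = 1" | "2 \<le> i" by linarith
      then show "v $ i = cube_vec_2 n (v $ 0) $ i"
        using v i unfolding iff by cases (auto simp: cube_vec_2_def)
    qed (use v in \<open>auto simp: iff cube_vec_2_def\<close>)
    moreover have "v $ 0 = 0 \<or> v $ 0 = 1" using v unfolding iff by blast
    ultimately show "v \<in> {cube_vec_2 n 0, cube_vec_2 n 1}" by (metis insertCI)
  next
    assume "v \<in> {cube_vec_2 n 0, cube_vec_2 n 1}"
    then show "v \<in> cube n 2" unfolding iff using n by (auto simp: cube_vec_2_def)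
  qed
  then show ?thesis by blast
qed

lemma cube_3: "3 \<le> n \<Longrightarrow> cube n 3 = {cube_vec_3 n 0 0, cube_vec_3 n 0 1, cube_vec_3 n 1 0, cube_vec_3 n 1 1}"
proof -
  assume n: "3 \<le> n"
  have iff: "v \<in> cube n 3 \<longleftrightarrow> v \<in> carrier_vec n \<and> v $ 2 = 1 \<and> v $ 0 \<in> {0, 1} \<and> v $ 1 \<in> {0, 1} \<and> (\<forall>i. 3 \<le> i \<and> i < n \<longrightarrow> v $ i = 0)" for v
    using cube_iff[OF _ n, of v] by (auto simp: less_Suc_eq numeral_2_eq_2)
  have "v \<in> cube n 3 \<longleftrightarrow> v \<in> {cube_vec_3 n 0 0, cube_vec_3 n 0 1, cube_vec_3 n 1 0, cube_vec_3 n 1 1}" for v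
  proof
    assume v: "v \<in> cube n 3"
    have "v = cube_vec_3 n (v $ 0) (v $ 1)"
    proof (rule eq_vecI)
      fix i assume "i < dim_vec (cube_vec_3 n (v $ 0) (v $ 1))"
      then have i: "i < n" by (simp add: cube_vec_3_def)
      consider "i = 0" | "i = 1" | "i = 2" | "3 \<le> i" by linarith
      then show "v $ i = cube_vec_3 n (v $ 0) (v $ 1) $ i"
        using v i unfolding iff by cases (auto simp: cube_vec_3_def)
    qed (use v in \<open>auto simp: iff cube_vec_3_def\<close>)
    moreover have "v $ 0 = 0 \<or> v $ 0 = 1" "v $ 1 = 0 \<or> v $ 1 = 1" using v unfolding iff by blast+
    ultimately show "v \<in> {cube_vec_3 n 0 0, cube_vec_3 n 0 1, cube_vec_3 n 1 0, cube_vec_3 n 1 1}"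
      by (metis insertCI)
  next
    assume "v \<in> {cube_vec_3 n 0 0, cube_vec_3 n 0 1, cube_vec_3 n 1 0, cube_vec_3 n 1 1}"
    then show "v \<in> cube n 3" unfolding iff using n by (auto simp: cube_vec_3_def)
  qed
  then show ?thesis by blast
qed

lemma cube_vec_distinct:
  "2 \<le> n \<Longrightarrow> cube_vec_2 n 0 \<noteq> cube_vec_2 n 1"
  "3 \<le> n \<Longrightarrow> (x, y) \<noteq> (x', y') \<Longrightarrow> cube_vec_3 n x y \<noteq> cube_vec_3 n x' y'"
proof -
  show "cube_vec_2 n 0 \<noteq> cube_vec_2 n 1" if "2 \<le> n"
  proof
    assume "cube_vec_2 n 0 = cube_vec_2 n 1"
    then have "cube_vec_2 n 0 $ 0 = cube_vec_2 n 1 $ 0" by simp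
    then show False using that by (simp add: cube_vec_2_def)
  qed
  show "cube_vec_3 n x y \<noteq> cube_vec_3 n x' y'" if "3 \<le> n" "(x, y) \<noteq> (x', y')"
  proof
    assume "cube_vec_3 n x y = cube_vec_3 n x' y'"
    then have "cube_vec_3 n x y $ 0 = cube_vec_3 n x' y' $ 0" "cube_vec_3 n x y $ 1 = cube_vec_3 n x' y' $ 1" by simp_all
    then show False using that by (simp add: cube_vec_3_def)
  qed
qed

lemma all_nat_iff: "(\<forall>i. P i) \<longleftrightarrow> P 0 \<and> (\<forall>i. P (Suc i))"
  by (metis nat.exhaust)

context contraction_setting
begin

abbreviation C\<^sub>s :: "int vec set" where "C\<^sub>s \<equiv> cube (m - 1) (k - 1)"

lemma dep_iff:
  assumes "C \<subseteq> M"
  shows "H.dep_mod_e C \<longleftrightarrow> (\<exists>c. (\<exists>b\<in>C. c b \<noteq> 0) \<and> (\<forall>i<m - 1. (\<Sum>b\<in>C. c b * real_of_int (b $ i)) = 0))"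
proof -
  have "(\<Sum>b\<in>C. fscale (c b) (l b)) = fscale \<phi> e \<longleftrightarrow>
      \<phi> = (\<Sum>b\<in>C. c b * of_int (lo b)) \<and> (\<forall>i<m - 1. (\<Sum>b\<in>C. c b * real_of_int (b $ i)) = 0)" for c \<phi>
  proof -
    have 0: "(\<Sum>b\<in>C. fscale (c b) (l b)) 0 = (\<Sum>b\<in>C. c b * of_int (lo b))"
      by (simp add: fun_sum_apply l_0)
    have S: "(\<Sum>b\<in>C. fscale (c b) (l b)) (Suc i) =
        (if i < m - 1 then (\<Sum>b\<in>C. c b * real_of_int (b $ i)) else 0)" for i
    proof -
      have "(\<Sum>b\<in>C. c b * real_fun b i) = (\<Sum>b\<in>C. c b * (if i < m - 1 then real_of_int (b $ i) else 0))"
        by (rule sum.cong) (use assms real_fun_apply[OF M_carrier] in auto)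
      then show ?thesis by (simp add: fun_sum_apply l_Suc)
    qed
    have "(\<Sum>b\<in>C. fscale (c b) (l b)) = fscale \<phi> e \<longleftrightarrow>
        (\<forall>i. (\<Sum>b\<in>C. fscale (c b) (l b)) i = fscale \<phi> e i)" by (rule fun_eq_iff)
    also have "\<dots> \<longleftrightarrow> (\<Sum>b\<in>C. fscale (c b) (l b)) 0 = fscale \<phi> e 0 \<and>
        (\<forall>i. (\<Sum>b\<in>C. fscale (c b) (l b)) (Suc i) = fscale \<phi> e (Suc i))"
      by (rule all_nat_iff)
    finally show ?thesis unfolding 0 S e_0 e_Suc by auto
  qed
  then show ?thesis unfolding H.dep_mod_e_def by auto
qed

lemma dep_iff_lin_dependent: "C \<subseteq> M \<Longrightarrow> H.dep_mod_e C \<longleftrightarrow> lin_dependent (m - 1) C"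
  using dep_iff lin_dependent_iff[of C "m - 1"] M_carrier finite_M finite_subset[of C M] by blast

lemma circ_iff_circuit: "C \<subseteq> M \<Longrightarrow> H.circ_mod_e C \<longleftrightarrow> circuit (m - 1) C"
  unfolding H.circ_mod_e_def circuit_def using dep_iff_lin_dependent by (metis psubset_imp_subset subset_trans)

lemma k1: "1 \<le> k - 1" "k - 1 \<le> m - 1"
  using k_ge_2 k_le_m by auto

lemma in_span_iff_cube:
  assumes b: "b \<in> M"
  shows "l b \<in> fs.span B \<longleftrightarrow> b \<in> C\<^sub>s"
proof
  assume "l b \<in> fs.span B"
  then have c: "vCons (lo b) b \<in> cube m k" by (rule lift_in_cube[OF b])
  have k0: "1 \<le> k" using k_ge_2 by simp
  have tail: "b $ i = vCons (lo b) b $ (Suc i)" for i by (simp add: vec_index_vCons)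
  show "b \<in> C\<^sub>s"
    unfolding cube_iff[OF k1]
  proof (intro conjI allI impI)
    show "b \<in> carrier_vec (m - 1)" by (rule M_carrier[OF b])
    have "Suc (k - 1 - 1) = k - 1" using k_ge_2 by simp
    then show "b $ (k - 1 - 1) = 1" unfolding tail using c cube_iff[OF k0 k_le_m] by simp
    show "b $ i \<in> {0, 1}" if "i < k - 1 - 1" for i
      unfolding tail using c that unfolding cube_iff[OF k0 k_le_m] by (metis less_diff_conv Suc_eq_plus1)
    show "b $ i = 0" if "k - 1 \<le> i \<and> i < m - 1" for i
    proof -
      have "k \<le> Suc i" "Suc i < m" using that by auto
      then show ?thesis unfolding tail using c unfolding cube_iff[OF k0 k_le_m] by blast
    qed
  qed
next
  assume c: "b \<in> C\<^sub>s"
  have "vCons (lo b) b \<in> carrier_vec m" using M_carrier[OF b] m_eq by (metis vCons_carrier_vec)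
  moreover have "vCons (lo b) b $ i = 0" if "k \<le> i" "i < m" for i
  proof -
    have i: "k - 1 \<le> i - 1" "i - 1 < m - 1" "i \<noteq> 0" using that k_ge_2 by auto
    then have "b $ (i - 1) = 0" using c unfolding cube_iff[OF k1] by blast
    then show ?thesis using i(3) by (simp add: vec_index_vCons)
  qed
  ultimately show "l b \<in> fs.span B" unfolding l_def by (rule B_coords(2))
qed

lemma tail_equation:
  assumes "b' \<in> M" "b \<in> M" "u \<in> M" "u' \<in> M" "i < m - 1"
    and eq: "l b' = fscale (of_int x) (l b) + fscale (of_int y) (l u) + fscale (of_int z) (l u') + fscale \<phi> e"
  shows "b' $ i = x * b $ i + y * u $ i + z * u' $ i"
proof -
  have "real_fun b' i = of_int x * real_fun b i + of_int y * real_fun u i + of_int z * real_fun u' i"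
    using fun_cong[OF eq, of "Suc i"] by (simp add: l_Suc e_Suc)
  then have "real_of_int (b' $ i) = of_int (x * b $ i + y * u $ i + z * u' $ i)"
    using assms(5) by (simp add: real_fun_apply[OF M_carrier[OF assms(1)]] real_fun_apply[OF M_carrier[OF assms(2)]]
        real_fun_apply[OF M_carrier[OF assms(3)]] real_fun_apply[OF M_carrier[OF assms(4)]])
  then show ?thesis by (simp only: of_int_eq_iff)
qed

definition triple_circuit :: "int vec set \<Rightarrow> bool" where
  "triple_circuit C \<longleftrightarrow> (\<exists>b b' u \<sigma> \<tau>. C = {b, b', u} \<and> b \<notin> C\<^sub>s \<and> b' \<notin> C\<^sub>s \<and> u \<in> C\<^sub>s \<and> b \<noteq> b' \<and>
     \<bar>\<sigma>\<bar> = 1 \<and> \<bar>\<tau>\<bar> = 1 \<and> (\<forall>i<m - 1. b' $ i = \<sigma> * b $ i + \<tau> * (2 * u $ i)))"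

definition quadruple_circuit :: "(int vec \<Rightarrow> int vec) \<Rightarrow> int vec set \<Rightarrow> bool" where
  "quadruple_circuit cls C \<longleftrightarrow> (\<exists>b b' u u' \<sigma> \<tau> \<tau>'. C = {b, b', u, u'} \<and>
     b \<notin> C\<^sub>s \<and> b' \<notin> C\<^sub>s \<and> u \<in> C\<^sub>s \<and> u' \<in> C\<^sub>s \<and> b \<noteq> b' \<and> u \<noteq> u' \<and> cls b = cls b' \<and>
     \<bar>\<sigma>\<bar> = 1 \<and> \<bar>\<tau>\<bar> = 1 \<and> \<bar>\<tau>'\<bar> = 1 \<and>
     (\<forall>i<m - 1. b' $ i = \<sigma> * b $ i + \<tau> * u $ i + \<tau>' * u' $ i))"

lemma circuits_shape:
  obtains cls :: "int vec \<Rightarrow> int vec" where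
    "\<And>C. C \<subseteq> M \<Longrightarrow> H.circ_mod_e C \<Longrightarrow> C \<subseteq> C\<^sub>s \<or> k = 2 \<and> triple_circuit C \<or> quadruple_circuit cls C"
    "\<And>b b' b''. 3 \<le> k \<Longrightarrow> b \<in> M - C\<^sub>s \<Longrightarrow> b' \<in> M - C\<^sub>s \<Longrightarrow> b'' \<in> M - C\<^sub>s \<Longrightarrow>
      cls b = cls b' \<Longrightarrow> cls b' = cls b'' \<Longrightarrow> b = b' \<or> b' = b'' \<or> b = b''"
proof -
  obtain N S where NS: "H.basis S" "B \<subseteq> S" "N \<subseteq> M" "l ` N \<subseteq> S"
    "\<And>p. p \<in> N \<Longrightarrow> l p \<notin> fs.span B" "\<And>b. b \<in> M \<Longrightarrow> l b \<in> fs.span (B \<union> l ` N)"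
    by (rule H.adapted_basis_exists) (rule that; assumption)
  interpret T: adapted_basis fscale "real_fun ` set (cols A)" "real_fun ` carrier_vec m" e h B M l \<delta> N S
    by unfold_locales (fact NS)+
  show thesis
  proof (rule that[of T.cls])
    fix C assume C: "C \<subseteq> M" "H.circ_mod_e C"
    show "C \<subseteq> C\<^sub>s \<or> k = 2 \<and> triple_circuit C \<or> quadruple_circuit T.cls C"
    proof (cases "\<forall>b\<in>C. l b \<in> fs.span B")
      case True
      then show ?thesis using in_span_iff_cube C(1) by blast
    next
      case False
      show ?thesis
        using C False
      proof (cases rule: T.circuit_cases)
        case (one b b' u \<sigma> \<tau> \<phi>)
        have inM: "b \<in> M" "b' \<in> M" "u \<in> M" using one(1) C(1) by auto
        have "l b' = fscale (of_int \<sigma>) (l b) + fscale (of_int (2 * \<tau>)) (l u) + fscale (of_int 0) (l u) + fscale \<phi> e"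
          using one(9) by (simp add: fun_eq_iff)
        from tail_equation[OF inM(2,1,3,3) _ this]
        have "\<forall>i<m - 1. b' $ i = \<sigma> * b $ i + \<tau> * (2 * u $ i)" by (simp add: algebra_simps)
        moreover have "b \<notin> C\<^sub>s" "b' \<notin> C\<^sub>s" "u \<in> C\<^sub>s"
          using one(2-4) in_span_iff_cube[OF inM(1)] in_span_iff_cube[OF inM(2)] in_span_iff_cube[OF inM(3)] by auto
        moreover have "k = 2" using one(6) card_B_eq by simp
        ultimately show ?thesis using one(1,5,7,8) unfolding triple_circuit_def by blast
      next
        case (two b b' u u' \<sigma> \<tau> \<tau>' \<phi>)
        have inM: "b \<in> M" "b' \<in> M" "u \<in> M" "u' \<in> M" using two(1) C(1) by auto
        have "\<forall>i<m - 1. b' $ i = \<sigma> * b $ i + \<tau> * u $ i + \<tau>' * u' $ i"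
          using tail_equation[OF inM(2,1,3,4) _ two(12)] by blast
        moreover have "b \<notin> C\<^sub>s" "b' \<notin> C\<^sub>s" "u \<in> C\<^sub>s" "u' \<in> C\<^sub>s"
          using two(2-5) in_span_iff_cube[OF inM(1)] in_span_iff_cube[OF inM(2)] in_span_iff_cube[OF inM(3)]
            in_span_iff_cube[OF inM(4)] by auto
        ultimately show ?thesis using two(1,6-11) unfolding quadruple_circuit_def by blast
      qed
    qed
  next
    fix b b' b'' assume k3: "3 \<le> k" and b: "b \<in> M - C\<^sub>s" "b' \<in> M - C\<^sub>s" "b'' \<in> M - C\<^sub>s"
      "T.cls b = T.cls b'" "T.cls b' = T.cls b''"
    have o: "b \<in> M" "l b \<notin> fs.span B" "b' \<in> M" "l b' \<notin> fs.span B" "b'' \<in> M" "l b'' \<notin> fs.span B"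
      using b in_span_iff_cube by auto
    have "3 \<le> card B" using k3 card_B_eq by simp
    then show "b = b' \<or> b' = b'' \<or> b = b''" using T.class_size[OF _ o b(4,5)] by blast
  qed
qed

lemma dim_cols: "fs.dim (real_fun ` set (cols A)) = m"
  by (rule full_rank_dim(1)[OF bimodular_A dim_A])

lemma relation_on_cube:
  assumes C: "C \<subseteq> M" "H.dep_mod_e C" "C \<subseteq> X" "finite X"
  obtains g where "\<exists>b\<in>C. g b \<noteq> 0" "\<And>b. b \<notin> C \<Longrightarrow> g b = 0"
    "\<And>i. i < m - 1 \<Longrightarrow> (\<Sum>b\<in>X. g b * real_of_int (b $ i)) = 0"
proof -
  obtain c where c: "\<exists>b\<in>C. c b \<noteq> 0" "\<forall>i<m - 1. (\<Sum>b\<in>C. c b * real_of_int (b $ i)) = 0"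
    using C(2) dep_iff[OF C(1)] by blast
  let ?g = "\<lambda>b. if b \<in> C then c b else 0"
  have "(\<Sum>b\<in>X. ?g b * real_of_int (b $ i)) = (\<Sum>b\<in>C. c b * real_of_int (b $ i))" for i
    by (rule sum.mono_neutral_cong_right) (use C(3,4) in auto)
  then show thesis using that[of ?g] c by auto
qed

lemma unique_circuit_bound:
  assumes u: "\<And>C. C \<subseteq> M \<Longrightarrow> H.circ_mod_e C \<Longrightarrow> u \<in> C"
  shows "card M \<le> m" "C \<subseteq> M \<Longrightarrow> H.circ_mod_e C \<Longrightarrow> C' \<subseteq> M \<Longrightarrow> H.circ_mod_e C' \<Longrightarrow> C' = C"
  using H.card_M_le_if_hitting[of "{u}"] u H.unique_circuit[OF u] dim_cols by auto

lemma circuits_card_2: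
  assumes k2: "k = 2" and C: "C \<subseteq> M" "H.circ_mod_e C"
  shows "extends_by_pair (contraction A) C C\<^sub>s (2 \<cdot>\<^sub>v unit_vec (m - 1) 0)"
    and "\<And>C'. C' \<subseteq> M \<Longrightarrow> H.circ_mod_e C' \<Longrightarrow> C' = C" and "card M \<le> m"
proof -
  let ?u = "unit_vec (m - 1) 0 :: int vec"
  have Cs: "C\<^sub>s = {?u}" using cube_1[of "m - 1"] k1 k2 by simp
  have m1: "0 < m - 1" using k1 k2 by simp
  obtain cls :: "int vec \<Rightarrow> int vec" where shape: "\<And>C. C \<subseteq> M \<Longrightarrow> H.circ_mod_e C \<Longrightarrow> C \<subseteq> C\<^sub>s \<or> k = 2 \<and> triple_circuit C \<or> quadruple_circuit cls C"
    by (rule circuits_shape) (rule that; assumption)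
  have triple: "\<exists>b b' \<sigma> \<tau>. C = {b, b', ?u} \<and> b \<noteq> ?u \<and> b' \<noteq> ?u \<and> b \<noteq> b' \<and> \<bar>\<sigma>\<bar> = 1 \<and> \<bar>\<tau>\<bar> = 1 \<and>
      (\<forall>i<m - 1. b' $ i = \<sigma> * b $ i + \<tau> * (2 * ?u $ i))" if C: "C \<subseteq> M" "H.circ_mod_e C" for C
  proof -
    have "\<not> C \<subseteq> C\<^sub>s"
    proof
      assume sub: "C \<subseteq> C\<^sub>s"
      obtain g where g: "\<exists>b\<in>C. g b \<noteq> 0" "\<And>b. b \<notin> C \<Longrightarrow> g b = 0"
        "\<And>i. i < m - 1 \<Longrightarrow> (\<Sum>b\<in>{?u}. g b * real_of_int (b $ i)) = 0"
        using relation_on_cube[of C "{?u}"] C sub Cs by (auto simp: H.circ_mod_e_def)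
      have "g ?u = 0" using g(3)[OF m1] m1 by simp
      then show False using g(1) sub Cs by auto
    qed
    moreover have "\<not> quadruple_circuit cls C" unfolding quadruple_circuit_def Cs by blast
    ultimately have "triple_circuit C" using shape[OF C] by blast
    then show ?thesis unfolding triple_circuit_def Cs by blast
  qed
  have mem: "?u \<in> C" if "C \<subseteq> M" "H.circ_mod_e C" for C using triple[OF that] by blast
  show "card M \<le> m" "\<And>C'. C' \<subseteq> M \<Longrightarrow> H.circ_mod_e C' \<Longrightarrow> C' = C"
    using unique_circuit_bound[of ?u] mem C by blast+
  obtain b b' \<sigma> \<tau> where c: "C = {b, b', ?u}" "b \<noteq> ?u" "b' \<noteq> ?u" "b \<noteq> b'" "\<bar>\<sigma>\<bar> = 1" "\<bar>\<tau>\<bar> = 1"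
    "\<And>i. i < m - 1 \<Longrightarrow> b' $ i = \<sigma> * b $ i + \<tau> * (2 * ?u $ i)"
    using triple[OF C] by blast
  have inM: "b \<in> M" "b' \<in> M" using c(1) C(1) by auto
  show "extends_by_pair (contraction A) C C\<^sub>s (2 \<cdot>\<^sub>v ?u)"
  proof (rule extends_by_pairI)
    show "C = insert b (insert b' C\<^sub>s)" using c(1) Cs by blast
    show "b' $ i = \<sigma> * b $ i + \<tau> * (2 \<cdot>\<^sub>v ?u) $ i" if "i < m - 1" for i using c(7)[OF that] that by simp
    show "b \<in> contraction A" using inM by (simp add: multiple_fibers_def)
  qed (use c inM M_carrier Cs in auto)
qed

text \<open>
The sum and the difference of the two vectors of \<open>C\<^sup>*\<close> are, up to sign, the two vectors of \<open>D\<^sup>*\<close>.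
\<close>

lemma circuits_card_3:
  assumes k3: "k = 3" and C: "C \<subseteq> M" "H.circ_mod_e C"
  shows "\<exists>d \<in> half_basis (m - 1) (k - 1). extends_by_pair (contraction A) C C\<^sub>s d"
    and "\<And>C'. C' \<subseteq> M \<Longrightarrow> H.circ_mod_e C' \<Longrightarrow> C' = C" and "card M \<le> m"
proof -
  let ?n = "m - 1"
  let ?u = "cube_vec_2 ?n 0" and ?v = "cube_vec_2 ?n 1"
  have n2: "2 \<le> ?n" using k1 k3 by simp
  have Cs: "C\<^sub>s = {?u, ?v}" using cube_2[OF n2] k3 by simp
  have uv: "?u \<noteq> ?v" by (rule cube_vec_distinct(1)[OF n2])
  obtain cls :: "int vec \<Rightarrow> int vec" where shape: "\<And>C. C \<subseteq> M \<Longrightarrow> H.circ_mod_e C \<Longrightarrow> C \<subseteq> C\<^sub>s \<or> k = 2 \<and> triple_circuit C \<or> quadruple_circuit cls C"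
    by (rule circuits_shape) (rule that; assumption)
  have quad: "\<exists>b b' \<sigma> \<tau> \<tau>'. C = {b, b', ?u, ?v} \<and> b \<notin> C\<^sub>s \<and> b' \<notin> C\<^sub>s \<and> b \<noteq> b' \<and> \<bar>\<sigma>\<bar> = 1 \<and> \<bar>\<tau>\<bar> = 1 \<and> \<bar>\<tau>'\<bar> = 1 \<and>
      (\<forall>i<?n. b' $ i = \<sigma> * b $ i + \<tau> * ?u $ i + \<tau>' * ?v $ i)" if C: "C \<subseteq> M" "H.circ_mod_e C" for C
  proof -
    have "\<not> C \<subseteq> C\<^sub>s"
    proof
      assume sub: "C \<subseteq> C\<^sub>s"
      obtain g where g: "\<exists>b\<in>C. g b \<noteq> 0" "\<And>b. b \<notin> C \<Longrightarrow> g b = 0"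
        "\<And>i. i < ?n \<Longrightarrow> (\<Sum>b\<in>{?u, ?v}. g b * real_of_int (b $ i)) = 0"
        using relation_on_cube[of C "{?u, ?v}"] C sub Cs by (auto simp: H.circ_mod_e_def)
      have "g ?v = 0" using g(3)[of 0] n2 uv by (simp add: cube_vec_2_def)
      moreover have "g ?u + g ?v = 0" using g(3)[of 1] n2 uv by (simp add: cube_vec_2_def)
      ultimately show False using g(1) sub Cs by auto
    qed
    then have "quadruple_circuit cls C" using shape[OF C] k3 by auto
    then obtain b b' u u' \<sigma> \<tau> \<tau>' where c: "C = {b, b', u, u'}" "b \<notin> C\<^sub>s" "b' \<notin> C\<^sub>s" "u \<in> C\<^sub>s" "u' \<in> C\<^sub>s"
      "b \<noteq> b'" "u \<noteq> u'" "\<bar>\<sigma>\<bar> = 1" "\<bar>\<tau>\<bar> = 1" "\<bar>\<tau>'\<bar> = 1"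
      "\<forall>i<?n. b' $ i = \<sigma> * b $ i + \<tau> * u $ i + \<tau>' * u' $ i"
      unfolding quadruple_circuit_def by blast
    then consider "u = ?u" "u' = ?v" | "u = ?v" "u' = ?u" unfolding Cs by blast
    then show ?thesis
    proof cases
      case 1
      then show ?thesis using c by blast
    next
      case 2
      then have "C = {b, b', ?u, ?v}" using c(1) by blast
      moreover have "\<forall>i<?n. b' $ i = \<sigma> * b $ i + \<tau>' * ?u $ i + \<tau> * ?v $ i" using c(11) 2 by simp
      ultimately show ?thesis using c(2,3,6,8-10) by blast
    qed
  qed
  have mem: "?u \<in> C" if "C \<subseteq> M" "H.circ_mod_e C" for C using quad[OF that] by blast
  show "card M \<le> m" "\<And>C'. C' \<subseteq> M \<Longrightarrow> H.circ_mod_e C' \<Longrightarrow> C' = C"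
    using unique_circuit_bound[of ?u] mem C by blast+
  obtain b b' \<sigma> \<tau> \<tau>' where c: "C = {b, b', ?u, ?v}" "b \<notin> C\<^sub>s" "b' \<notin> C\<^sub>s" "b \<noteq> b'" "\<bar>\<sigma>\<bar> = 1" "\<bar>\<tau>\<bar> = 1" "\<bar>\<tau>'\<bar> = 1"
    "\<forall>i<?n. b' $ i = \<sigma> * b $ i + \<tau> * ?u $ i + \<tau>' * ?v $ i"
    using quad[OF C] by blast
  have inM: "b \<in> M" "b' \<in> M" using c(1) C(1) by auto
  have ext: "extends_by_pair (contraction A) C C\<^sub>s d"
    if d: "d \<in> carrier_vec ?n" "\<And>i. i < ?n \<Longrightarrow> \<tau> * ?u $ i + \<tau>' * ?v $ i = \<tau>' * d $ i" for d
  proof (rule extends_by_pairI)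
    show "C = insert b (insert b' C\<^sub>s)" using c(1) Cs by blast
    show "b' $ i = \<sigma> * b $ i + \<tau>' * d $ i" if "i < ?n" for i
      using c(8) d(2)[OF that] that by (metis add.assoc)
    show "b \<in> contraction A" using inM by (simp add: multiple_fibers_def)
  qed (use c d inM M_carrier Cs in auto)
  have hb: "half_basis ?n (k - 1) = half_basis_vec ?n 2 ` {..<2}"
    using half_basis_eq[of 2 ?n] n2 k3 by simp
  have "\<tau> = \<tau>' \<or> \<tau> = - \<tau>'" using c(6,7) by linarith
  then show "\<exists>d \<in> half_basis ?n (k - 1). extends_by_pair (contraction A) C C\<^sub>s d"
  proof
    assume \<tau>: "\<tau> = \<tau>'"
    have "extends_by_pair (contraction A) C C\<^sub>s (half_basis_vec ?n 2 1)"
      by (rule ext) (use \<tau> in \<open>auto simp: half_basis_vec_def cube_vec_2_def\<close>)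
    moreover have "half_basis_vec ?n 2 1 \<in> half_basis ?n (k - 1)" unfolding hb by simp
    ultimately show ?thesis by (rule bexI)
  next
    assume \<tau>: "\<tau> = - \<tau>'"
    have "extends_by_pair (contraction A) C C\<^sub>s (half_basis_vec ?n 2 0)"
      by (rule ext) (use \<tau> in \<open>auto simp: half_basis_vec_def cube_vec_2_def\<close>)
    moreover have "half_basis_vec ?n 2 0 \<in> half_basis ?n (k - 1)" unfolding hb by simp
    ultimately show ?thesis by (rule bexI)
  qed
qed

text \<open>
The vectors of \<open>C\<^sup>*\<close> satisfy, up to scalar factors, a single linear relation: opposite vertices of the
square \<open>C\<^sup>*\<close> have the same sum. So \<open>C\<^sup>*\<close> itself is the only possible circuit inside \<open>C\<^sup>*\<close>.
\<close>

lemma circuits_card_4: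
  assumes k4: "k = 4" and C: "C \<subseteq> M" "H.circ_mod_e C"
  shows "C = C\<^sub>s \<or> card (C \<inter> C\<^sub>s) = 2 \<and> card C = 4"
    and "C' \<subseteq> M \<Longrightarrow> H.circ_mod_e C' \<Longrightarrow> C' \<noteq> C \<Longrightarrow> C \<noteq> C\<^sub>s \<Longrightarrow>
      {D. D \<subseteq> M \<and> H.circ_mod_e D} = {C, C\<^sub>s, sym_diff C C\<^sub>s} \<and> card {D. D \<subseteq> M \<and> H.circ_mod_e D} = 3"
    and "card M \<le> m + 1"
proof -
  let ?n = "m - 1"
  let ?v = "cube_vec_3 ?n"
  have n3: "3 \<le> ?n" using k1 k4 by simp
  have Cs: "C\<^sub>s = {?v 0 0, ?v 0 1, ?v 1 0, ?v 1 1}" using cube_3[OF n3] k4 by simp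
  have ne: "?v 0 0 \<noteq> ?v 0 1" "?v 0 0 \<noteq> ?v 1 0" "?v 0 0 \<noteq> ?v 1 1" "?v 0 1 \<noteq> ?v 1 0" "?v 0 1 \<noteq> ?v 1 1" "?v 1 0 \<noteq> ?v 1 1"
    by (rule cube_vec_distinct(2)[OF n3], simp)+
  have card4: "card C\<^sub>s = 4" unfolding Cs using ne by simp
  obtain cls :: "int vec \<Rightarrow> int vec" where shape: "\<And>C. C \<subseteq> M \<Longrightarrow> H.circ_mod_e C \<Longrightarrow> C \<subseteq> C\<^sub>s \<or> k = 2 \<and> triple_circuit C \<or> quadruple_circuit cls C"
    and classes: "\<And>b b' b''. 3 \<le> k \<Longrightarrow> b \<in> M - C\<^sub>s \<Longrightarrow> b' \<in> M - C\<^sub>s \<Longrightarrow> b'' \<in> M - C\<^sub>s \<Longrightarrow>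
      cls b = cls b' \<Longrightarrow> cls b' = cls b'' \<Longrightarrow> b = b' \<or> b' = b'' \<or> b = b''"
    by (rule circuits_shape) (rule that; assumption)
  have sum4: "(\<Sum>b\<in>C\<^sub>s. f b) = f (?v 0 0) + f (?v 0 1) + f (?v 1 0) + f (?v 1 1)" for f :: "int vec \<Rightarrow> real"
    unfolding Cs using ne by simp
  have inside: "C = C\<^sub>s" if C: "C \<subseteq> M" "H.circ_mod_e C" "C \<subseteq> C\<^sub>s" for C
  proof -
    have "finite C\<^sub>s" using Cs by simp
    then obtain g where g: "\<exists>b\<in>C. g b \<noteq> 0" "\<And>b. b \<notin> C \<Longrightarrow> g b = 0"
      "\<And>i. i < ?n \<Longrightarrow> (\<Sum>b\<in>C\<^sub>s. g b * real_of_int (b $ i)) = 0"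
      using relation_on_cube[of C "C\<^sub>s"] C by (auto simp: H.circ_mod_e_def)
    have "g (?v 1 0) + g (?v 1 1) = 0" using g(3)[of 0] n3 unfolding sum4 by (simp add: cube_vec_3_def)
    moreover have "g (?v 0 1) + g (?v 1 1) = 0" using g(3)[of 1] n3 unfolding sum4 by (simp add: cube_vec_3_def)
    moreover have "g (?v 0 0) + g (?v 0 1) + g (?v 1 0) + g (?v 1 1) = 0"
      using g(3)[of 2] n3 unfolding sum4 by (simp add: cube_vec_3_def)
    ultimately have eqs: "g (?v 1 0) = - g (?v 1 1)" "g (?v 0 1) = - g (?v 1 1)" "g (?v 0 0) = g (?v 1 1)"
      by linarith+
    have "g (?v 1 1) \<noteq> 0" using g(1) C(3) eqs unfolding Cs by auto
    then have "g b \<noteq> 0" if "b \<in> C\<^sub>s" for b using that eqs unfolding Cs by auto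
    then have "C\<^sub>s \<subseteq> C" using g(2) by blast
    then show ?thesis using C(3) by blast
  qed
  have dep_Cs: "H.dep_mod_e C\<^sub>s" if "C\<^sub>s \<subseteq> M"
  proof -
    define g :: "int vec \<Rightarrow> real" where "g b = (if b \<in> {?v 0 0, ?v 1 1} then 1 else -1)" for b
    have g: "g (?v 0 0) = 1" "g (?v 1 1) = 1" "g (?v 0 1) = -1" "g (?v 1 0) = -1" using ne by (auto simp: g_def)
    have "(\<Sum>b\<in>C\<^sub>s. g b * real_of_int (b $ i)) = 0" if "i < ?n" for i
      unfolding sum4 g using that by (simp add: cube_vec_3_def)
    moreover have "\<exists>b\<in>C\<^sub>s. g b \<noteq> 0" unfolding Cs using g by simp
    ultimately show ?thesis using dep_iff[OF that] by blast
  qed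
  have circ_Cs: "H.circ_mod_e C\<^sub>s" if sub: "C\<^sub>s \<subseteq> M"
  proof -
    have "finite C\<^sub>s" using Cs by simp
    then obtain D where "D \<subseteq> C\<^sub>s" "H.circ_mod_e D" using H.dep_contains_circ dep_Cs[OF sub] by blast
    then show ?thesis using inside[of D] sub by blast
  qed
  let ?F = "\<lambda>D. D \<subseteq> M \<and> H.circ_mod_e D"
  have mixed: "\<exists>b b' u u'. D = {b, b', u, u'} \<and> b \<notin> C\<^sub>s \<and> b' \<notin> C\<^sub>s \<and> u \<in> C\<^sub>s \<and> u' \<in> C\<^sub>s \<and>
      b \<noteq> b' \<and> u \<noteq> u' \<and> cls b = cls b'" if D: "?F D" "D \<noteq> C\<^sub>s" for D
  proof -
    have "quadruple_circuit cls D" using shape[of D] D inside[of D] k4 by auto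
    then show ?thesis unfolding quadruple_circuit_def by blast
  qed
  have parts: "\<exists>b b'. D - C\<^sub>s = {b, b'} \<and> b \<noteq> b' \<and> cls b = cls b' \<and> card (D \<inter> C\<^sub>s) = 2 \<and> card D = 4"
    if D: "?F D" "D \<noteq> C\<^sub>s" for D
  proof -
    obtain b b' u u' where d: "D = {b, b', u, u'}" "b \<notin> C\<^sub>s" "b' \<notin> C\<^sub>s" "u \<in> C\<^sub>s" "u' \<in> C\<^sub>s"
      "b \<noteq> b'" "u \<noteq> u'" "cls b = cls b'"
      using mixed[OF D] by blast
    have "D - C\<^sub>s = {b, b'}" "D \<inter> C\<^sub>s = {u, u'}" using d by auto
    moreover have "card D = 4" using d by (auto simp: card_insert_if)
    ultimately show ?thesis using d(6-8) by auto
  qed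
  interpret Q: circuits_meeting_quadruple ?F C\<^sub>s
  proof
    show "finite D" if "?F D" for D using that finite_M finite_subset by blast
    show "\<exists>D. ?F D \<and> D \<subseteq> C \<union> C' - {x}"
      if F: "?F C" "?F C'" "C \<noteq> C'" "x \<in> C" "x \<in> C'" for C C' x
    proof -
      have "finite C" "finite C'" using F finite_M finite_subset by blast+
      then obtain D where "H.circ_mod_e D" "D \<subseteq> C \<union> C' - {x}"
        using H.circ_elim[of C C' x] F by blast
      then show ?thesis using F by blast
    qed
    show "card C\<^sub>s = 4" by (rule card4)
    show "?F C\<^sub>s" if "C\<^sub>s \<subseteq> C \<union> C'" "?F C" "?F C'" for C C'
      using circ_Cs that by blast
    show "card (D \<inter> C\<^sub>s) = 2 \<and> card (D - C\<^sub>s) = 2" if "?F D" "D \<noteq> C\<^sub>s" for D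
      using parts[OF that] by auto
    show "C - C\<^sub>s = C' - C\<^sub>s" if F: "?F C" "?F C'" "b \<in> C - C\<^sub>s" "b \<in> C' - C\<^sub>s" for C C' b
    proof -
      have ne: "C \<noteq> C\<^sub>s" "C' \<noteq> C\<^sub>s" using F by auto
      have partner: "\<exists>d. D - C\<^sub>s = {b, d} \<and> d \<noteq> b \<and> cls d = cls b"
        if D: "?F D" "D \<noteq> C\<^sub>s" "b \<in> D - C\<^sub>s" for D
      proof -
        obtain x y where xy: "D - C\<^sub>s = {x, y}" "x \<noteq> y" "cls x = cls y"
          using parts[OF D(1,2)] by blast
        then consider "b = x" | "b = y" using D(3) by blast
        then show ?thesis
        proof cases
          case 1
          then show ?thesis using xy by (intro exI[of _ y]) auto
        next
          case 2
          then show ?thesis using xy by (intro exI[of _ x]) auto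
        qed
      qed
      obtain d where d: "C - C\<^sub>s = {b, d}" "d \<noteq> b" "cls d = cls b"
        using partner[OF F(1) ne(1) F(3)] by blast
      obtain d' where d': "C' - C\<^sub>s = {b, d'}" "d' \<noteq> b" "cls d' = cls b"
        using partner[OF F(2) ne(2) F(4)] by blast
      have "d \<in> C - C\<^sub>s" unfolding d(1) by simp
      moreover have "d' \<in> C' - C\<^sub>s" unfolding d'(1) by simp
      ultimately have inM: "d \<in> M - C\<^sub>s" "b \<in> M - C\<^sub>s" "d' \<in> M - C\<^sub>s" using F(1-3) by auto
      have k3: "3 \<le> k" using k4 by simp
      have "d = b \<or> b = d' \<or> d = d'"
        using classes[OF k3 inM d(3)] d'(3) by simp
      then have "d = d'" using d(2) d'(2) by auto
      then show ?thesis using d(1) d'(1) by simp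
    qed
  qed
  have FC: "?F C" using C by simp
  show "C = C\<^sub>s \<or> card (C \<inter> C\<^sub>s) = 2 \<and> card C = 4" using parts[OF FC] by blast
  show "{D. D \<subseteq> M \<and> H.circ_mod_e D} = {C, C\<^sub>s, sym_diff C C\<^sub>s} \<and> card {D. D \<subseteq> M \<and> H.circ_mod_e D} = 3"
    if "C' \<subseteq> M" "H.circ_mod_e C'" "C' \<noteq> C" "C \<noteq> C\<^sub>s"
    using Q.three_circuits[OF FC that(4), of C'] that by blast
  obtain X where X: "finite X" "card X \<le> 2" "\<And>D. ?F D \<Longrightarrow> D \<inter> X \<noteq> {}"
    using Q.hitting_pair[OF FC] by blast
  have "card M + 1 \<le> m + card X"
    using H.card_M_le_if_hitting[OF X(1)] X(3) dim_cols by auto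
  then show "card M \<le> m + 1" using X(2) by linarith
qed

end

theorem lemma7:
  fixes m k :: nat and A :: "int mat" and B\<^sub>s C\<^sub>1 C\<^sub>s D\<^sub>s M :: "int vec set"
  assumes "dim_row A = m"
    and "maximal_bimodular A"
    and "unit_vec m 0 \<in> set (cols A)"
    and "aligned_signs A"
    and "\<forall>a \<in> set (cols A). primitive a"
    and M: "M = multiple_fibers A"
    and "C\<^sub>1 \<subseteq> M" and "circuit (m - 1) C\<^sub>1"
    and "min_half_integral_indep A B\<^sub>s"
    and k: "k = card B\<^sub>s"
    and "B\<^sub>s = half_basis m k"
    and "\<forall>a \<in> set (cols A). in_span m a B\<^sub>s \<longrightarrow> a \<in> B\<^sub>s \<union> cube m k"
    and Cs: "C\<^sub>s = cube (m - 1) (k - 1)"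
    and Ds: "D\<^sub>s = half_basis (m - 1) (k - 1)"
  shows
    "(k = 2 \<longrightarrow>
        extends_by_pair (contraction A) C\<^sub>1 C\<^sub>s (2 \<cdot>\<^sub>v unit_vec (m - 1) 0) \<and>
        (\<forall>C \<subseteq> M. circuit (m - 1) C \<longrightarrow> C = C\<^sub>1) \<and>
        card M \<le> m) \<and>
     (k = 3 \<longrightarrow>
        (\<exists>d \<in> D\<^sub>s. extends_by_pair (contraction A) C\<^sub>1 C\<^sub>s d) \<and>
        (\<forall>C \<subseteq> M. circuit (m - 1) C \<longrightarrow> C = C\<^sub>1) \<and>
        card M \<le> m) \<and>
     (k = 4 \<longrightarrow>
        (C\<^sub>1 = C\<^sub>s \<or> card (C\<^sub>1 \<inter> C\<^sub>s) = 2 \<and> card C\<^sub>1 = 4) \<and>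
        ((\<exists>C \<subseteq> M. circuit (m - 1) C \<and> C \<noteq> C\<^sub>1) \<and> C\<^sub>1 \<noteq> C\<^sub>s \<longrightarrow>
           {C. C \<subseteq> M \<and> circuit (m - 1) C} = {C\<^sub>1, C\<^sub>s, sym_diff C\<^sub>1 C\<^sub>s} \<and>
           card {C. C \<subseteq> M \<and> circuit (m - 1) C} = 3) \<and>
        card M \<le> m + 1)"
proof (cases "2 \<le> k")
  case False
  then have "k \<noteq> 2" "k \<noteq> 3" "k \<noteq> 4" by simp_all
  then show ?thesis by (simp only: simp_thms)
next
  case True
  interpret S: contraction_setting m k A B\<^sub>s
  proof
    show "bimodular A" using assms(2) by (simp add: maximal_bimodular_def)
  qed (fact assms True)+
  have C1: "C\<^sub>1 \<subseteq> multiple_fibers A" "S.H.circ_mod_e C\<^sub>1"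
    using assms(7,8) M S.circ_iff_circuit by auto
  have fam: "{C. C \<subseteq> multiple_fibers A \<and> circuit (m - 1) C} = {C. C \<subseteq> multiple_fibers A \<and> S.H.circ_mod_e C}"
    using S.circ_iff_circuit by blast
  show ?thesis
  proof (intro conjI impI)
    assume k2: "k = 2"
    note * = S.circuits_card_2[OF k2 C1]
    show "extends_by_pair (contraction A) C\<^sub>1 C\<^sub>s (2 \<cdot>\<^sub>v unit_vec (m - 1) 0)" using *(1) Cs by simp
    show "\<forall>C \<subseteq> M. circuit (m - 1) C \<longrightarrow> C = C\<^sub>1" using *(2) M S.circ_iff_circuit by blast
    show "card M \<le> m" using *(3) M by simp
  next
    assume k3: "k = 3"
    note * = S.circuits_card_3[OF k3 C1]
    show "\<exists>d \<in> D\<^sub>s. extends_by_pair (contraction A) C\<^sub>1 C\<^sub>s d" using *(1) Cs Ds by simp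
    show "\<forall>C \<subseteq> M. circuit (m - 1) C \<longrightarrow> C = C\<^sub>1" using *(2) M S.circ_iff_circuit by blast
    show "card M \<le> m" using *(3) M by simp
  next
    assume k4: "k = 4"
    note * = S.circuits_card_4[OF k4 C1]
    show "C\<^sub>1 = C\<^sub>s \<or> card (C\<^sub>1 \<inter> C\<^sub>s) = 2 \<and> card C\<^sub>1 = 4" using *(1) Cs by simp
    show "card M \<le> m + 1" using *(3) M by simp
    assume "(\<exists>C \<subseteq> M. circuit (m - 1) C \<and> C \<noteq> C\<^sub>1) \<and> C\<^sub>1 \<noteq> C\<^sub>s"
    then obtain C where C: "C \<subseteq> multiple_fibers A" "S.H.circ_mod_e C" "C \<noteq> C\<^sub>1" "C\<^sub>1 \<noteq> C\<^sub>s"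
      using M S.circ_iff_circuit by blast
    have "{D. D \<subseteq> multiple_fibers A \<and> S.H.circ_mod_e D} = {C\<^sub>1, C\<^sub>s, sym_diff C\<^sub>1 C\<^sub>s} \<and>
        card {D. D \<subseteq> multiple_fibers A \<and> S.H.circ_mod_e D} = 3"
      using *(2)[OF C(1-3)] C(4) unfolding Cs by blast
    then show "{C. C \<subseteq> M \<and> circuit (m - 1) C} = {C\<^sub>1, C\<^sub>s, sym_diff C\<^sub>1 C\<^sub>s}"
      "card {C. C \<subseteq> M \<and> circuit (m - 1) C} = 3"
      unfolding M fam by blast+
  qed
qed

end
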